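(* Let $R$ be a unital ring and let $n\in\mathbb{N}$ (that is, $n\geq 1$). Then there exists a $\frac1n$-automorphism $\xi$ in $\mathcal{T}^{\langle t\rangle}(\mathbb{R})$ such that $\mathbb{U}([\xi])=[t]$ in $K_1(R[t,t^{-1}])$.
   Context: $\langle t\rangle$ is the infinite cyclic group acting freely on $\mathbb{R}$ with $t$ acting by $x\mapsto x+1$; its group ring is $R\langle t\rangle=R[t,t^{-1}]$. A geometric $R$-module over $\mathbb{R}$ is a family $A=(A_x)_{x\in \mathbb{R}}$ of finitely generated free $R$-modules whose support $\{x: A_x\neq 0\}$ is locally finite in $\mathbb{R}$. A morphism $\varphi:A\to B$ is a family of $R$-module maps $\varphi_x^y:A_x\to B_y$ such that for every $y$ the set $\{x:\varphi_x^y\ne0\}$ is finite and for every $x$ the set $\{y:\varphi_x^y\neq 0\}$ is finite; composition is matrix multiplication; $\operatorname{supp}(\varphi)=\{(x,y):\varphi_x^y\neq0\}$. $A$ is $\langle t\rangle$-invariant if $A_{x+1}=A_x$ for all $x$, and $\varphi$ is $\langle t\rangle$-invariant if $\varphi_{x+1}^{y+1}=\varphi_x^y$ for all $x,y$. $\mathcal{T}^{\langle t\rangle}(\mathbb{R})$ is the category of $\langle t\rangle$-invariant geometric $R$-modules over $\mathbb{R}$ (with support contained in $\langle t\rangle\cdot K$ for some compact $K$) and $\langle t\rangle$-invariant morphisms. The functor $\mathbb{U}$ from $\mathcal{T}^{\langle t\rangle}(\mathbb{R})$ to finitely generated free $R[t,t^{-1}]$-modules forgets geometry: $\mathbb{U}(A)=\bigoplus_{x\in\mathbb{R}}A_x$,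 where $t$ acts by carrying the summand $A_x$ identically to $A_{x+1}=A_x$, and $\mathbb{U}(\varphi)$ is the map with components $\varphi_x^y$. It is an equivalence of categories; the induced isomorphism $K_1(\mathcal{T}^{\langle t\rangle}(\mathbb{R}))\to K_1(R[t,t^{-1}])$ is also denoted $\mathbb{U}$. Here $[t]$ is the class of $t\in\mathrm{GL}_1(R[t,t^{-1}])$. For $\epsilon>0$, a morphism $\varphi$ is $\epsilon$-controlled if $|x-y|<\epsilon$ for all $(x,y)\in\operatorname{supp}(\varphi)$. An $\epsilon$-automorphism is an automorphism $\varphi$ such that $\varphi$ and $\varphi^{-1}$ are both $\epsilon$-controlled. *)

theory Defs
  imports
    Complex_Main
    "HOL-Algebra.Module"
    "HOL-Algebra.Generated_Groups"
    "HOL-Algebra.Free_Abelian_Groups"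
begin

section \<open>Finitely generated free modules over a noncommutative ring\<close>

text \<open>
  The locale \<open>module\<close> of HOL-Algebra is restricted to commutative scalars.  We keep its record type
  (whose \<open>mult\<close> and \<open>one\<close> fields are ignored, as they are there) and let the scalars be a type of
  class \<open>ring_1\<close>.  All modules are left modules.
\<close>

locale left_module = abelian_group M
  for M :: "('r::ring_1, 'm) module" (structure) +
  assumes smult_closed: "x \<in> carrier M \<Longrightarrow> r \<odot> x \<in> carrier M"
    and smult_l_distr: "x \<in> carrier M \<Longrightarrow> (r + s) \<odot> x = r \<odot> x \<oplus> s \<odot> x"
    and smult_r_distr:
      "x \<in> carrier M \<Longrightarrow> y \<in> carrier M \<Longrightarrow> r \<odot> (x \<oplus> y) = r \<odot> x \<oplus> r \<odot> y"
    and smult_assoc: "x \<in> carrier M \<Longrightarrow> (r * s) \<odot> x = r \<odot> (s \<odot> x)"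
    and smult_one: "x \<in> carrier M \<Longrightarrow> 1 \<odot> x = x"

definition lincomb :: "('r::ring_1, 'm) module \<Rightarrow> 'm list \<Rightarrow> (nat \<Rightarrow> 'r) \<Rightarrow> 'm" where
  "lincomb M bs c = (\<Oplus>\<^bsub>M\<^esub>i\<in>{..<length bs}. c i \<odot>\<^bsub>M\<^esub> (bs ! i))"

definition is_basis :: "('r::ring_1, 'm) module \<Rightarrow> 'm list \<Rightarrow> bool" where
  "is_basis M bs \<longleftrightarrow> set bs \<subseteq> carrier M \<and>
     (\<forall>m\<in>carrier M. \<exists>!c. c \<in> {..<length bs} \<rightarrow>\<^sub>E UNIV \<and> m = lincomb M bs c)"

definition fg_free :: "('r::ring_1, 'm) module \<Rightarrow> bool" where
  "fg_free M \<longleftrightarrow> left_module M \<and> (\<exists>bs. is_basis M bs)"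

text \<open>Linear maps are extensional, so that equality of functions is equality of linear maps.\<close>

definition lin_hom :: "('r::ring_1, 'm) module \<Rightarrow> ('r, 'm) module \<Rightarrow> ('m \<Rightarrow> 'm) set" where
  "lin_hom M N = {f \<in> carrier M \<rightarrow>\<^sub>E carrier N.
     (\<forall>a\<in>carrier M. \<forall>b\<in>carrier M. f (a \<oplus>\<^bsub>M\<^esub> b) = f a \<oplus>\<^bsub>N\<^esub> f b) \<and>
     (\<forall>r. \<forall>a\<in>carrier M. f (r \<odot>\<^bsub>M\<^esub> a) = r \<odot>\<^bsub>N\<^esub> f a)}"


section \<open>The functor \<open>K\<^sub>1\<close> of a ring\<close>

text \<open>
  \<open>GL(R)\<close> is the union of the groups \<open>GL\<^sub>n(R)\<close> along \<open>M \<mapsto> M \<oplus> 1\<close>, realised as the group of units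
  of the monoid of those infinite matrices that agree with the identity outside a finite square
  block; \<open>K\<^sub>1(R)\<close> is its abelianisation.
\<close>

definition stabilize :: "nat \<Rightarrow> (nat \<Rightarrow> nat \<Rightarrow> 'a::ring_1) \<Rightarrow> nat \<Rightarrow> nat \<Rightarrow> 'a" where
  "stabilize n M = (\<lambda>i j. if i < n \<and> j < n then M i j else if i = j then 1 else 0)"

definition stable_matrices :: "(nat \<Rightarrow> nat \<Rightarrow> 'a::ring_1) monoid" where
  "stable_matrices =
     \<lparr>carrier = {M. \<exists>n. M = stabilize n M},
      monoid.mult = (\<lambda>M N i k. \<Sum>j | M i j \<noteq> 0. M i j * N j k),
      one = (\<lambda>i j. if i = j then 1 else 0)\<rparr>"

definition GL :: "(nat \<Rightarrow> nat \<Rightarrow> 'a::ring_1) monoid" where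
  "GL = units_of stable_matrices"

definition K1 :: "(nat \<Rightarrow> nat \<Rightarrow> 'a::ring_1) set monoid" where
  "K1 = GL Mod derived GL (carrier GL)"

definition K1_matrix_class :: "nat \<Rightarrow> (nat \<Rightarrow> nat \<Rightarrow> 'a::ring_1) \<Rightarrow> (nat \<Rightarrow> nat \<Rightarrow> 'a) set" where
  "K1_matrix_class n M = derived GL (carrier GL) #>\<^bsub>GL\<^esub> stabilize n M"

definition K1_unit_class :: "'a::ring_1 \<Rightarrow> (nat \<Rightarrow> nat \<Rightarrow> 'a) set" where
  "K1_unit_class u = K1_matrix_class 1 (\<lambda>_ _. u)"

text \<open>
  The matrix of an endomorphism \<open>\<alpha>\<close> of a free left module has the coordinates of \<open>\<alpha>(b\<^sub>i)\<close> as its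
  \<open>i\<close>-th row; this reverses products, which is immaterial in \<open>K\<^sub>1\<close>.
\<close>

definition coords :: "('r::ring_1, 'm) module \<Rightarrow> 'm list \<Rightarrow> 'm \<Rightarrow> nat \<Rightarrow> 'r" where
  "coords M bs m = (THE c. c \<in> {..<length bs} \<rightarrow>\<^sub>E UNIV \<and> m = lincomb M bs c)"

definition matrix_of ::
    "('r::ring_1, 'm) module \<Rightarrow> 'm list \<Rightarrow> ('m \<Rightarrow> 'm) \<Rightarrow> nat \<Rightarrow> nat \<Rightarrow> 'r" where
  "matrix_of M bs \<alpha> = (\<lambda>i. coords M bs (\<alpha> (bs ! i)))"

text \<open>
  The class in \<open>K\<^sub>1\<close> of an automorphism of a finitely generated free module: the class of its matrix
  in a basis.  It does not depend on the basis, even if bases of different length exist.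
\<close>

definition K1_aut_class ::
    "('r::ring_1, 'm) module \<Rightarrow> ('m \<Rightarrow> 'm) \<Rightarrow> (nat \<Rightarrow> nat \<Rightarrow> 'r) set" where
  "K1_aut_class M \<alpha> =
     (THE c. \<exists>bs. is_basis M bs \<and> c = K1_matrix_class (length bs) (matrix_of M bs \<alpha>))"


section \<open>Geometric modules over the real line\<close>

type_synonym ('r, 'm) gmod = "real \<Rightarrow> ('r, 'm) module"
type_synonym 'm gmor = "real \<Rightarrow> real \<Rightarrow> 'm \<Rightarrow> 'm"  \<comment> \<open>\<open>\<phi> x y\<close> is the component \<open>A\<^sub>x \<rightarrow> B\<^sub>y\<close>\<close>

definition gsupport :: "('r, 'm) gmod \<Rightarrow> real set" where
  "gsupport A = {x. carrier (A x) \<noteq> {\<zero>\<^bsub>A x\<^esub>}}"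

definition geometric_module :: "('r::ring_1, 'm) gmod \<Rightarrow> bool" where
  "geometric_module A \<longleftrightarrow> (\<forall>x. fg_free (A x)) \<and>
     (\<forall>x. \<exists>W. open W \<and> x \<in> W \<and> finite (W \<inter> gsupport A))"

definition supp :: "('r, 'm) gmod \<Rightarrow> ('r, 'm) gmod \<Rightarrow> 'm gmor \<Rightarrow> (real \<times> real) set" where
  "supp A B \<phi> = {(x, y). \<exists>a\<in>carrier (A x). \<phi> x y a \<noteq> \<zero>\<^bsub>B y\<^esub>}"

definition geometric_morphism ::
    "('r::ring_1, 'm) gmod \<Rightarrow> ('r, 'm) gmod \<Rightarrow> 'm gmor \<Rightarrow> bool" where
  "geometric_morphism A B \<phi> \<longleftrightarrow> (\<forall>x y. \<phi> x y \<in> lin_hom (A x) (B y)) \<and>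
     (\<forall>y. finite {x. (x, y) \<in> supp A B \<phi>}) \<and> (\<forall>x. finite {y. (x, y) \<in> supp A B \<phi>})"

definition gcomp ::
    "('r, 'm) gmod \<Rightarrow> ('r, 'm) gmod \<Rightarrow> ('r, 'm) gmod \<Rightarrow> 'm gmor \<Rightarrow> 'm gmor \<Rightarrow> 'm gmor" where
  "gcomp A B C \<psi> \<phi> = (\<lambda>x z. \<lambda>a\<in>carrier (A x).
     \<Oplus>\<^bsub>C z\<^esub>y\<in>{y. (x, y) \<in> supp A B \<phi>}. \<psi> y z (\<phi> x y a))"

definition gid :: "('r, 'm) gmod \<Rightarrow> 'm gmor" where
  "gid A = (\<lambda>x y. \<lambda>a\<in>carrier (A x). if x = y then a else \<zero>\<^bsub>A y\<^esub>)"

definition gadd :: "('r, 'm) gmod \<Rightarrow> ('r, 'm) gmod \<Rightarrow> 'm gmor \<Rightarrow> 'm gmor \<Rightarrow> 'm gmor" where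
  "gadd A B \<phi> \<psi> = (\<lambda>x y. \<lambda>a\<in>carrier (A x). \<phi> x y a \<oplus>\<^bsub>B y\<^esub> \<psi> x y a)"


section \<open>The category of invariant geometric modules\<close>

definition T_obj :: "('r::ring_1, 'm) gmod set" where
  "T_obj = {A. geometric_module A \<and> (\<forall>x. A (x + 1) = A x) \<and>
     (\<exists>K. compact K \<and> gsupport A \<subseteq> {x + of_int k |x k. x \<in> K})}"

definition T_hom :: "('r::ring_1, 'm) gmod \<Rightarrow> ('r, 'm) gmod \<Rightarrow> 'm gmor set" where
  "T_hom A B = {\<phi>. geometric_morphism A B \<phi> \<and> (\<forall>x y. \<phi> (x + 1) (y + 1) = \<phi> x y)}"

definition T_inverse :: "('r::ring_1, 'm) gmod \<Rightarrow> 'm gmor \<Rightarrow> 'm gmor \<Rightarrow> bool" where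
  "T_inverse A \<phi> \<psi> \<longleftrightarrow> \<phi> \<in> T_hom A A \<and> \<psi> \<in> T_hom A A \<and>
     gcomp A A A \<psi> \<phi> = gid A \<and> gcomp A A A \<phi> \<psi> = gid A"

definition T_Aut :: "(('r::ring_1, 'm) gmod \<times> 'm gmor) set" where
  "T_Aut = {(A, \<phi>). A \<in> T_obj \<and> (\<exists>\<psi>. T_inverse A \<phi> \<psi>)}"

definition controlled ::
    "real \<Rightarrow> ('r, 'm) gmod \<Rightarrow> ('r, 'm) gmod \<Rightarrow> 'm gmor \<Rightarrow> bool" where
  "controlled \<epsilon> A B \<phi> \<longleftrightarrow> (\<forall>(x, y)\<in>supp A B \<phi>. \<bar>x - y\<bar> < \<epsilon>)"

definition eps_automorphism :: "real \<Rightarrow> ('r::ring_1, 'm) gmod \<Rightarrow> 'm gmor \<Rightarrow> bool" where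
  "eps_automorphism \<epsilon> A \<phi> \<longleftrightarrow> A \<in> T_obj \<and>
     (\<exists>\<psi>. T_inverse A \<phi> \<psi> \<and> controlled \<epsilon> A A \<phi> \<and> controlled \<epsilon> A A \<psi>)"


section \<open>\<open>K\<^sub>1\<close> of the category of invariant geometric modules\<close>

text \<open>
  As for every additive category, \<open>K\<^sub>1\<close> is the abelian group generated by the automorphisms, with
  relations \<open>[\<psi> \<circ> \<phi>] = [\<psi>] + [\<phi>]\<close> and \<open>[\<chi>] = [\<phi>] + [\<psi>]\<close> whenever \<open>\<chi>\<close> is (isomorphic to) the direct
  sum of \<open>\<phi>\<close> and \<open>\<psi>\<close>.  The latter includes invariance under conjugation by isomorphisms.
\<close>

definition T_direct_sum ::
    "('r::ring_1, 'm) gmod \<Rightarrow> 'm gmor \<Rightarrow> ('r, 'm) gmod \<Rightarrow> 'm gmor \<Rightarrow>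
     ('r, 'm) gmod \<Rightarrow> 'm gmor \<Rightarrow> bool" where
  "T_direct_sum A \<phi> B \<psi> C \<chi> \<longleftrightarrow>
     (\<exists>i\<in>T_hom A C. \<exists>j\<in>T_hom B C. \<exists>p\<in>T_hom C A. \<exists>q\<in>T_hom C B.
        gcomp A C A p i = gid A \<and> gcomp B C B q j = gid B \<and>
        gadd C C (gcomp C A C i p) (gcomp C B C j q) = gid C \<and>
        gcomp A C C \<chi> i = gcomp A A C i \<phi> \<and> gcomp B C C \<chi> j = gcomp B B C j \<psi>)"

definition K1_T_relations :: "((('r::ring_1, 'm) gmod \<times> 'm gmor) \<Rightarrow>\<^sub>0 int) set" where
  "K1_T_relations =
     {frag_of (A, gcomp A A A \<psi> \<phi>) - frag_of (A, \<psi>) - frag_of (A, \<phi>) |A \<phi> \<psi>.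
        (A, \<phi>) \<in> T_Aut \<and> (A, \<psi>) \<in> T_Aut} \<union>
     {frag_of (C, \<chi>) - frag_of (A, \<phi>) - frag_of (B, \<psi>) |A \<phi> B \<psi> C \<chi>.
        (A, \<phi>) \<in> T_Aut \<and> (B, \<psi>) \<in> T_Aut \<and> (C, \<chi>) \<in> T_Aut \<and> T_direct_sum A \<phi> B \<psi> C \<chi>}"

definition K1_T_kernel :: "((('r::ring_1, 'm) gmod \<times> 'm gmor) \<Rightarrow>\<^sub>0 int) set" where
  "K1_T_kernel = generate (free_Abelian_group T_Aut) K1_T_relations"

definition K1_T :: "((('r::ring_1, 'm) gmod \<times> 'm gmor) \<Rightarrow>\<^sub>0 int) set monoid" where
  "K1_T = free_Abelian_group T_Aut Mod K1_T_kernel"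

definition K1_T_class ::
    "('r::ring_1, 'm) gmod \<Rightarrow> 'm gmor \<Rightarrow> ((('r, 'm) gmod \<times> 'm gmor) \<Rightarrow>\<^sub>0 int) set" where
  "K1_T_class A \<phi> = K1_T_kernel #>\<^bsub>free_Abelian_group T_Aut\<^esub> frag_of (A, \<phi>)"


section \<open>The functor forgetting geometry\<close>

text \<open>
  \<^typ>\<open>int \<Rightarrow>\<^sub>0 'r\<close> with its convolution product is the group ring \<open>R[t, t\<^sup>-\<^sup>1]\<close>.  Since
  \<open>t\<^sup>k\<close> carries the summand at \<open>x - k\<close> identically to the summand at \<open>x\<close>, the component at \<open>x\<close>
  of \<open>(\<Sum>\<^sub>k r\<^sub>k t\<^sup>k) f\<close> is \<open>\<Sum>\<^sub>k r\<^sub>k f(x - k)\<close>.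
\<close>

definition laurent_t :: "int \<Rightarrow>\<^sub>0 'r::ring_1" where
  "laurent_t = Poly_Mapping.single 1 1"

definition U_obj :: "('r::ring_1, 'm) gmod \<Rightarrow> (int \<Rightarrow>\<^sub>0 'r, real \<Rightarrow> 'm) module" where
  "U_obj A =
     \<lparr>carrier = {f. (\<forall>x. f x \<in> carrier (A x)) \<and> finite {x. f x \<noteq> \<zero>\<^bsub>A x\<^esub>}},
      monoid.mult = undefined, monoid.one = undefined,
      ring.zero = (\<lambda>x. \<zero>\<^bsub>A x\<^esub>),
      ring.add = (\<lambda>f g x. f x \<oplus>\<^bsub>A x\<^esub> g x),
      module.smult = (\<lambda>p f x. \<Oplus>\<^bsub>A x\<^esub>k\<in>Poly_Mapping.keys p.
        Poly_Mapping.lookup p k \<odot>\<^bsub>A x\<^esub> f (x - of_int k))\<rparr>"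

definition U_map :: "('r::ring_1, 'm) gmod \<Rightarrow> ('r, 'm) gmod \<Rightarrow> 'm gmor \<Rightarrow>
    (real \<Rightarrow> 'm) \<Rightarrow> real \<Rightarrow> 'm" where
  "U_map A B \<phi> = (\<lambda>f\<in>carrier (U_obj A). \<lambda>y.
     \<Oplus>\<^bsub>B y\<^esub>x\<in>{x. f x \<noteq> \<zero>\<^bsub>A x\<^esub>}. \<phi> x y (f x))"

text \<open>
  The homomorphism induced on \<open>K\<^sub>1\<close>: extend \<open>(A, \<phi>) \<mapsto> [U(\<phi>)]\<close> to the free abelian group on the
  automorphisms; the extension is constant on the cosets that make up \<open>K1_T\<close>.
\<close>

definition U_free :: "((('r::ring_1, 'm) gmod \<times> 'm gmor) \<Rightarrow>\<^sub>0 int) \<Rightarrow>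
    (nat \<Rightarrow> nat \<Rightarrow> (int \<Rightarrow>\<^sub>0 'r)) set" where
  "U_free c = (\<Otimes>\<^bsub>K1\<^esub>a\<in>Poly_Mapping.keys c.
     K1_aut_class (U_obj (fst a)) (U_map (fst a) (fst a) (snd a)) [^]\<^bsub>K1\<^esub> Poly_Mapping.lookup c a)"

definition U_K1 :: "((('r::ring_1, 'm) gmod \<times> 'm gmor) \<Rightarrow>\<^sub>0 int) set \<Rightarrow>
    (nat \<Rightarrow> nat \<Rightarrow> (int \<Rightarrow>\<^sub>0 'r)) set" where
  "U_K1 C = the_elem (U_free ` C)"

text \<open>
  To speak of all geometric modules over a ring in one type, their elements are drawn from
  sequences in the ring.  Every finitely generated free module is isomorphic to one carried by
  such a set, as \<open>R\<^sup>n\<close> consists of the sequences vanishing from \<open>n\<close> on.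
\<close>

type_synonym 'r geometric = "('r, nat \<Rightarrow> 'r) gmod"
type_synonym 'r geometric_mor = "(nat \<Rightarrow> 'r) gmor"

end

(*
  Let xi be the shift by 1/m on the geometric module with one copy of R at each point of (1/m)Z,
  where m = 2n + 1 (so 1/m < 1/n).  On the basis at the points -i/m, 0 <= i < m, its matrix is
  diag(t, 1, ..., 1) times the permutation matrix of a cycle of odd length m.  A cycle of odd length
  is the square of a power s of itself, and s is conjugate to its inverse by a reflection;
  so the permutation matrix is a commutator and the class of the matrix is [t].

  To compare with the definition of U on K_1, the class of an automorphism must be independent of
  the basis and compatible with compositions and direct sums.  Both follow from one construction:
  if b_i are elements and f_i functionals of a module M with m = sum_i f_i(m) b_i, an automorphism
  alpha acts as (f_j(alpha b_i)) on a direct summand of the free module of infinite rank, and as the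
  identity on the complement.  Two such embeddings with disjoint index sets are exchanged by an
  involution, and any two can be compared with a third one that is disjoint from both.
*)
theory Submission
  imports Defs
begin

section \<open>Row-finite matrices and \<open>K\<^sub>1\<close>\<close>

text \<open>\<open>U_K1\<close> takes \<open>the_elem\<close> of the image of a coset, so it has a
  meaningful value only once \<open>U_free\<close> kills every relation, including those from direct
  sums. The obstacle is that ranks are not well behaved: \<open>R[t, t^-1]\<close> may lack
  invariant basis number, so bases of one module can differ in length, and a direct sum
  decomposition comes with maps but not with adapted bases. Hence all comparisons take place inside
  one ring of infinite matrices, by identities between idempotents, where sizes are never compared.

  The cycle must have odd length: a cycle of even length contributes the class of -1, and the result
  would be the class of -t. Any odd m > n would do; 2n + 1 is a uniform choice. The base points are
  -i/m rather than i/m so that the shift lowers the index and wraps around at i = 0, which puts t in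
  the first row, exactly where \<open>K1_unit_class\<close> has it.\<close>

typedef (overloaded) 'a rfmat =
  "{M :: nat \<Rightarrow> nat \<Rightarrow> 'a::ring_1. \<forall>i. finite {j. M i j \<noteq> 0}}"
  morphisms entry Rfmat
  by (rule exI [of _ "\<lambda>_ _. 0"]) simp

setup_lifting type_definition_rfmat

lemma finite_row: "finite {j. entry M i j \<noteq> 0}"
  using entry [of M] by simp

lemma sum_row_superset:
  fixes f g :: "nat \<Rightarrow> 'a::ring_1"
  assumes "finite J" "{j. f j \<noteq> 0} \<subseteq> J"
  shows "(\<Sum>j | f j \<noteq> 0. f j * g j) = (\<Sum>j\<in>J. f j * g j)"
  using assms by (intro sum.mono_neutral_left) auto

lemma finite_row_product:
  fixes f :: "nat \<Rightarrow> 'a::ring_1"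
  assumes "finite {j. f j \<noteq> 0}" "\<And>j. finite {k. N j k \<noteq> 0}"
  shows "finite {k. (\<Sum>j | f j \<noteq> 0. f j * N j k) \<noteq> 0}"
proof (rule finite_subset)
  show "{k. (\<Sum>j | f j \<noteq> 0. f j * N j k) \<noteq> 0} \<subseteq> (\<Union>j\<in>{j. f j \<noteq> 0}. {k. N j k \<noteq> 0})"
  proof clarify
    fix k assume nz: "(\<Sum>j | f j \<noteq> 0. f j * N j k) \<noteq> 0"
    show "k \<in> (\<Union>j\<in>{j. f j \<noteq> 0}. {k. N j k \<noteq> 0})"
    proof (rule ccontr)
      assume "\<not> ?thesis"
      then have "(\<Sum>j | f j \<noteq> 0. f j * N j k) = 0"
        by (intro sum.neutral) auto
      with nz show False by simp
    qed
  qed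
qed (use assms in simp)

text \<open>\<open>GL\<close> consists of units of a monoid that is not closed under sums.
  Row-finite matrices form a ring around it with the infinite identity as unit, so that expressions
  such as \<open>1 - e + a\<close> make sense and their identities follow from the ring
  laws.\<close>

instantiation rfmat :: (ring_1) ring_1
begin

lift_definition zero_rfmat :: "'a rfmat" is "\<lambda>_ _. 0" by simp
lift_definition one_rfmat :: "'a rfmat" is "\<lambda>i j. if i = j then 1 else 0" by simp
lift_definition plus_rfmat :: "'a rfmat \<Rightarrow> 'a rfmat \<Rightarrow> 'a rfmat" is "\<lambda>M N i j. M i j + N i j"
proof -
  fix M N :: "nat \<Rightarrow> nat \<Rightarrow> 'a" and i
  assume "\<And>i. finite {j. M i j \<noteq> 0}" "\<And>i. finite {j. N i j \<noteq> 0}"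
  then show "finite {j. M i j + N i j \<noteq> 0}"
    by (auto intro: rev_finite_subset [of "{j. M i j \<noteq> 0} \<union> {j. N i j \<noteq> 0}"])
qed
lift_definition uminus_rfmat :: "'a rfmat \<Rightarrow> 'a rfmat" is "\<lambda>M i j. - M i j" by simp
lift_definition minus_rfmat :: "'a rfmat \<Rightarrow> 'a rfmat \<Rightarrow> 'a rfmat" is "\<lambda>M N i j. M i j - N i j"
proof -
  fix M N :: "nat \<Rightarrow> nat \<Rightarrow> 'a" and i
  assume "\<And>i. finite {j. M i j \<noteq> 0}" "\<And>i. finite {j. N i j \<noteq> 0}"
  then show "finite {j. M i j - N i j \<noteq> 0}"
    by (auto intro: rev_finite_subset [of "{j. M i j \<noteq> 0} \<union> {j. N i j \<noteq> 0}"])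
qed
lift_definition times_rfmat :: "'a rfmat \<Rightarrow> 'a rfmat \<Rightarrow> 'a rfmat"
  is "\<lambda>M N i k. \<Sum>j | M i j \<noteq> 0. M i j * N j k"
  by (intro allI finite_row_product) auto

lemma entry_times_superset:
  assumes "finite J" "{j. entry M i j \<noteq> 0} \<subseteq> J"
  shows "entry (M * N) i k = (\<Sum>j\<in>J. entry M i j * entry N j k)"
  using assms by (simp add: times_rfmat.rep_eq sum_row_superset)

instance
proof
  fix a b c :: "'a rfmat"
  show "a * b * c = a * (b * c)"
  proof (rule entry_inject [THEN iffD1], intro ext)
    fix i l
    define J where "J = {j. entry a i j \<noteq> 0}"
    \<comment> \<open>K contains the row supports needed by both groupings, so one finite double sum
      serves both and can be swapped.\<close>
    define K where "K = {k. entry (a * b) i k \<noteq> 0} \<union> (\<Union>j\<in>J. {k. entry b j k \<noteq> 0})"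
    have fin: "finite J" "finite K" by (simp_all add: J_def K_def finite_row)
    have "entry (a * b * c) i l = (\<Sum>k\<in>K. entry (a * b) i k * entry c k l)"
      by (rule entry_times_superset) (use fin in \<open>auto simp: K_def\<close>)
    also have "\<dots> = (\<Sum>k\<in>K. \<Sum>j\<in>J. entry a i j * (entry b j k * entry c k l))"
      by (simp add: entry_times_superset [OF fin(1), of a i b, unfolded J_def, OF subset_refl]
          sum_distrib_right mult.assoc J_def)
    also have "\<dots> = (\<Sum>j\<in>J. \<Sum>k\<in>K. entry a i j * (entry b j k * entry c k l))"
      by (rule sum.swap)
    also have "\<dots> = (\<Sum>j\<in>J. entry a i j * entry (b * c) j l)"
    proof (rule sum.cong [OF refl])
      fix j assume "j \<in> J"
      then have "entry (b * c) j l = (\<Sum>k\<in>K. entry b j k * entry c k l)"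
        by (intro entry_times_superset) (use fin in \<open>auto simp: K_def\<close>)
      then show "(\<Sum>k\<in>K. entry a i j * (entry b j k * entry c k l)) = entry a i j * entry (b * c) j l"
        by (simp add: sum_distrib_left)
    qed
    also have "\<dots> = entry (a * (b * c)) i l"
      by (rule entry_times_superset [symmetric]) (use fin in \<open>auto simp: J_def\<close>)
    finally show "entry (a * b * c) i l = entry (a * (b * c)) i l" .
  qed
  show "1 * a = a"
    by (rule entry_inject [THEN iffD1], intro ext,
        subst entry_times_superset, rule finite_row, rule subset_refl)
       (auto simp: one_rfmat.rep_eq)
  show "a * 1 = a"
  proof (rule entry_inject [THEN iffD1], intro ext)
    fix i k
    have "entry (a * 1) i k
      = (\<Sum>j\<in>insert k {j. entry a i j \<noteq> 0}. entry a i j * entry 1 j k)"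
      by (rule entry_times_superset) (auto simp: finite_row)
    also have "\<dots> = (\<Sum>j\<in>insert k {j. entry a i j \<noteq> 0}. if j = k then entry a i j else 0)"
      by (rule sum.cong) (auto simp: one_rfmat.rep_eq)
    also have "\<dots> = entry a i k" by (subst sum.delta) (auto simp: finite_row)
    finally show "entry (a * 1) i k = entry a i k" .
  qed
  show "(a + b) * c = a * c + b * c"
  proof (rule entry_inject [THEN iffD1], intro ext)
    fix i k
    define J where "J = {j. entry a i j \<noteq> 0} \<union> {j. entry b i j \<noteq> 0}"
    have fin: "finite J" by (simp add: J_def finite_row)
    have "entry ((a + b) * c) i k = (\<Sum>j\<in>J. entry (a + b) i j * entry c j k)"
      using fin by (intro entry_times_superset) (auto simp: J_def plus_rfmat.rep_eq)
    also have "\<dots> = (\<Sum>j\<in>J. entry a i j * entry c j k) + (\<Sum>j\<in>J. entry b i j * entry c j k)"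
      by (simp add: plus_rfmat.rep_eq distrib_right sum.distrib)
    also have "\<dots> = entry (a * c) i k + entry (b * c) i k"
      using fin by (intro arg_cong2 [where f = "(+)"] entry_times_superset [symmetric])
        (auto simp: J_def)
    finally show "entry ((a + b) * c) i k = entry (a * c + b * c) i k"
      by (simp add: plus_rfmat.rep_eq)
  qed
  show "a * (b + c) = a * b + a * c"
    by (rule entry_inject [THEN iffD1])
       (auto simp: fun_eq_iff times_rfmat.rep_eq plus_rfmat.rep_eq distrib_left sum.distrib)
  show "(0::'a rfmat) \<noteq> 1"
  proof
    assume "(0::'a rfmat) = 1"
    then have "entry (0::'a rfmat) 0 0 = entry 1 0 0" by simp
    then show False by (simp add: zero_rfmat.rep_eq one_rfmat.rep_eq)
  qed
  show "a + b + c = a + (b + c)" "a + b = b + a" "0 + a = a" "- a + a = 0" "a - b = a + - b"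
    by (rule entry_inject [THEN iffD1],
        simp add: fun_eq_iff plus_rfmat.rep_eq zero_rfmat.rep_eq uminus_rfmat.rep_eq
          minus_rfmat.rep_eq add.assoc add.commute)+
qed

end

lemma rfmat_eqI: "(\<And>i j. entry M i j = entry N i j) \<Longrightarrow> M = N"
  by (metis entry_inject ext)

lemmas entry_simps = zero_rfmat.rep_eq one_rfmat.rep_eq plus_rfmat.rep_eq uminus_rfmat.rep_eq
  minus_rfmat.rep_eq

section \<open>Stable matrices, GL and classes in K_1\<close>

definition stable :: "'a::ring_1 rfmat \<Rightarrow> bool" where
  "stable M \<longleftrightarrow> (\<exists>n. entry M = stabilize n (entry M))"

text \<open>The corner is a subring whose unit is not that of the whole ring; the stable matrices
  are exactly \<open>1 + X\<close> with \<open>X\<close> in some corner.\<close>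

definition block :: "nat \<Rightarrow> 'a::ring_1 rfmat \<Rightarrow> bool" where
  "block n M \<longleftrightarrow> (\<forall>i j. i \<ge> n \<or> j \<ge> n \<longrightarrow> entry M i j = 0)"

lemma entry_eq_stabilize_iff: "entry M = stabilize n (entry M) \<longleftrightarrow> block n (M - 1)"
proof -
  have "entry M = stabilize n (entry M) \<longleftrightarrow>
    (\<forall>i j. entry M i j = stabilize n (entry M) i j)" by (simp add: fun_eq_iff)
  also have "\<dots> \<longleftrightarrow> (\<forall>i j. i \<ge> n \<or> j \<ge> n \<longrightarrow> entry M i j = (if i = j then 1 else 0))"
    unfolding stabilize_def by (meson not_le)
  also have "\<dots> \<longleftrightarrow> block n (M - 1)" by (simp add: block_def entry_simps)
  finally show ?thesis .
qed

lemma stable_iff: "stable M \<longleftrightarrow> (\<exists>n. block n (M - 1))"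
  by (simp add: stable_def entry_eq_stabilize_iff)

lemma block_mono: "block m M \<Longrightarrow> m \<le> n \<Longrightarrow> block n M"
  by (auto simp: block_def)

lemma block_add: "block n M \<Longrightarrow> block n N \<Longrightarrow> block n (M + N)"
  and block_diff: "block n M \<Longrightarrow> block n N \<Longrightarrow> block n (M - N)"
  and block_zero: "block n 0"
  by (auto simp: block_def entry_simps)

lemma block_mult: "block n M \<Longrightarrow> block n N \<Longrightarrow> block n (M * N)"
  by (auto simp: block_def times_rfmat.rep_eq)

lemma stable_one: "stable 1"
  by (auto simp: stable_iff block_zero)

text \<open>For M = 1 + X and N = 1 + Y with X and Y in a common corner, M N - 1 = X Y + X + Y lies
  in that corner.\<close>

lemma stable_mult:
  assumes "stable M" "stable N"
  shows "stable (M * N)"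
proof -
  obtain m n where "block m (M - 1)" "block n (N - 1)" using assms by (auto simp: stable_iff)
  then have bl: "block (max m n) (M - 1)" "block (max m n) (N - 1)" by (auto intro: block_mono)
  have "M * N - 1 = (M - 1) * (N - 1) + ((M - 1) + (N - 1))" by (simp add: algebra_simps)
  then have "block (max m n) (M * N - 1)" using bl by (simp only: block_add block_mult)
  then show ?thesis by (auto simp: stable_iff)
qed

lemma finite_row_stabilize: "finite {j. stabilize n M i j \<noteq> 0}"
  by (rule finite_subset [of _ "{..<n} \<union> {i}"]) (auto simp: stabilize_def split: if_splits)

lemma entry_Rfmat_stabilize [simp]: "entry (Rfmat (stabilize n M)) = stabilize n M"
  by (simp add: Rfmat_inverse finite_row_stabilize)

lemma carrier_stable_matrices: "carrier stable_matrices = entry ` Collect stable"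
proof (intro equalityI subsetI)
  fix M :: "nat \<Rightarrow> nat \<Rightarrow> 'a" assume "M \<in> carrier stable_matrices"
  then obtain n where M: "M = stabilize n M" by (auto simp: stable_matrices_def)
  have "entry (Rfmat M) = M" by (subst (1 2) M) simp
  then show "M \<in> entry ` Collect stable"
    using M by (intro image_eqI [of _ _ "Rfmat M"]) (auto simp: stable_def)
qed (auto simp: stable_matrices_def stable_def)

lemma mult_stable_matrices: "entry M \<otimes>\<^bsub>stable_matrices\<^esub> entry N = entry (M * N)"
  by (simp add: stable_matrices_def times_rfmat.rep_eq)

lemma one_stable_matrices: "\<one>\<^bsub>stable_matrices\<^esub> = entry 1"
  by (simp add: stable_matrices_def one_rfmat.rep_eq)

lemma monoid_stable_matrices: "Group.monoid (stable_matrices :: (nat \<Rightarrow> nat \<Rightarrow> 'a::ring_1) monoid)"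
  by (unfold_locales)
     (auto simp: carrier_stable_matrices mult_stable_matrices one_stable_matrices
        stable_mult stable_one mult.assoc)

lemma group_GL: "group (GL :: (nat \<Rightarrow> nat \<Rightarrow> 'a::ring_1) monoid)"
  unfolding GL_def by (rule monoid.units_group [OF monoid_stable_matrices])

lemma comm_group_K1: "comm_group (K1 :: (nat \<Rightarrow> nat \<Rightarrow> 'a::ring_1) set monoid)"
  unfolding K1_def by (rule group.derived_quot_is_comm_group [OF group_GL])

interpretation K1: comm_group "K1 :: (nat \<Rightarrow> nat \<Rightarrow> 'a::ring_1) set monoid"
  by (rule comm_group_K1)

definition is_GL :: "'a::ring_1 rfmat \<Rightarrow> bool" where
  "is_GL M \<longleftrightarrow> entry M \<in> carrier GL"

lemma is_GL_iff:
  "is_GL M \<longleftrightarrow> stable M \<and> (\<exists>N. stable N \<and> M * N = 1 \<and> N * M = 1)"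
  unfolding is_GL_def GL_def units_of_carrier Units_def carrier_stable_matrices
  by (auto simp: mult_stable_matrices one_stable_matrices entry_inject)

lemma is_GLI: "stable M \<Longrightarrow> stable N \<Longrightarrow> M * N = 1 \<Longrightarrow> N * M = 1 \<Longrightarrow> is_GL M"
  by (auto simp: is_GL_iff)

lemma mult_GL: "entry M \<otimes>\<^bsub>GL\<^esub> entry N = entry (M * N)"
  by (simp add: GL_def units_of_mult mult_stable_matrices)

lemma is_GL_mult: "is_GL M \<Longrightarrow> is_GL N \<Longrightarrow> is_GL (M * N)"
  using group.subgroup_self [OF group_GL, THEN subgroup.m_closed]
  by (auto simp: is_GL_def mult_GL [symmetric])

definition K1_class :: "'a::ring_1 rfmat \<Rightarrow> (nat \<Rightarrow> nat \<Rightarrow> 'a) set" where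
  "K1_class M = derived GL (carrier GL) #>\<^bsub>GL\<^esub> entry M"

lemma K1_class_closed: "is_GL M \<Longrightarrow> K1_class M \<in> carrier K1"
  by (auto simp: K1_class_def K1_def FactGroup_def RCOSETS_def is_GL_def)

lemma K1_class_mult:
  assumes "is_GL M" "is_GL N"
  shows "K1_class (M * N) = K1_class M \<otimes>\<^bsub>K1\<^esub> K1_class N"
proof -
  have "normal (derived GL (carrier GL)) (GL :: (nat \<Rightarrow> nat \<Rightarrow> 'a) monoid)"
    by (simp add: group.derived_is_normal group.normal_self group_GL)
  from normal.rcos_sum [OF this] assms show ?thesis
    by (simp add: K1_class_def K1_def FactGroup_def is_GL_def mult_GL)
qed

lemma K1_class_one: "K1_class 1 = \<one>\<^bsub>K1\<^esub>"
proof -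
  have "is_GL (1 :: 'a rfmat)" by (auto simp: is_GL_iff stable_one)
  then show ?thesis
    using K1_class_mult [of "1::'a rfmat" 1] K1_class_closed [of "1::'a rfmat"]
      comm_group.axioms(2) [OF comm_group_K1]
    by (metis group.l_cancel_one comm_group_def mult_1)
qed

text \<open>\<open>K1\<close> is commutative, so the class of \<open>T\<close> cancels. The
  hypothesis is an intertwining relation, which avoids writing the inverse of
  \<open>T\<close>.\<close>

lemma K1_class_conj:
  assumes "is_GL T" "is_GL M" "is_GL N" "T * M = N * T"
  shows "K1_class M = K1_class N"
proof -
  have "K1_class T \<otimes>\<^bsub>K1\<^esub> K1_class M = K1_class T \<otimes>\<^bsub>K1\<^esub> K1_class N"
    using assms K1.m_comm [of "K1_class T" "K1_class N"]
    by (simp add: K1_class_closed flip: K1_class_mult)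
  then show ?thesis using assms by (simp add: K1_class_closed)
qed

lemma K1_matrix_class_eq: "entry M = stabilize n P \<Longrightarrow> K1_matrix_class n P = K1_class M"
  by (simp add: K1_matrix_class_def K1_class_def)

text \<open>
  Orthogonal copies \<open>e11\<close> and \<open>e22\<close> of a module inside the free module of infinite rank are
  exchanged by the involution \<open>T\<close>, so the two ways of extending an endomorphism by the identity
  are conjugate.
\<close>

lemma matrix_units_swap:
  fixes e11 e12 e21 e22 a :: "'a::ring_1"
  assumes "e11 * e11 = e11" "e11 * e12 = e12" "e11 * e21 = 0" "e11 * e22 = 0"
    "e12 * e11 = 0" "e12 * e12 = 0" "e12 * e21 = e11" "e12 * e22 = e12"
    "e21 * e11 = e21" "e21 * e12 = e22" "e21 * e21 = 0" "e21 * e22 = 0"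
    "e22 * e11 = 0" "e22 * e12 = 0" "e22 * e21 = e21" "e22 * e22 = e22"
    and a: "e21 * a = b" "a * e11 = a" "a * e12 = b'" "a * e22 = 0" "e11 * a = a"
      "e22 * a = 0" "e12 * a = 0" "a * e21 = 0"
      "e12 * c = b'" "c * e21 = b" "e11 * c = 0" "c * e11 = 0" "c * e22 = c" "e22 * c = c"
      "e21 * c = 0" "c * e12 = 0"
  defines "T \<equiv> e12 + e21 + 1 - e11 - e22"
  shows "T * T = 1" "T * (1 - e11 + a) = (1 - e22 + c) * T"
  by (simp_all add: T_def algebra_simps assms(1-32))

section \<open>Automorphisms of finitely generated free modules\<close>

lemma (in left_module) smult_zero: "r \<odot> \<zero> = \<zero>"
proof -
  have "r \<odot> \<zero> \<oplus> r \<odot> \<zero> = r \<odot> \<zero>"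
    by (simp flip: smult_r_distr)
  then show ?thesis by (simp add: smult_closed)
qed

lemma (in left_module) zero_smult: "x \<in> carrier M \<Longrightarrow> 0 \<odot> x = \<zero>"
proof -
  assume x: "x \<in> carrier M"
  then have "0 \<odot> x \<oplus> 0 \<odot> x = 0 \<odot> x"
    by (simp flip: smult_l_distr)
  then show ?thesis using x by (simp add: smult_closed)
qed

section \<open>Linear maps and functionals\<close>

text \<open>Unlike \<open>lin_hom\<close>, this allows different element types and leaves values
  outside the carrier free, so composites are plain compositions without restriction.\<close>

definition left_linear :: "('r::ring_1, 'm) module \<Rightarrow> ('r, 'n) module \<Rightarrow> ('m \<Rightarrow> 'n) \<Rightarrow> bool" where
  "left_linear M N f \<longleftrightarrow> f \<in> carrier M \<rightarrow> carrier N \<and>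
     (\<forall>a\<in>carrier M. \<forall>b\<in>carrier M. f (a \<oplus>\<^bsub>M\<^esub> b) = f a \<oplus>\<^bsub>N\<^esub> f b) \<and>
     (\<forall>r. \<forall>a\<in>carrier M. f (r \<odot>\<^bsub>M\<^esub> a) = r \<odot>\<^bsub>N\<^esub> f a)"

definition functional :: "('r::ring_1, 'm) module \<Rightarrow> ('m \<Rightarrow> 'r) \<Rightarrow> bool" where
  "functional M f \<longleftrightarrow>
     (\<forall>a\<in>carrier M. \<forall>b\<in>carrier M. f (a \<oplus>\<^bsub>M\<^esub> b) = f a + f b) \<and>
     (\<forall>r. \<forall>a\<in>carrier M. f (r \<odot>\<^bsub>M\<^esub> a) = r * f a)"

lemma lin_hom_iff: "f \<in> lin_hom M N \<longleftrightarrow> left_linear M N f \<and> f \<in> extensional (carrier M)"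
  by (auto simp: lin_hom_def left_linear_def PiE_def)

lemma left_linear_closed: "left_linear M N f \<Longrightarrow> a \<in> carrier M \<Longrightarrow> f a \<in> carrier N"
  by (auto simp: left_linear_def)

lemma left_linear_add:
  "left_linear M N f \<Longrightarrow> a \<in> carrier M \<Longrightarrow> b \<in> carrier M \<Longrightarrow> f (a \<oplus>\<^bsub>M\<^esub> b) = f a \<oplus>\<^bsub>N\<^esub> f b"
  by (auto simp: left_linear_def)

lemma left_linear_smult: "left_linear M N f \<Longrightarrow> a \<in> carrier M \<Longrightarrow> f (r \<odot>\<^bsub>M\<^esub> a) = r \<odot>\<^bsub>N\<^esub> f a"
  by (auto simp: left_linear_def)

lemma left_linear_id: "left_linear M M (\<lambda>x. x)"
  by (auto simp: left_linear_def)

lemma left_linear_comp: "left_linear M N f \<Longrightarrow> left_linear N P g \<Longrightarrow> left_linear M P (\<lambda>x. g (f x))"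
  by (auto simp: left_linear_def Pi_iff)

lemma functional_comp: "left_linear M N f \<Longrightarrow> functional N g \<Longrightarrow> functional M (\<lambda>x. g (f x))"
  by (auto simp: left_linear_def functional_def Pi_iff)

lemma functional_add:
  "functional M f \<Longrightarrow> a \<in> carrier M \<Longrightarrow> b \<in> carrier M \<Longrightarrow> f (a \<oplus>\<^bsub>M\<^esub> b) = f a + f b"
  by (auto simp: functional_def)

lemma functional_smult: "functional M f \<Longrightarrow> a \<in> carrier M \<Longrightarrow> f (r \<odot>\<^bsub>M\<^esub> a) = r * f a"
  by (auto simp: functional_def)

lemma left_linear_zero:
  assumes "left_module M" "left_module N" "left_linear M N f"
  shows "f \<zero>\<^bsub>M\<^esub> = \<zero>\<^bsub>N\<^esub>"
proof -
  interpret M: left_module M by fact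
  interpret N: left_module N by fact
  have "f (0 \<odot>\<^bsub>M\<^esub> \<zero>\<^bsub>M\<^esub>) = 0 \<odot>\<^bsub>N\<^esub> f \<zero>\<^bsub>M\<^esub>"
    using assms(3) by (simp add: left_linear_smult)
  then show ?thesis using assms(3) by (simp add: M.zero_smult N.zero_smult left_linear_closed)
qed

lemma functional_zero:
  assumes "left_module M" "functional M f"
  shows "f \<zero>\<^bsub>M\<^esub> = 0"
proof -
  interpret M: left_module M by fact
  have "f (0 \<odot>\<^bsub>M\<^esub> \<zero>\<^bsub>M\<^esub>) = 0 * f \<zero>\<^bsub>M\<^esub>"
    using assms(2) M.zero_closed by (metis functional_smult)
  then show ?thesis by (simp add: M.zero_smult)
qed

lemma left_linear_finsum:
  assumes M: "left_module M" and N: "left_module N" and f: "left_linear M N f" and x: "x \<in> I \<rightarrow> carrier M"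
  shows "f (\<Oplus>\<^bsub>M\<^esub>i\<in>I. x i) = (\<Oplus>\<^bsub>N\<^esub>i\<in>I. f (x i))"
proof -
  interpret M: left_module M by fact
  interpret N: left_module N by fact
  show ?thesis using x
  proof (induction I rule: infinite_finite_induct)
    case (insert i I)
    then have "x i \<in> carrier M" "x \<in> I \<rightarrow> carrier M" by auto
    moreover from this have "(\<lambda>i. f (x i)) \<in> I \<rightarrow> carrier N" using f by (auto intro: left_linear_closed)
    ultimately show ?case using insert f by (simp add: left_linear_add left_linear_closed)
  qed (auto simp: left_linear_zero [OF M N f])
qed

lemma functional_finsum:
  assumes M: "left_module M" and f: "functional M f" and x: "x \<in> I \<rightarrow> carrier M"
  shows "f (\<Oplus>\<^bsub>M\<^esub>i\<in>I. x i) = (\<Sum>i\<in>I. f (x i))"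
proof -
  interpret M: left_module M by fact
  show ?thesis using x
  proof (induction I rule: infinite_finite_induct)
    case (insert i I)
    then have "x i \<in> carrier M" "x \<in> I \<rightarrow> carrier M" by auto
    then show ?case using insert f by (simp add: functional_add)
  qed (auto simp: functional_zero [OF M f])
qed

section \<open>Frames and their matrices\<close>

text \<open>
  A finite family \<open>b\<close> with functionals \<open>f\<close> such that \<open>m = \<Sum>\<^sub>i f\<^sub>i(m) b\<^sub>i\<close>.  Bases with their
  coordinate functionals are frames, but, unlike bases, frames pass to direct summands.
\<close>

definition frame ::
    "('r::ring_1, 'm) module \<Rightarrow> nat \<Rightarrow> (nat \<Rightarrow> 'm) \<Rightarrow> (nat \<Rightarrow> 'm \<Rightarrow> 'r) \<Rightarrow> bool" where
  "frame M n b f \<longleftrightarrow> (\<forall>i. b i \<in> carrier M) \<and> (\<forall>i. functional M (f i)) \<and>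
     (\<forall>i\<ge>n. b i = \<zero>\<^bsub>M\<^esub> \<and> f i = (\<lambda>_. 0)) \<and>
     (\<forall>m\<in>carrier M. m = (\<Oplus>\<^bsub>M\<^esub>i\<in>{..<n}. f i m \<odot>\<^bsub>M\<^esub> b i))"

text \<open>Vectors and functionals may come from different frames. With \<alpha> the identity, one
  frame gives an idempotent, and two frames give the off-diagonal matrix units between two embedded
  copies of the module.\<close>

definition frame_matrix :: "(nat \<Rightarrow> 'm) \<Rightarrow> ('m \<Rightarrow> 'm) \<Rightarrow> (nat \<Rightarrow> 'm \<Rightarrow> 'r::ring_1) \<Rightarrow> 'r rfmat" where
  "frame_matrix b \<alpha> f = Rfmat (\<lambda>i j. f j (\<alpha> (b i)))"

lemma frameD:
  assumes "frame M n b f"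
  shows "b i \<in> carrier M" "functional M (f i)" "i \<ge> n \<Longrightarrow> b i = \<zero>\<^bsub>M\<^esub>" "i \<ge> n \<Longrightarrow> f i = (\<lambda>_. 0)"
    "m \<in> carrier M \<Longrightarrow> m = (\<Oplus>\<^bsub>M\<^esub>i\<in>{..<n}. f i m \<odot>\<^bsub>M\<^esub> b i)"
  using assms by (auto simp: frame_def)

lemma entry_frame_matrix:
  assumes "frame M n c f"
  shows "entry (frame_matrix b \<alpha> f) i j = f j (\<alpha> (b i))"
proof -
  have "finite {j. f j (\<alpha> (b i)) \<noteq> 0}" for i
    by (rule finite_subset [of _ "{..<n}"]) (use frameD(4) [OF assms] in \<open>auto simp: not_le [symmetric]\<close>)
  then show ?thesis by (simp add: frame_matrix_def Rfmat_inverse)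
qed

lemma frame_expand_functional:
  assumes M: "left_module M" and b: "frame M n b f" and g: "functional M g" and m: "m \<in> carrier M"
  shows "g m = (\<Sum>i<n. f i m * g (b i))"
proof -
  interpret M: left_module M by fact
  have "g m = g (\<Oplus>\<^bsub>M\<^esub>i\<in>{..<n}. f i m \<odot>\<^bsub>M\<^esub> b i)" using frameD(5) [OF b m] by simp
  also have "\<dots> = (\<Sum>i<n. f i m * g (b i))"
    using frameD(1) [OF b]
    by (simp add: functional_finsum [OF M g] M.smult_closed functional_smult [OF g])
  finally show ?thesis .
qed

text \<open>The inner sum is the expansion of \<open>\<alpha> (c i)\<close> in the frame
  \<open>b\<close>, \<open>f\<close>. Rows hold coordinates, so the left factor acts first.\<close>

lemma frame_matrix_mult:
  assumes M: "left_module M" and b: "frame M n b f" and g: "frame M n' d g"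
    and c: "\<And>i. \<alpha> (c i) \<in> carrier M" and \<beta>: "left_linear M M \<beta>"
  shows "frame_matrix c \<alpha> f * frame_matrix b \<beta> g = frame_matrix c (\<lambda>x. \<beta> (\<alpha> x)) g"
proof (rule rfmat_eqI)
  fix i k
  have "entry (frame_matrix c \<alpha> f * frame_matrix b \<beta> g) i k = (\<Sum>j<n. f j (\<alpha> (c i)) * g k (\<beta> (b j)))"
    using frameD(4) [OF b]
    by (subst entry_times_superset [of "{..<n}"])
       (auto simp: entry_frame_matrix [OF b] entry_frame_matrix [OF g] not_le [symmetric])
  also have "\<dots> = g k (\<beta> (\<alpha> (c i)))"
    by (rule frame_expand_functional [OF M b functional_comp [OF \<beta> frameD(2) [OF g]] c, symmetric])
  finally show "entry (frame_matrix c \<alpha> f * frame_matrix b \<beta> g) i k =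
      entry (frame_matrix c (\<lambda>x. \<beta> (\<alpha> x)) g) i k"
    by (simp add: entry_frame_matrix [OF g])
qed

text \<open>Every index of the inner sum is dead on one side: either the functional
  \<open>f j\<close> is zero, or the vector \<open>c' j\<close> is and the linear maps after it keep
  it zero.\<close>

lemma frame_matrix_mult_disjoint:
  assumes M: "left_module M" and b: "frame M n b f" and g: "frame M n' d g"
    and \<beta>: "left_linear M M \<beta>" and disj: "\<And>i. c' i = \<zero>\<^bsub>M\<^esub> \<or> f i = (\<lambda>_. 0)"
  shows "frame_matrix c \<alpha> f * frame_matrix c' \<beta> g = 0"
proof (rule rfmat_eqI)
  fix i k
  have "f j (\<alpha> (c i)) * g k (\<beta> (c' j)) = 0" for j
    using disj [of j] functional_zero [OF M frameD(2) [OF g]] left_linear_zero [OF M M \<beta>] by auto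
  then show "entry (frame_matrix c \<alpha> f * frame_matrix c' \<beta> g) i k = entry 0 i k"
    by (simp add: times_rfmat.rep_eq entry_frame_matrix [OF b] entry_frame_matrix [OF g] entry_simps)
qed

text \<open>With e the idempotent of the frame and a the matrix of \<alpha>, this is 1 - e + a,
  where e a = a = a e. For a basis, e is the unit of a corner and the formula becomes ordinary
  stabilisation.\<close>

definition frame_aut :: "(nat \<Rightarrow> 'm) \<Rightarrow> (nat \<Rightarrow> 'm \<Rightarrow> 'r::ring_1) \<Rightarrow> ('m \<Rightarrow> 'm) \<Rightarrow> 'r rfmat" where
  "frame_aut b f \<alpha> = 1 - frame_matrix b (\<lambda>x. x) f + frame_matrix b \<alpha> f"

lemma block_frame_matrix:
  assumes M: "left_module M" and b: "frame M m b h" and f: "frame M n c f" and \<alpha>: "left_linear M M \<alpha>"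
  shows "block (max m n) (frame_matrix b \<alpha> f)"
  using frameD(3) [OF b] frameD(4) [OF f] functional_zero [OF M frameD(2) [OF f]]
    left_linear_zero [OF M M \<alpha>]
  by (auto simp: block_def entry_frame_matrix [OF f])

lemma stable_frame_aut:
  assumes "left_module M" "frame M n b f" "left_linear M M \<alpha>"
  shows "stable (frame_aut b f \<alpha>)"
proof -
  have "block n (frame_matrix b \<alpha> f - frame_matrix b (\<lambda>x. x) f)"
    using block_frame_matrix [OF assms(1,2,2)] assms(3) left_linear_id
    by (fastforce intro: block_diff)
  then show ?thesis by (auto simp: stable_iff frame_aut_def algebra_simps)
qed

text \<open>Since e fixes a and b on both sides, (1 - e + a)(1 - e + b) = 1 - e + a b.\<close>

lemma frame_aut_mult:
  assumes M: "left_module M" and b: "frame M n b f" and "left_linear M M \<alpha>" "left_linear M M \<beta>"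
  shows "frame_aut b f \<alpha> * frame_aut b f \<beta> = frame_aut b f (\<lambda>x. \<beta> (\<alpha> x))"
proof -
  have mult: "frame_matrix b \<gamma> f * frame_matrix b \<delta> f = frame_matrix b (\<lambda>x. \<delta> (\<gamma> x)) f"
    if "left_linear M M \<gamma>" "left_linear M M \<delta>" for \<gamma> \<delta>
    using that frameD(1) [OF b] by (intro frame_matrix_mult [OF M b b]) (auto simp: left_linear_closed)
  show ?thesis using assms(3,4)
    by (simp add: frame_aut_def algebra_simps mult left_linear_id)
qed

lemma frame_aut_cong:
  assumes "frame M n b f" "\<And>x. x \<in> carrier M \<Longrightarrow> \<alpha> x = \<beta> x"
  shows "frame_aut b f \<alpha> = frame_aut b f \<beta>"
  using assms(2) frameD(1) [OF assms(1)] by (simp add: frame_aut_def frame_matrix_def)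

lemma frame_aut_id: "frame_aut b f (\<lambda>x. x) = 1"
  by (simp add: frame_aut_def)

section \<open>Automorphisms and independence of the frame\<close>

definition automorphism :: "('r::ring_1, 'm) module \<Rightarrow> ('m \<Rightarrow> 'm) \<Rightarrow> bool" where
  "automorphism M \<alpha> \<longleftrightarrow> left_linear M M \<alpha> \<and>
     (\<exists>\<beta>. left_linear M M \<beta> \<and> (\<forall>x\<in>carrier M. \<alpha> (\<beta> x) = x \<and> \<beta> (\<alpha> x) = x))"

lemma is_GL_frame_aut:
  assumes M: "left_module M" and b: "frame M n b f" and "automorphism M \<alpha>"
  shows "is_GL (frame_aut b f \<alpha>)"
proof -
  obtain \<beta> where \<beta>: "left_linear M M \<alpha>" "left_linear M M \<beta>" "\<forall>x\<in>carrier M. \<alpha> (\<beta> x) = x \<and> \<beta> (\<alpha> x) = x"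
    using assms(3) by (auto simp: automorphism_def)
  show ?thesis
  proof (rule is_GLI)
    show "frame_aut b f \<alpha> * frame_aut b f \<beta> = 1" "frame_aut b f \<beta> * frame_aut b f \<alpha> = 1"
      using \<beta> frame_aut_cong [OF b, of "\<lambda>x. \<alpha> (\<beta> x)" "\<lambda>x. x"]
        frame_aut_cong [OF b, of "\<lambda>x. \<beta> (\<alpha> x)" "\<lambda>x. x"]
      by (auto simp: frame_aut_mult [OF M b] frame_aut_id)
  qed (use \<beta> in \<open>auto intro: stable_frame_aut [OF M b]\<close>)
qed

lemma K1_class_frame_aut_disjoint:
  assumes M: "left_module M" and b: "frame M n b f" and c: "frame M n' c g"
    and aut: "automorphism M \<alpha>"
    and disj: "\<And>i. b i = \<zero>\<^bsub>M\<^esub> \<and> f i = (\<lambda>_. 0) \<or> c i = \<zero>\<^bsub>M\<^esub> \<and> g i = (\<lambda>_. 0)"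
  shows "K1_class (frame_aut b f \<alpha>) = K1_class (frame_aut c g \<alpha>)"
proof -
  let ?e = "\<lambda>b f. frame_matrix b (\<lambda>x. x) f" and ?a = "\<lambda>b f. frame_matrix b \<alpha> f"
  \<comment> \<open>In the notation of \<open>matrix_units_swap\<close>, e11 is
    \<open>?e b f\<close>, e12 is \<open>?e b g\<close>, e21 is \<open>?e c f\<close> and e22 is
    \<open>?e c g\<close>.\<close>
  let ?T = "?e b g + ?e c f + 1 - ?e b f - ?e c g"
  have \<alpha>: "left_linear M M \<alpha>" using aut by (auto simp: automorphism_def)
  have mult: "frame_matrix d \<gamma> f * frame_matrix b \<delta> h = frame_matrix d (\<lambda>x. \<delta> (\<gamma> x)) h"
      "frame_matrix d \<gamma> g * frame_matrix c \<delta> h = frame_matrix d (\<lambda>x. \<delta> (\<gamma> x)) h"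
    if "left_linear M M \<gamma>" "left_linear M M \<delta>" "d = b \<or> d = c" "h = f \<or> h = g" for \<gamma> \<delta> d h
    using that frameD(1) [OF b] frameD(1) [OF c]
    by (auto intro!: frame_matrix_mult [OF M b b] frame_matrix_mult [OF M b c]
        frame_matrix_mult [OF M c b] frame_matrix_mult [OF M c c] simp: left_linear_closed)
  have disj': "c i = \<zero>\<^bsub>M\<^esub> \<or> f i = (\<lambda>_. 0)" "b i = \<zero>\<^bsub>M\<^esub> \<or> g i = (\<lambda>_. 0)" for i
    using disj [of i] by auto
  \<comment> \<open>A product vanishes when the functionals of the left factor and the vectors of
    the right factor belong to different frames; when they belong to the same one, it contracts by
    \<open>mult\<close>.\<close>
  have zero: "frame_matrix d \<gamma> f * frame_matrix c \<delta> h = 0"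
      "frame_matrix d \<gamma> g * frame_matrix b \<delta> h = 0"
    if "left_linear M M \<delta>" "h = f \<or> h = g" for \<gamma> \<delta> d h
    using that disj'
    by (auto intro!: frame_matrix_mult_disjoint [OF M b b] frame_matrix_mult_disjoint [OF M b c]
        frame_matrix_mult_disjoint [OF M c b] frame_matrix_mult_disjoint [OF M c c])
  have swap: "?T * ?T = 1" "?T * (1 - ?e b f + ?a b f) = (1 - ?e c g + ?a c g) * ?T"
    by (rule matrix_units_swap [where a = "?a b f" and c = "?a c g"];
        simp add: mult zero left_linear_id \<alpha>)+
  have "block (max n n') (?T - 1)"
  proof -
    have "block (max n n') (?e b g)" "block (max n n') (?e c f)"
        "block (max n n') (?e b f)" "block (max n n') (?e c g)"
      using block_frame_matrix [OF M b c left_linear_id] block_frame_matrix [OF M c b left_linear_id]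
        block_frame_matrix [OF M b b left_linear_id] block_frame_matrix [OF M c c left_linear_id]
      by (auto intro: block_mono)
    moreover have "?T - 1 = ?e b g + ?e c f - ?e b f - ?e c g" by simp
    ultimately show ?thesis by (simp only: block_add block_diff)
  qed
  then have "is_GL ?T" using swap by (intro is_GLI [of _ ?T]) (auto simp: stable_iff)
  then show ?thesis
    by (rule K1_class_conj)
       (use swap in \<open>simp_all add: frame_aut_def is_GL_frame_aut [OF M _ aut, unfolded frame_aut_def, OF b]
         is_GL_frame_aut [OF M _ aut, unfolded frame_aut_def, OF c]\<close>)
qed

text \<open>Zero padding moves a frame past any index bound \<open>N\<close>, which yields a frame
  of the same module disjoint from given ones.\<close>

lemma frame_shift:
  assumes M: "left_module M" and b: "frame M n b f"
  shows "frame M (N + n) (\<lambda>i. if i < N then \<zero>\<^bsub>M\<^esub> else b (i - N)) (\<lambda>i. if i < N then \<lambda>_. 0 else f (i - N))"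
    (is "frame M _ ?b ?f")
proof -
  interpret M: left_module M by fact
  have bc: "b i \<in> carrier M" for i by (rule frameD(1) [OF b])
  have "m = (\<Oplus>\<^bsub>M\<^esub>i\<in>{..<N + n}. ?f i m \<odot>\<^bsub>M\<^esub> ?b i)" if m: "m \<in> carrier M" for m
  proof -
    define t where "t i = ?f i m \<odot>\<^bsub>M\<^esub> ?b i" for i
    have t: "t i \<in> carrier M" for i by (simp add: t_def M.smult_closed bc)
    have "(\<Oplus>\<^bsub>M\<^esub>i\<in>{..<N + n}. t i) = (\<Oplus>\<^bsub>M\<^esub>i\<in>(\<lambda>i. i + N) ` {..<n}. t i)"
    proof (rule M.add.finprod_mono_neutral_cong_right)
      show "t i = \<zero>\<^bsub>M\<^esub>" if i: "i \<in> {..<N + n} - (\<lambda>i. i + N) ` {..<n}" for i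
      proof (cases "i < N")
        case True
        then show ?thesis by (simp add: t_def M.zero_smult)
      next
        case False
        then have "i = (i - N) + N" "i - N < n" using i by auto
        then show ?thesis using i by blast
      qed
    qed (use t in auto)
    also have "\<dots> = (\<Oplus>\<^bsub>M\<^esub>i\<in>{..<n}. t (i + N))"
      using t by (simp add: M.finsum_reindex)
    also have "\<dots> = m" using frameD(5) [OF b m] by (simp add: t_def)
    finally show ?thesis by (simp add: t_def)
  qed
  then show ?thesis
    using frameD(1-4) [OF b] by (auto simp: frame_def functional_def)
qed

text \<open>The shifted copy of the first frame occupies indices from \<open>max n n'\<close> on,
  hence is disjoint from both frames. The lengths \<open>n\<close> and \<open>n'\<close> are never
  compared, so the argument covers rings without invariant basis number.\<close>

theorem K1_class_frame_aut_independent: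
  assumes M: "left_module M" and b: "frame M n b f" and c: "frame M n' c g"
    and aut: "automorphism M \<alpha>"
  shows "K1_class (frame_aut b f \<alpha>) = K1_class (frame_aut c g \<alpha>)"
proof -
  note d = frame_shift [OF M b, of "max n n'"]
  show ?thesis
    by (rule trans [OF K1_class_frame_aut_disjoint [OF M b d aut]
          K1_class_frame_aut_disjoint [OF M c d aut, symmetric]])
       (use frameD(3,4) [OF b] frameD(3,4) [OF c] in auto)
qed

section \<open>Direct summands and direct sums\<close>

text \<open>Vectors are pushed along \<open>p\<close> and functionals pulled back along
  \<open>i\<close>, and \<open>a = p (i a)\<close> is expanded inside \<open>C\<close>. The images
  of a basis under \<open>p\<close> can be linearly dependent, which is why frames do not ask for
  independence.\<close>

lemma frame_summand:
  assumes A: "left_module A" and C: "left_module C" and c: "frame C n c g"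
    and i: "left_linear A C i" and p: "left_linear C A p" and pi: "\<And>a. a \<in> carrier A \<Longrightarrow> p (i a) = a"
  shows "frame A n (\<lambda>k. p (c k)) (\<lambda>k a. g k (i a))"
proof -
  interpret A: left_module A by fact
  interpret C: left_module C by fact
  have "a = (\<Oplus>\<^bsub>A\<^esub>k\<in>{..<n}. g k (i a) \<odot>\<^bsub>A\<^esub> p (c k))" if a: "a \<in> carrier A" for a
  proof -
    have "a = p (i a)" using pi [OF a] by simp
    also have "\<dots> = p (\<Oplus>\<^bsub>C\<^esub>k\<in>{..<n}. g k (i a) \<odot>\<^bsub>C\<^esub> c k)"
      using frameD(5) [OF c left_linear_closed [OF i a]] by simp
    also have "\<dots> = (\<Oplus>\<^bsub>A\<^esub>k\<in>{..<n}. g k (i a) \<odot>\<^bsub>A\<^esub> p (c k))"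
      using frameD(1) [OF c]
      by (subst left_linear_finsum [OF C A p]) (auto simp: C.smult_closed left_linear_smult [OF p])
    finally show ?thesis .
  qed
  then show ?thesis
    using frameD(1-4) [OF c] left_linear_zero [OF C A p] functional_comp [OF i]
    by (auto simp: frame_def left_linear_closed [OF p])
qed

text \<open>With the frames inherited from \<open>C\<close>, the matrices of \<phi> and \<psi> live
  at orthogonal idempotents whose sum is the idempotent of \<open>C\<close>. The product of the two
  stabilisations therefore expands to that of \<chi>. The given frames of \<open>A\<close> and
  \<open>B\<close> are then exchanged for the inherited ones by independence of the frame.\<close>

lemma K1_class_frame_aut_direct_sum:
  assumes A: "left_module A" and B: "left_module B" and C: "left_module C"
    and lin: "left_linear A C i" "left_linear C A p" "left_linear B C j" "left_linear C B q"
    and pi: "\<And>a. a \<in> carrier A \<Longrightarrow> p (i a) = a" and qj: "\<And>b. b \<in> carrier B \<Longrightarrow> q (j b) = b"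
    and sum: "\<And>c. c \<in> carrier C \<Longrightarrow> i (p c) \<oplus>\<^bsub>C\<^esub> j (q c) = c"
    and aut: "automorphism A \<phi>" "automorphism B \<psi>"
    and \<chi>: "left_linear C C \<chi>" "\<And>a. a \<in> carrier A \<Longrightarrow> \<chi> (i a) = i (\<phi> a)"
      "\<And>b. b \<in> carrier B \<Longrightarrow> \<chi> (j b) = j (\<psi> b)"
    and fr: "frame A nA bA fA" "frame B nB bB fB" "frame C nC bC fC"
  shows "K1_class (frame_aut bC fC \<chi>) = K1_class (frame_aut bA fA \<phi>) \<otimes>\<^bsub>K1\<^esub> K1_class (frame_aut bB fB \<psi>)"
proof -
  interpret A: left_module A by fact
  interpret B: left_module B by fact
  interpret C: left_module C by fact
  let ?m = "\<lambda>x. frame_matrix bC x fC"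
  have \<phi>: "left_linear A A \<phi>" and \<psi>: "left_linear B B \<psi>" using aut by (auto simp: automorphism_def)
  note closed [simp] = lin [THEN left_linear_closed] \<phi> [THEN left_linear_closed] \<psi> [THEN left_linear_closed]
  have pj: "p (j b) = \<zero>\<^bsub>A\<^esub>" if b: "b \<in> carrier B" for b
  proof -
    have "p (i (p (j b)) \<oplus>\<^bsub>C\<^esub> j (q (j b))) = p (j b)" using b by (simp add: sum)
    then have "p (j b) \<oplus>\<^bsub>A\<^esub> p (j b) = p (j b)"
      using b by (simp add: left_linear_add [OF lin(2)] pi qj)
    then show ?thesis using b by simp
  qed
  have lin_m: "left_linear C C (\<lambda>x. i (p x))" "left_linear C C (\<lambda>x. j (q x))"
      "left_linear C C (\<lambda>x. i (\<phi> (p x)))" "left_linear C C (\<lambda>x. j (\<psi> (q x)))"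
    using left_linear_comp [OF lin(2,1)] left_linear_comp [OF lin(4,3)]
      left_linear_comp [OF lin(2) left_linear_comp [OF \<phi> lin(1)]]
      left_linear_comp [OF lin(4) left_linear_comp [OF \<psi> lin(3)]] by simp_all
  have mult: "?m x * ?m y = ?m (\<lambda>u. y (x u))" if "left_linear C C x" "left_linear C C y" for x y
    using that frameD(1) [OF fr(3)]
    by (intro frame_matrix_mult [OF C fr(3) fr(3)]) (auto simp: left_linear_closed)
  have cong: "?m x = ?m y" if "\<And>u. u \<in> carrier C \<Longrightarrow> x u = y u" for x y
    using that frameD(1) [OF fr(3)] by (simp add: frame_matrix_def)
  have madd: "?m (\<lambda>u. x u \<oplus>\<^bsub>C\<^esub> y u) = ?m x + ?m y" if "left_linear C C x" "left_linear C C y" for x y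
    using that frameD(1,2) [OF fr(3)]
    by (intro rfmat_eqI)
       (simp add: entry_frame_matrix [OF fr(3)] plus_rfmat.rep_eq functional_add left_linear_closed)
  have zero: "?m (\<lambda>u. \<zero>\<^bsub>C\<^esub>) = 0"
    using functional_zero [OF C frameD(2) [OF fr(3)]]
    by (intro rfmat_eqI) (simp add: entry_frame_matrix [OF fr(3)] zero_rfmat.rep_eq)
  let ?fA = "frame_aut (\<lambda>k. p (bC k)) (\<lambda>k a. fC k (i a)) \<phi>"
  let ?fB = "frame_aut (\<lambda>k. q (bC k)) (\<lambda>k a. fC k (j a)) \<psi>"
  note frA = frame_summand [OF A C fr(3) lin(1,2) pi] and frB = frame_summand [OF B C fr(3) lin(3,4) qj]
  \<comment> \<open>Orthogonality is a consequence of the splitting: applying \<open>q\<close> to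
    the decomposition of \<open>i a\<close> gives x + x = x for x = \<open>q (i a)\<close>.\<close>
  have qi: "q (i a) = \<zero>\<^bsub>B\<^esub>" if a: "a \<in> carrier A" for a
  proof -
    have "q (i (p (i a)) \<oplus>\<^bsub>C\<^esub> j (q (i a))) = q (i a)" using a by (simp add: sum)
    then have "q (i a) \<oplus>\<^bsub>B\<^esub> q (i a) = q (i a)"
      using a by (simp add: left_linear_add [OF lin(4)] pi qj)
    then show ?thesis using a by simp
  qed
  \<comment> \<open>Written through \<open>C\<close>, both matrices use the same vectors and
    functionals; only the endomorphism of \<open>C\<close> in the middle differs.\<close>
  have eA: "?fA = 1 - ?m (\<lambda>x. i (p x)) + ?m (\<lambda>x. i (\<phi> (p x)))"
    and eB: "?fB = 1 - ?m (\<lambda>x. j (q x)) + ?m (\<lambda>x. j (\<psi> (q x)))"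
    by (simp_all add: frame_aut_def frame_matrix_def)
  have "?m x * ?m y = 0"
    if "x = (\<lambda>x. i (p x)) \<or> x = (\<lambda>x. i (\<phi> (p x)))" "y = (\<lambda>x. j (q x)) \<or> y = (\<lambda>x. j (\<psi> (q x)))" for x y
  proof -
    have "?m x * ?m y = ?m (\<lambda>u. y (x u))" using that lin_m by (auto intro!: mult)
    also have "\<dots> = ?m (\<lambda>u. \<zero>\<^bsub>C\<^esub>)"
      using that by (intro cong) (auto simp: qi left_linear_zero [OF B C lin(3)] left_linear_zero [OF B B \<psi>])
    finally show ?thesis by (simp add: zero)
  qed
  then have "?fA * ?fB = 1 - (?m (\<lambda>x. i (p x)) + ?m (\<lambda>x. j (q x)))
      + (?m (\<lambda>x. i (\<phi> (p x))) + ?m (\<lambda>x. j (\<psi> (q x))))"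
    by (simp add: eA eB algebra_simps)
  also have "?m (\<lambda>x. i (p x)) + ?m (\<lambda>x. j (q x)) = ?m (\<lambda>x. x)"
    by (simp only: madd [symmetric] lin_m) (rule cong, rule sum)
  also have "?m (\<lambda>x. i (\<phi> (p x))) + ?m (\<lambda>x. j (\<psi> (q x))) = ?m \<chi>"
  proof (simp only: madd [symmetric] lin_m, rule cong)
    fix c assume c: "c \<in> carrier C"
    have "\<chi> c = \<chi> (i (p c) \<oplus>\<^bsub>C\<^esub> j (q c))" using sum [OF c] by simp
    also have "\<dots> = i (\<phi> (p c)) \<oplus>\<^bsub>C\<^esub> j (\<psi> (q c))"
      using c by (simp add: left_linear_add [OF \<chi>(1)] \<chi>(2,3))
    finally show "i (\<phi> (p c)) \<oplus>\<^bsub>C\<^esub> j (\<psi> (q c)) = \<chi> c" by simp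
  qed
  finally have "?fA * ?fB = frame_aut bC fC \<chi>" by (simp add: frame_aut_def)
  then show ?thesis
    using K1_class_mult [OF is_GL_frame_aut [OF A frA aut(1)] is_GL_frame_aut [OF B frB aut(2)]]
      K1_class_frame_aut_independent [OF A frA fr(1) aut(1)]
      K1_class_frame_aut_independent [OF B frB fr(2) aut(2)]
    by simp
qed

section \<open>Bases as frames with dual functionals\<close>

text \<open>Uniqueness of coordinates makes them linear, because the sum of the coordinates of x and
  y represents x + y, and likewise for left multiples. It also gives the duality between vectors and
  functionals, which a general frame lacks.\<close>

lemma is_basis_frame:
  assumes M: "left_module M" and bs: "is_basis M bs"
  defines "b \<equiv> \<lambda>i. if i < length bs then bs ! i else \<zero>\<^bsub>M\<^esub>"
    and "f \<equiv> \<lambda>i. if i < length bs then \<lambda>m. if m \<in> carrier M then coords M bs m i else 0 else (\<lambda>_. 0)"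
  shows "frame M (length bs) b f"
    and "i < length bs \<Longrightarrow> j < length bs \<Longrightarrow> f j (b i) = (if i = j then 1 else 0)"
proof -
  interpret M: left_module M by fact
  have bsc: "bs ! i \<in> carrier M" if "i < length bs" for i
    using bs that by (auto simp: is_basis_def)
  have ex: "\<exists>!c. c \<in> {..<length bs} \<rightarrow>\<^sub>E UNIV \<and> m = lincomb M bs c" if "m \<in> carrier M" for m
    using bs that by (auto simp: is_basis_def)
  have co: "coords M bs m \<in> {..<length bs} \<rightarrow>\<^sub>E UNIV" "m = lincomb M bs (coords M bs m)"
    if "m \<in> carrier M" for m
    using theI' [OF ex [OF that]] by (auto simp: coords_def)
  \<comment> \<open>\<open>lincomb\<close> sees only coefficients below the length, so
    \<open>c\<close> may be restricted first and then compared with the extensional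
    \<open>coords\<close>.\<close>
  have uniq: "coords M bs m i = c i" if m: "m \<in> carrier M" "m = lincomb M bs c" and i: "i < length bs" for m c i
  proof -
    have "lincomb M bs (restrict c {..<length bs}) = lincomb M bs c"
      unfolding lincomb_def by (rule M.finsum_cong') (auto simp: M.smult_closed bsc)
    then have "coords M bs m = restrict c {..<length bs}"
      using ex [OF m(1)] co [OF m(1)] m(2) by (metis PiE_restrict restrict_PiE_iff iso_tuple_UNIV_I)
    then show ?thesis using i by simp
  qed
  have func: "functional M (f i)" for i
  proof (cases "i < length bs")
    case True
    have "coords M bs (x \<oplus>\<^bsub>M\<^esub> y) i = coords M bs x i + coords M bs y i"
      if "x \<in> carrier M" "y \<in> carrier M" for x y
    proof (rule uniq)
      have "x \<oplus>\<^bsub>M\<^esub> y = lincomb M bs (coords M bs x) \<oplus>\<^bsub>M\<^esub> lincomb M bs (coords M bs y)"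
        using co(2) that by metis
      also have "\<dots> = lincomb M bs (\<lambda>i. coords M bs x i + coords M bs y i)"
        unfolding lincomb_def
        by (rule trans [OF M.finsum_addf [symmetric] M.finsum_cong'])
           (auto simp: M.smult_closed bsc M.smult_l_distr)
      finally show "x \<oplus>\<^bsub>M\<^esub> y = lincomb M bs (\<lambda>i. coords M bs x i + coords M bs y i)" .
    qed (use True that in auto)
    moreover have "coords M bs (r \<odot>\<^bsub>M\<^esub> x) i = r * coords M bs x i" if "x \<in> carrier M" for r x
    proof (rule uniq)
      have "r \<odot>\<^bsub>M\<^esub> x = r \<odot>\<^bsub>M\<^esub> lincomb M bs (coords M bs x)" using co(2) that by metis
      also have "r \<odot>\<^bsub>M\<^esub> (\<Oplus>\<^bsub>M\<^esub>i\<in>I. c i \<odot>\<^bsub>M\<^esub> (bs ! i)) = (\<Oplus>\<^bsub>M\<^esub>i\<in>I. (r * c i) \<odot>\<^bsub>M\<^esub> (bs ! i))"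
        if "finite I" "I \<subseteq> {..<length bs}" for I c
        using that
      proof (induction I rule: finite_induct)
        case empty
        then show ?case by (simp add: M.smult_zero)
      next
        case (insert i I)
        then have "bs ! i \<in> carrier M" "(\<lambda>i. s i \<odot>\<^bsub>M\<^esub> bs ! i) \<in> I \<rightarrow> carrier M" for s
          by (auto simp: M.smult_closed bsc)
        then show ?case using insert by (simp add: M.smult_closed M.smult_r_distr M.smult_assoc)
      qed
      from this [of "{..<length bs}" "coords M bs x"]
      have "r \<odot>\<^bsub>M\<^esub> lincomb M bs (coords M bs x) = lincomb M bs (\<lambda>i. r * coords M bs x i)"
        by (simp add: lincomb_def)
      finally show "r \<odot>\<^bsub>M\<^esub> x = lincomb M bs (\<lambda>i. r * coords M bs x i)" .
    qed (use True that in \<open>auto simp: M.smult_closed\<close>)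
    ultimately show ?thesis using True by (simp add: f_def functional_def M.smult_closed)
  qed (simp add: f_def functional_def)
  have "m = (\<Oplus>\<^bsub>M\<^esub>i\<in>{..<length bs}. f i m \<odot>\<^bsub>M\<^esub> b i)" if m: "m \<in> carrier M" for m
  proof -
    have "m = (\<Oplus>\<^bsub>M\<^esub>i\<in>{..<length bs}. coords M bs m i \<odot>\<^bsub>M\<^esub> bs ! i)"
      using co(2) [OF m] by (simp add: lincomb_def)
    also have "\<dots> = (\<Oplus>\<^bsub>M\<^esub>i\<in>{..<length bs}. f i m \<odot>\<^bsub>M\<^esub> b i)"
      using m by (intro M.finsum_cong') (auto simp: f_def b_def M.smult_closed bsc)
    finally show ?thesis .
  qed
  then show "frame M (length bs) b f"
    using func by (auto simp: frame_def b_def f_def bsc)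
  assume ij: "i < length bs" "j < length bs"
  have "coords M bs (bs ! i) j = (if i = j then 1 else 0)"
  proof (rule uniq)
    have "lincomb M bs (\<lambda>j. if i = j then 1 else 0)
        = (\<Oplus>\<^bsub>M\<^esub>j\<in>{..<length bs}. if i = j then bs ! j else \<zero>\<^bsub>M\<^esub>)"
      unfolding lincomb_def
      by (rule M.finsum_cong') (auto simp: bsc M.smult_one M.zero_smult)
    also have "\<dots> = bs ! i" using ij bsc by (intro M.finsum_singleton) auto
    finally show "bs ! i = lincomb M bs (\<lambda>j. if i = j then 1 else 0)" by simp
  qed (use ij bsc in auto)
  then show "f j (b i) = (if i = j then 1 else 0)" using ij bsc by (simp add: f_def b_def)
qed

text \<open>The frame provides existence of coordinates; duality provides uniqueness, by applying
  \<open>f j\<close> to a representation.\<close>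

lemma is_basis_of_frame:
  assumes M: "left_module M" and b: "frame M n b f"
    and dual: "\<And>i j. i < n \<Longrightarrow> j < n \<Longrightarrow> f j (b i) = (if i = j then 1 else 0)"
  shows "is_basis M (map b [0..<n])"
proof -
  interpret M: left_module M by fact
  have lc: "lincomb M (map b [0..<n]) c = (\<Oplus>\<^bsub>M\<^esub>i\<in>{..<n}. c i \<odot>\<^bsub>M\<^esub> b i)" for c
    unfolding lincomb_def using frameD(1) [OF b] by (intro M.finsum_cong') (auto simp: M.smult_closed)
  have "\<exists>!c. c \<in> {..<n} \<rightarrow>\<^sub>E UNIV \<and> m = (\<Oplus>\<^bsub>M\<^esub>i\<in>{..<n}. c i \<odot>\<^bsub>M\<^esub> b i)" if m: "m \<in> carrier M" for m
  proof (rule ex1I [of _ "\<lambda>i\<in>{..<n}. f i m"])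
    have "(\<Oplus>\<^bsub>M\<^esub>i\<in>{..<n}. f i m \<odot>\<^bsub>M\<^esub> b i) = (\<Oplus>\<^bsub>M\<^esub>i\<in>{..<n}. (\<lambda>i\<in>{..<n}. f i m) i \<odot>\<^bsub>M\<^esub> b i)"
      using frameD(1) [OF b] by (intro M.finsum_cong') (auto simp: M.smult_closed)
    then show "(\<lambda>i\<in>{..<n}. f i m) \<in> {..<n} \<rightarrow>\<^sub>E UNIV \<and>
        m = (\<Oplus>\<^bsub>M\<^esub>i\<in>{..<n}. (\<lambda>i\<in>{..<n}. f i m) i \<odot>\<^bsub>M\<^esub> b i)"
      using frameD(5) [OF b m] by auto
  next
    fix c assume c: "c \<in> {..<n} \<rightarrow>\<^sub>E UNIV \<and> m = (\<Oplus>\<^bsub>M\<^esub>i\<in>{..<n}. c i \<odot>\<^bsub>M\<^esub> b i)"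
    have "c j = f j m" if j: "j < n" for j
    proof -
      have "f j m = (\<Sum>i<n. f j (c i \<odot>\<^bsub>M\<^esub> b i))"
        using conjunct2 [OF c] functional_finsum [OF M frameD(2) [OF b], of "\<lambda>i. c i \<odot>\<^bsub>M\<^esub> b i" "{..<n}"]
          frameD(1) [OF b]
        by (simp add: M.smult_closed)
      also have "\<dots> = (\<Sum>i<n. if i = j then c i else 0)"
        using frameD(1) [OF b] j
        by (intro sum.cong) (auto simp: functional_smult [OF frameD(2) [OF b]] dual)
      finally show ?thesis using j by simp
    qed
    then show "c = (\<lambda>i\<in>{..<n}. f i m)" using c by (auto simp: PiE_iff extensional_def fun_eq_iff)
  qed
  then show ?thesis using frameD(1) [OF b] by (auto simp: is_basis_def lc)
qed

text \<open>The definite description is meaningful because every basis, whatever its length, yields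
  the class computed from any one frame; \<open>bs0\<close> guarantees that a basis exists.\<close>

theorem K1_aut_class_eq:
  assumes M: "left_module M" and basis: "is_basis M bs0" and c: "frame M n c g" and aut: "automorphism M \<alpha>"
  shows "K1_aut_class M \<alpha> = K1_class (frame_aut c g \<alpha>)"
proof -
  have cls: "K1_matrix_class (length bs) (matrix_of M bs \<alpha>) = K1_class (frame_aut c g \<alpha>)"
    if bs: "is_basis M bs" for bs
  proof -
    have \<alpha>: "left_linear M M \<alpha>" using aut by (auto simp: automorphism_def)
    define b where "b = (\<lambda>i. if i < length bs then bs ! i else \<zero>\<^bsub>M\<^esub>)"
    define f where "f = (\<lambda>i. if i < length bs then \<lambda>m. if m \<in> carrier M then coords M bs m i else 0 else (\<lambda>_. 0))"
    note fr = is_basis_frame [OF M bs, folded b_def f_def]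
    \<comment> \<open>Duality makes the idempotent of this frame the unit of the corner, so
      subtracting it from 1 leaves the identity outside the corner and nothing inside.\<close>
    have "entry (frame_aut b f \<alpha>) = stabilize (length bs) (matrix_of M bs \<alpha>)"
    proof (intro ext)
      fix i j
      show "entry (frame_aut b f \<alpha>) i j = stabilize (length bs) (matrix_of M bs \<alpha>) i j"
      proof (cases "i < length bs \<and> j < length bs")
        case True
        have "bs ! i \<in> carrier M" using bs True by (auto simp: is_basis_def)
        then show ?thesis
          using True fr(2) [of i j] left_linear_closed [OF \<alpha>, of "bs ! i"]
          by (simp add: frame_aut_def entry_simps entry_frame_matrix [OF fr(1)] stabilize_def
              matrix_of_def) (auto simp: b_def f_def)
      next
        case False
        then have "f j x = 0 \<or> b i = \<zero>\<^bsub>M\<^esub>" for x by (auto simp: b_def f_def)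
        then have "f j (b i) = 0" "f j (\<alpha> (b i)) = 0"
          using functional_zero [OF M frameD(2) [OF fr(1)]] left_linear_zero [OF M M \<alpha>] by metis+
        then show ?thesis using False
          by (auto simp: frame_aut_def entry_simps entry_frame_matrix [OF fr(1)] stabilize_def)
      qed
    qed
    then have "K1_matrix_class (length bs) (matrix_of M bs \<alpha>) = K1_class (frame_aut b f \<alpha>)"
      by (rule K1_matrix_class_eq)
    also have "\<dots> = K1_class (frame_aut c g \<alpha>)"
      by (rule K1_class_frame_aut_independent [OF M fr(1) c aut])
    finally show ?thesis .
  qed
  show ?thesis unfolding K1_aut_class_def
    by (rule the_equality) (use cls basis in auto)
qed

section \<open>The functor forgetting geometry\<close>

text \<open>The laws of the Laurent action are additive in the polynomial, so they can be checked on
  monomials r t^k; zero is covered as a monomial with coefficient 0.\<close>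

lemma poly_mapping_single_induct:
  assumes "\<And>k r. P (Poly_Mapping.single k r)" "\<And>p q. P p \<Longrightarrow> P q \<Longrightarrow> P (p + q)"
  shows "P (p :: 'a \<Rightarrow>\<^sub>0 'b::comm_monoid_add)"
proof -
  have "P (\<Sum>k\<in>K. Poly_Mapping.single k (Poly_Mapping.lookup p k))" if "finite K" for K
    using that assms(1) [of undefined 0] by (induction K) (auto intro: assms)
  moreover have "(\<Sum>k\<in>Poly_Mapping.keys p. Poly_Mapping.single k (Poly_Mapping.lookup p k)) = p"
    by (rule poly_mapping_eqI) (simp add: lookup_sum lookup_single when_def in_keys_iff)
  ultimately show ?thesis by (metis finite_keys)
qed

lemma lookup_single_times:
  "Poly_Mapping.lookup (Poly_Mapping.single k r * q) l = r * Poly_Mapping.lookup q (l - k)"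
  for q :: "int \<Rightarrow>\<^sub>0 'r::ring_1"
proof (induction q rule: poly_mapping_single_induct)
  case (1 j s)
  then show ?case by (auto simp: mult_single lookup_single when_def)
next
  case (2 p q)
  then show ?case by (simp add: distrib_left lookup_add)
qed

lemma U_obj_simps:
  "f \<in> carrier (U_obj A) \<longleftrightarrow> (\<forall>x. f x \<in> carrier (A x)) \<and> finite {x. f x \<noteq> \<zero>\<^bsub>A x\<^esub>}"
  "\<zero>\<^bsub>U_obj A\<^esub> = (\<lambda>x. \<zero>\<^bsub>A x\<^esub>)"
  "f \<oplus>\<^bsub>U_obj A\<^esub> g = (\<lambda>x. f x \<oplus>\<^bsub>A x\<^esub> g x)"
  "p \<odot>\<^bsub>U_obj A\<^esub> f = (\<lambda>x. \<Oplus>\<^bsub>A x\<^esub>k\<in>Poly_Mapping.keys p.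
      Poly_Mapping.lookup p k \<odot>\<^bsub>A x\<^esub> f (x - of_int k))"
  by (simp_all add: U_obj_def)

section \<open>The Laurent module of an invariant family\<close>

text \<open>These are the properties on which the module structure of \<open>U_obj\<close> rests;
  finiteness of the support of \<open>A\<close> enters later, with the basis.\<close>

locale invariant_family =
  fixes A :: "('r::ring_1, 'm) gmod"
  assumes left_module: "left_module (A x)" and periodic: "A (x + 1) = A x"

sublocale invariant_family \<subseteq> M: left_module "A x" for x
  by (rule left_module)

context invariant_family
begin

lemma periodic_nat: "A (x + of_nat k) = A x"
proof (induction k)
  case (Suc k)
  then show ?case using periodic [of "x + of_nat k"] by (simp add: ac_simps)
qed simp

lemma periodic_int: "A (x + of_int k) = A x"
proof (cases k rule: int_cases2)
  case (nonneg n)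
  then show ?thesis using periodic_nat by simp
next
  case (nonpos n)
  then show ?thesis using periodic_nat [of "x - of_nat n" n] by simp
qed

lemma periodic_int_diff: "A (x - of_int k) = A x"
  using periodic_int [of "x - of_int k" k] by simp

lemma U_closed [simp]: "f \<in> carrier (U_obj A) \<Longrightarrow> f x \<in> carrier (A x)"
  by (simp add: U_obj_simps)

lemma U_shift_closed [simp]: "f \<in> carrier (U_obj A) \<Longrightarrow> f (x - of_int k) \<in> carrier (A x)"
  using U_closed [of f "x - of_int k"] by (simp add: periodic_int_diff)

lemma U_smult_superset:
  assumes "f \<in> carrier (U_obj A)" "finite K" "Poly_Mapping.keys p \<subseteq> K"
  shows "(p \<odot>\<^bsub>U_obj A\<^esub> f) x = (\<Oplus>\<^bsub>A x\<^esub>k\<in>K. Poly_Mapping.lookup p k \<odot>\<^bsub>A x\<^esub> f (x - of_int k))"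
  unfolding U_obj_simps using assms
  by (intro M.add.finprod_mono_neutral_cong_left)
     (auto simp: in_keys_iff M.zero_smult intro: M.smult_closed)

lemma U_smult_single:
  assumes "f \<in> carrier (U_obj A)"
  shows "(Poly_Mapping.single k r \<odot>\<^bsub>U_obj A\<^esub> f) x = r \<odot>\<^bsub>A x\<^esub> f (x - of_int k)"
  using assms by (subst U_smult_superset [of f "{k}"]) (auto simp: M.smult_closed)

lemma U_smult_add:
  assumes f: "f \<in> carrier (U_obj A)"
  shows "((p + q) \<odot>\<^bsub>U_obj A\<^esub> f) x = (p \<odot>\<^bsub>U_obj A\<^esub> f) x \<oplus>\<^bsub>A x\<^esub> (q \<odot>\<^bsub>U_obj A\<^esub> f) x"
proof -
  let ?K = "Poly_Mapping.keys p \<union> Poly_Mapping.keys q"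
  have "Poly_Mapping.keys (p + q) \<subseteq> ?K" by (rule Poly_Mapping.keys_add)
  then have "((p + q) \<odot>\<^bsub>U_obj A\<^esub> f) x =
      (\<Oplus>\<^bsub>A x\<^esub>k\<in>?K. Poly_Mapping.lookup (p + q) k \<odot>\<^bsub>A x\<^esub> f (x - of_int k))"
    using f by (intro U_smult_superset) auto
  also have "\<dots> = (\<Oplus>\<^bsub>A x\<^esub>k\<in>?K. Poly_Mapping.lookup p k \<odot>\<^bsub>A x\<^esub> f (x - of_int k)
      \<oplus>\<^bsub>A x\<^esub> Poly_Mapping.lookup q k \<odot>\<^bsub>A x\<^esub> f (x - of_int k))"
    using f by (intro M.finsum_cong') (auto simp: lookup_add M.smult_l_distr M.smult_closed)
  also have "\<dots> = (\<Oplus>\<^bsub>A x\<^esub>k\<in>?K. Poly_Mapping.lookup p k \<odot>\<^bsub>A x\<^esub> f (x - of_int k))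
      \<oplus>\<^bsub>A x\<^esub> (\<Oplus>\<^bsub>A x\<^esub>k\<in>?K. Poly_Mapping.lookup q k \<odot>\<^bsub>A x\<^esub> f (x - of_int k))"
    using f by (intro M.finsum_addf) (auto simp: M.smult_closed)
  also have "\<dots> = (p \<odot>\<^bsub>U_obj A\<^esub> f) x \<oplus>\<^bsub>A x\<^esub> (q \<odot>\<^bsub>U_obj A\<^esub> f) x"
    using f by (simp add: U_smult_superset [of f ?K])
  finally show ?thesis .
qed

lemma U_add_closed:
  assumes "f \<in> carrier (U_obj A)" "g \<in> carrier (U_obj A)"
  shows "f \<oplus>\<^bsub>U_obj A\<^esub> g \<in> carrier (U_obj A)"
proof -
  have "{x. f x \<oplus>\<^bsub>A x\<^esub> g x \<noteq> \<zero>\<^bsub>A x\<^esub>} \<subseteq> {x. f x \<noteq> \<zero>\<^bsub>A x\<^esub>} \<union> {x. g x \<noteq> \<zero>\<^bsub>A x\<^esub>}" by auto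
  then show ?thesis using assms by (auto simp: U_obj_simps intro: finite_subset)
qed

lemma U_smult_closed:
  assumes f: "f \<in> carrier (U_obj A)"
  shows "p \<odot>\<^bsub>U_obj A\<^esub> f \<in> carrier (U_obj A)"
proof (induction p rule: poly_mapping_single_induct)
  case (1 k r)
  have "{x. r \<odot>\<^bsub>A x\<^esub> f (x - of_int k) \<noteq> \<zero>\<^bsub>A x\<^esub>} \<subseteq> (\<lambda>x. x + of_int k) ` {x. f x \<noteq> \<zero>\<^bsub>A x\<^esub>}"
  proof
    fix x assume "x \<in> {x. r \<odot>\<^bsub>A x\<^esub> f (x - of_int k) \<noteq> \<zero>\<^bsub>A x\<^esub>}"
    then have "f (x - of_int k) \<noteq> \<zero>\<^bsub>A (x - of_int k)\<^esub>"
      by (auto simp: M.smult_zero periodic_int_diff)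
    then show "x \<in> (\<lambda>x. x + of_int k) ` {x. f x \<noteq> \<zero>\<^bsub>A x\<^esub>}"
      by (intro image_eqI [of _ _ "x - of_int k"]) auto
  qed
  moreover have "finite {x. f x \<noteq> \<zero>\<^bsub>A x\<^esub>}" using f by (simp add: U_obj_simps)
  ultimately have "finite {x. r \<odot>\<^bsub>A x\<^esub> f (x - of_int k) \<noteq> \<zero>\<^bsub>A x\<^esub>}"
    by (meson finite_imageI finite_subset)
  then show ?case using f by (simp add: U_obj_simps(1) U_smult_single M.smult_closed)
next
  case (2 p q)
  have "(p + q) \<odot>\<^bsub>U_obj A\<^esub> f = p \<odot>\<^bsub>U_obj A\<^esub> f \<oplus>\<^bsub>U_obj A\<^esub> q \<odot>\<^bsub>U_obj A\<^esub> f"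
    by (simp add: U_obj_simps(3) U_smult_add [OF f] fun_eq_iff)
  then show ?case using 2 by (simp add: U_add_closed)
qed

lemma U_smult_add_right:
  assumes f: "f \<in> carrier (U_obj A)" and g: "g \<in> carrier (U_obj A)"
  shows "p \<odot>\<^bsub>U_obj A\<^esub> (f \<oplus>\<^bsub>U_obj A\<^esub> g) = p \<odot>\<^bsub>U_obj A\<^esub> f \<oplus>\<^bsub>U_obj A\<^esub> p \<odot>\<^bsub>U_obj A\<^esub> g"
proof
  fix x
  have "(\<Oplus>\<^bsub>A x\<^esub>k\<in>Poly_Mapping.keys p.
        Poly_Mapping.lookup p k \<odot>\<^bsub>A x\<^esub> (f (x - of_int k) \<oplus>\<^bsub>A (x - of_int k)\<^esub> g (x - of_int k)))
     = (\<Oplus>\<^bsub>A x\<^esub>k\<in>Poly_Mapping.keys p. Poly_Mapping.lookup p k \<odot>\<^bsub>A x\<^esub> f (x - of_int k)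
        \<oplus>\<^bsub>A x\<^esub> Poly_Mapping.lookup p k \<odot>\<^bsub>A x\<^esub> g (x - of_int k))"
    using f g by (intro M.finsum_cong') (auto simp: periodic_int_diff M.smult_closed M.smult_r_distr)
  also have "\<dots> = (p \<odot>\<^bsub>U_obj A\<^esub> f) x \<oplus>\<^bsub>A x\<^esub> (p \<odot>\<^bsub>U_obj A\<^esub> g) x"
    unfolding U_obj_simps using f g by (intro M.finsum_addf) (auto simp: M.smult_closed)
  finally show "(p \<odot>\<^bsub>U_obj A\<^esub> (f \<oplus>\<^bsub>U_obj A\<^esub> g)) x
      = (p \<odot>\<^bsub>U_obj A\<^esub> f \<oplus>\<^bsub>U_obj A\<^esub> p \<odot>\<^bsub>U_obj A\<^esub> g) x"
    by (simp add: U_obj_simps)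
qed

lemma abelian_group_U: "abelian_group (U_obj A)"
proof (rule abelian_groupI)
  fix f assume f: "f \<in> carrier (U_obj A)"
  \<comment> \<open>The negative of f is the constant polynomial -1 acting on f, so its finite
    support comes from \<open>U_smult_closed\<close>.\<close>
  have "Poly_Mapping.single 0 (-1) \<odot>\<^bsub>U_obj A\<^esub> f \<oplus>\<^bsub>U_obj A\<^esub> f = \<zero>\<^bsub>U_obj A\<^esub>"
  proof
    fix x
    have "(- 1) \<odot>\<^bsub>A x\<^esub> f x \<oplus>\<^bsub>A x\<^esub> f x = (- 1) \<odot>\<^bsub>A x\<^esub> f x \<oplus>\<^bsub>A x\<^esub> 1 \<odot>\<^bsub>A x\<^esub> f x"
      using f by (simp add: M.smult_one)
    also have "\<dots> = \<zero>\<^bsub>A x\<^esub>"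
      using f M.smult_l_distr [of "f x" x "-1" 1] by (simp add: M.zero_smult)
    finally show "(Poly_Mapping.single 0 (-1) \<odot>\<^bsub>U_obj A\<^esub> f \<oplus>\<^bsub>U_obj A\<^esub> f) x = \<zero>\<^bsub>U_obj A\<^esub> x"
      using f by (simp add: U_obj_simps(2,3) U_smult_single)
  qed
  then show "\<exists>g\<in>carrier (U_obj A). g \<oplus>\<^bsub>U_obj A\<^esub> f = \<zero>\<^bsub>U_obj A\<^esub>"
    using U_smult_closed [OF f] by blast
qed (auto simp: U_add_closed, auto simp: U_obj_simps fun_eq_iff M.a_ac)

sublocale U: left_module "U_obj A"
proof (intro left_module.intro left_module_axioms.intro)
  show "abelian_group (U_obj A)" by (rule abelian_group_U)
  fix p q :: "int \<Rightarrow>\<^sub>0 'r" and f g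
  assume f: "f \<in> carrier (U_obj A)"
  show "p \<odot>\<^bsub>U_obj A\<^esub> f \<in> carrier (U_obj A)" by (rule U_smult_closed [OF f])
  show add: "(p + q) \<odot>\<^bsub>U_obj A\<^esub> f = p \<odot>\<^bsub>U_obj A\<^esub> f \<oplus>\<^bsub>U_obj A\<^esub> q \<odot>\<^bsub>U_obj A\<^esub> f" for p q
    by (simp add: U_obj_simps(3) U_smult_add [OF f] fun_eq_iff)
  show "p \<odot>\<^bsub>U_obj A\<^esub> (f \<oplus>\<^bsub>U_obj A\<^esub> g) = p \<odot>\<^bsub>U_obj A\<^esub> f \<oplus>\<^bsub>U_obj A\<^esub> p \<odot>\<^bsub>U_obj A\<^esub> g"
    if "g \<in> carrier (U_obj A)" by (rule U_smult_add_right [OF f that])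
  show "1 \<odot>\<^bsub>U_obj A\<^esub> f = f"
    using f by (simp add: fun_eq_iff U_smult_single M.smult_one flip: single_one)
  \<comment> \<open>Additivity in p and in q reduces this to monomials, where both sides are r s f(x
    - k - l).\<close>
  show "(p * q) \<odot>\<^bsub>U_obj A\<^esub> f = p \<odot>\<^bsub>U_obj A\<^esub> (q \<odot>\<^bsub>U_obj A\<^esub> f)"
  proof (induction p rule: poly_mapping_single_induct)
    case (1 k r)
    show ?case
    proof (induction q rule: poly_mapping_single_induct)
      case (1 l s)
      show ?case
      proof
        fix x
        have "(Poly_Mapping.single k r \<odot>\<^bsub>U_obj A\<^esub> (Poly_Mapping.single l s \<odot>\<^bsub>U_obj A\<^esub> f)) x
            = r \<odot>\<^bsub>A x\<^esub> (s \<odot>\<^bsub>A x\<^esub> f (x - of_int k - of_int l))"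
          by (subst U_smult_single [OF U_smult_closed [OF f]], subst U_smult_single [OF f])
             (simp add: periodic_int_diff)
        then show "(Poly_Mapping.single k r * Poly_Mapping.single l s \<odot>\<^bsub>U_obj A\<^esub> f) x
            = (Poly_Mapping.single k r \<odot>\<^bsub>U_obj A\<^esub> (Poly_Mapping.single l s \<odot>\<^bsub>U_obj A\<^esub> f)) x"
          using f U_shift_closed [OF f, of x "k + l"]
          by (simp add: mult_single U_smult_single M.smult_assoc diff_diff_eq)
      qed
    next
      case (2 p q)
      then show ?case
        by (simp add: distrib_left add U_smult_add_right U_smult_closed f)
    qed
  next
    case (2 p p')
    have "(p + p') \<odot>\<^bsub>U_obj A\<^esub> (q \<odot>\<^bsub>U_obj A\<^esub> f)
        = p \<odot>\<^bsub>U_obj A\<^esub> (q \<odot>\<^bsub>U_obj A\<^esub> f) \<oplus>\<^bsub>U_obj A\<^esub> p' \<odot>\<^bsub>U_obj A\<^esub> (q \<odot>\<^bsub>U_obj A\<^esub> f)"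
      using U_smult_closed [OF f] by (simp add: U_obj_simps(3) U_smult_add fun_eq_iff)
    then show ?case using 2 by (simp add: distrib_right add)
  qed
qed

definition delta :: "real \<Rightarrow> 'm \<Rightarrow> real \<Rightarrow> 'm" where
  "delta x a = (\<lambda>y. if y = x then a else \<zero>\<^bsub>A y\<^esub>)"

lemma delta_closed [simp]: "a \<in> carrier (A x) \<Longrightarrow> delta x a \<in> carrier (U_obj A)"
  by (auto simp: U_obj_simps delta_def intro: finite_subset [of _ "{x}"])

lemma delta_add:
  "a \<in> carrier (A x) \<Longrightarrow> b \<in> carrier (A x) \<Longrightarrow>
    delta x (a \<oplus>\<^bsub>A x\<^esub> b) = delta x a \<oplus>\<^bsub>U_obj A\<^esub> delta x b"
  by (auto simp: U_obj_simps delta_def)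

lemma single_smult_delta:
  assumes "a \<in> carrier (A x)"
  shows "Poly_Mapping.single k r \<odot>\<^bsub>U_obj A\<^esub> delta x a = delta (x + of_int k) (r \<odot>\<^bsub>A x\<^esub> a)"
proof
  fix y
  show "(Poly_Mapping.single k r \<odot>\<^bsub>U_obj A\<^esub> delta x a) y = delta (x + of_int k) (r \<odot>\<^bsub>A x\<^esub> a) y"
    by (subst U_smult_single [OF delta_closed [OF assms]])
       (auto simp: delta_def periodic_int periodic_int_diff M.smult_zero)
qed

text \<open>Elements concentrated at one point generate \<open>U_obj\<close> additively, and zero is
  such an element. Together with induction over monomials, this reduces Laurent linear statements to
  one point and one power of t.\<close>

lemma U_induct [consumes 1, case_names delta add]:
  assumes f: "f \<in> carrier (U_obj A)" and delta: "\<And>x a. a \<in> carrier (A x) \<Longrightarrow> P (delta x a)"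
    and add: "\<And>f g. f \<in> carrier (U_obj A) \<Longrightarrow> g \<in> carrier (U_obj A) \<Longrightarrow> P f \<Longrightarrow> P g \<Longrightarrow> P (f \<oplus>\<^bsub>U_obj A\<^esub> g)"
  shows "P f"
proof -
  have *: "P f" if "finite X" "f \<in> carrier (U_obj A)" "\<And>x. x \<notin> X \<Longrightarrow> f x = \<zero>\<^bsub>A x\<^esub>" for X f
    using that
  proof (induction X arbitrary: f rule: finite_induct)
    case empty
    then have "f = delta 0 \<zero>\<^bsub>A 0\<^esub>" by (auto simp: delta_def)
    then show ?case using delta by simp
  next
    case (insert x X)
    let ?g = "\<lambda>y. if y = x then \<zero>\<^bsub>A y\<^esub> else f y"
    have "{y. ?g y \<noteq> \<zero>\<^bsub>A y\<^esub>} \<subseteq> {y. f y \<noteq> \<zero>\<^bsub>A y\<^esub>}" by auto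
    then have g: "?g \<in> carrier (U_obj A)"
      using insert.prems(1) by (auto simp: U_obj_simps intro: finite_subset)
    have "f = delta x (f x) \<oplus>\<^bsub>U_obj A\<^esub> ?g"
      using insert.prems(1) by (auto simp: fun_eq_iff delta_def U_obj_simps)
    moreover have "P ?g" by (rule insert.IH [OF g]) (use insert.prems(2) in auto)
    ultimately show ?case
      using add [OF _ g, of "delta x (f x)"] delta [of "f x" x] insert.prems(1) by simp
  qed
  have "finite {x. f x \<noteq> \<zero>\<^bsub>A x\<^esub>}" using f by (simp add: U_obj_simps(1))
  then show ?thesis by (rule * [OF _ f]) simp
qed

lemma U_finsum:
  assumes "g \<in> I \<rightarrow> carrier (U_obj A)"
  shows "(\<Oplus>\<^bsub>U_obj A\<^esub>i\<in>I. g i) x = (\<Oplus>\<^bsub>A x\<^esub>i\<in>I. g i x)"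
  using assms
proof (induction I rule: infinite_finite_induct)
  case (insert i I)
  then have "g i \<in> carrier (U_obj A)" "g \<in> I \<rightarrow> carrier (U_obj A)" by auto
  moreover from this have "(\<lambda>i. g i x) \<in> I \<rightarrow> carrier (A x)"
    by (auto intro: U_closed)
  ultimately show ?case using insert by (simp add: U_obj_simps(3))
qed (simp_all add: U_obj_simps(2))

lemma smult_delta:
  assumes a: "a \<in> carrier (A y)"
  shows "(p \<odot>\<^bsub>U_obj A\<^esub> delta y a) x =
    (if x - y \<in> \<int> then Poly_Mapping.lookup p \<lfloor>x - y\<rfloor> \<odot>\<^bsub>A y\<^esub> a else \<zero>\<^bsub>A x\<^esub>)"
proof (induction p rule: poly_mapping_single_induct)
  case (1 k r)
  show ?case
  proof (cases "x - y \<in> \<int>")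
    case True
    then obtain l where "x - y = of_int l" by (auto simp: Ints_def)
    then have l: "x = y + of_int l" by simp
    show ?thesis using a unfolding single_smult_delta [OF a]
      by (auto simp: delta_def l periodic_int lookup_single when_def M.zero_smult)
  next
    case False
    then show ?thesis unfolding single_smult_delta [OF a] by (auto simp: delta_def)
  qed
next
  case (2 p q)
  show ?case
  proof (cases "x - y \<in> \<int>")
    case True
    then obtain l where "x - y = of_int l" by (auto simp: Ints_def)
    then have "A x = A y" using periodic_int [of y l] by (simp add: algebra_simps)
    then show ?thesis using a 2 True by (simp add: U_smult_add lookup_add M.smult_l_distr)
  qed (use a 2 in \<open>simp add: U_smult_add\<close>)
qed

end

section \<open>Invariant morphisms and functoriality\<close>

lemma T_hom_iff:
  "\<phi> \<in> T_hom A B \<longleftrightarrow> (\<forall>x y. left_linear (A x) (B y) (\<phi> x y) \<and> \<phi> x y \<in> extensional (carrier (A x))) \<and>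
     (\<forall>y. finite {x. (x, y) \<in> supp A B \<phi>}) \<and> (\<forall>x. finite {y. (x, y) \<in> supp A B \<phi>}) \<and>
     (\<forall>x y. \<phi> (x + 1) (y + 1) = \<phi> x y)"
  by (auto simp: T_hom_def geometric_morphism_def lin_hom_iff)

locale invariant_morphism = A: invariant_family A + B: invariant_family B
  for A :: "('r::ring_1, 'm) gmod" and B :: "('r, 'm) gmod" +
  fixes \<phi> :: "'m gmor"
  assumes T_hom: "\<phi> \<in> T_hom A B"
begin

lemma component_linear: "left_linear (A x) (B y) (\<phi> x y)"
  using T_hom by (simp add: T_hom_iff)

lemma component_closed [simp]: "a \<in> carrier (A x) \<Longrightarrow> \<phi> x y a \<in> carrier (B y)"
  by (rule left_linear_closed [OF component_linear])

lemma component_zero [simp]: "\<phi> x y \<zero>\<^bsub>A x\<^esub> = \<zero>\<^bsub>B y\<^esub>"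
  by (rule left_linear_zero [OF A.left_module B.left_module component_linear])

lemma component_outside_supp:
  "(x, y) \<notin> supp A B \<phi> \<Longrightarrow> a \<in> carrier (A x) \<Longrightarrow> \<phi> x y a = \<zero>\<^bsub>B y\<^esub>"
  by (auto simp: supp_def)

lemma finite_supp_row: "finite {y. (x, y) \<in> supp A B \<phi>}"
  and finite_supp_column: "finite {x. (x, y) \<in> supp A B \<phi>}"
  using T_hom by (simp_all add: T_hom_iff)

lemma component_shift: "\<phi> (x + of_int k) (y + of_int k) = \<phi> x y"
proof -
  have nat: "\<phi> (x + of_nat n) (y + of_nat n) = \<phi> x y" for n x y
  proof (induction n)
    case (Suc n)
    have "\<phi> (x + of_nat (Suc n)) (y + of_nat (Suc n)) = \<phi> (x + of_nat n + 1) (y + of_nat n + 1)"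
      by (simp add: ac_simps)
    also have "\<dots> = \<phi> (x + of_nat n) (y + of_nat n)" using T_hom by (simp add: T_hom_iff)
    finally show ?case using Suc by simp
  qed simp
  show ?thesis
  proof (cases k rule: int_cases2)
    case (nonpos n)
    then show ?thesis using nat [of "x - of_nat n" n "y - of_nat n"] by simp
  qed (use nat in simp)
qed

lemma U_map_superset:
  assumes f: "f \<in> carrier (U_obj A)" and X: "finite X" "{x. f x \<noteq> \<zero>\<^bsub>A x\<^esub>} \<subseteq> X"
  shows "U_map A B \<phi> f y = (\<Oplus>\<^bsub>B y\<^esub>x\<in>X. \<phi> x y (f x))"
proof -
  have "U_map A B \<phi> f y = (\<Oplus>\<^bsub>B y\<^esub>x\<in>{x. f x \<noteq> \<zero>\<^bsub>A x\<^esub>}. \<phi> x y (f x))"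
    using f by (simp add: U_map_def)
  also have "\<dots> = (\<Oplus>\<^bsub>B y\<^esub>x\<in>X. \<phi> x y (f x))"
    using assms by (intro B.M.add.finprod_mono_neutral_cong_left) auto
  finally show ?thesis .
qed

lemma U_map_delta:
  assumes "a \<in> carrier (A x)"
  shows "U_map A B \<phi> (A.delta x a) y = \<phi> x y a"
proof -
  have "U_map A B \<phi> (A.delta x a) y = (\<Oplus>\<^bsub>B y\<^esub>x'\<in>{x}. \<phi> x' y (A.delta x a x'))"
    by (rule U_map_superset [OF A.delta_closed [OF assms]]) (auto simp: A.delta_def)
  then show ?thesis using assms by (simp add: A.delta_def)
qed

lemma U_map_closed: "f \<in> carrier (U_obj A) \<Longrightarrow> U_map A B \<phi> f \<in> carrier (U_obj B)"
proof -
  assume f: "f \<in> carrier (U_obj A)"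
  let ?X = "{x. f x \<noteq> \<zero>\<^bsub>A x\<^esub>}"
  have X: "finite ?X" using f by (simp add: U_obj_simps)
  have "{y. U_map A B \<phi> f y \<noteq> \<zero>\<^bsub>B y\<^esub>} \<subseteq> (\<Union>x\<in>?X. {y. (x, y) \<in> supp A B \<phi>})"
  proof (rule ccontr)
    assume "\<not> ?thesis"
    then obtain y where y: "U_map A B \<phi> f y \<noteq> \<zero>\<^bsub>B y\<^esub>" "\<And>x. x \<in> ?X \<Longrightarrow> (x, y) \<notin> supp A B \<phi>" by auto
    have "U_map A B \<phi> f y = (\<Oplus>\<^bsub>B y\<^esub>x\<in>?X. \<phi> x y (f x))"
      by (rule U_map_superset [OF f X]) simp
    also have "\<dots> = \<zero>\<^bsub>B y\<^esub>"
      by (rule B.M.add.finprod_one_eqI) (use f y(2) component_outside_supp in auto)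
    finally show False using y(1) by simp
  qed
  then have "finite {y. U_map A B \<phi> f y \<noteq> \<zero>\<^bsub>B y\<^esub>}"
    using X finite_supp_row by (meson finite_UN finite_subset)
  moreover have "U_map A B \<phi> f y \<in> carrier (B y)" for y
    by (subst U_map_superset [OF f X]) (use f in auto)
  ultimately show ?thesis by (simp add: U_obj_simps(1))
qed

lemma U_map_add:
  assumes f: "f \<in> carrier (U_obj A)" and g: "g \<in> carrier (U_obj A)"
  shows "U_map A B \<phi> (f \<oplus>\<^bsub>U_obj A\<^esub> g) = U_map A B \<phi> f \<oplus>\<^bsub>U_obj B\<^esub> U_map A B \<phi> g"
proof
  fix y
  let ?X = "{x. f x \<noteq> \<zero>\<^bsub>A x\<^esub>} \<union> {x. g x \<noteq> \<zero>\<^bsub>A x\<^esub>}"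
  have X: "finite ?X" using f g by (simp add: U_obj_simps)
  have "U_map A B \<phi> (f \<oplus>\<^bsub>U_obj A\<^esub> g) y = (\<Oplus>\<^bsub>B y\<^esub>x\<in>?X. \<phi> x y ((f \<oplus>\<^bsub>U_obj A\<^esub> g) x))"
    by (rule U_map_superset [OF A.U_add_closed [OF f g] X]) (auto simp: U_obj_simps)
  also have "\<dots> = (\<Oplus>\<^bsub>B y\<^esub>x\<in>?X. \<phi> x y (f x) \<oplus>\<^bsub>B y\<^esub> \<phi> x y (g x))"
    using f g by (intro B.M.finsum_cong') (auto simp: U_obj_simps(3) left_linear_add [OF component_linear])
  also have "\<dots> = (\<Oplus>\<^bsub>B y\<^esub>x\<in>?X. \<phi> x y (f x)) \<oplus>\<^bsub>B y\<^esub> (\<Oplus>\<^bsub>B y\<^esub>x\<in>?X. \<phi> x y (g x))"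
    using f g by (intro B.M.finsum_addf) auto
  also have "\<dots> = U_map A B \<phi> f y \<oplus>\<^bsub>B y\<^esub> U_map A B \<phi> g y"
    by (simp add: U_map_superset [OF f X] U_map_superset [OF g X])
  finally show "U_map A B \<phi> (f \<oplus>\<^bsub>U_obj A\<^esub> g) y = (U_map A B \<phi> f \<oplus>\<^bsub>U_obj B\<^esub> U_map A B \<phi> g) y"
    by (simp add: U_obj_simps(3))
qed

text \<open>Reduced to r t^k acting on an element at one point, the claim is the invariance
  \<open>\<phi> (x + k) y = \<phi> x (y - k)\<close>.\<close>

lemma U_map_smult:
  assumes f: "f \<in> carrier (U_obj A)"
  shows "U_map A B \<phi> (p \<odot>\<^bsub>U_obj A\<^esub> f) = p \<odot>\<^bsub>U_obj B\<^esub> U_map A B \<phi> f"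
proof (induction p rule: poly_mapping_single_induct)
  case (1 k r)
  show ?case using f
  proof (induction rule: A.U_induct)
    case (delta x a)
    show ?case
    proof
      fix y
      have "\<phi> (x + of_int k) y = \<phi> x (y - of_int k)"
        using component_shift [of x k "y - of_int k"] by simp
      moreover have "r \<odot>\<^bsub>A x\<^esub> a \<in> carrier (A (x + of_int k))"
        using delta by (simp add: A.periodic_int A.M.smult_closed)
      ultimately show "U_map A B \<phi> (Poly_Mapping.single k r \<odot>\<^bsub>U_obj A\<^esub> A.delta x a) y
          = (Poly_Mapping.single k r \<odot>\<^bsub>U_obj B\<^esub> U_map A B \<phi> (A.delta x a)) y"
        using delta
        by (simp add: A.single_smult_delta U_map_delta B.U_smult_single U_map_closed
            left_linear_smult [OF component_linear] B.periodic_int_diff)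
    qed
  qed (simp add: A.U_smult_add_right B.U_smult_add_right U_map_add U_map_closed A.U_smult_closed)
next
  case (2 p q)
  then show ?case
    using f by (simp add: A.U.smult_l_distr B.U.smult_l_distr U_map_add U_map_closed A.U_smult_closed)
qed

lemma U_map_linear: "left_linear (U_obj A) (U_obj B) (U_map A B \<phi>)"
  by (auto simp: left_linear_def U_map_closed U_map_add U_map_smult)

end

text \<open>Faithfulness of U: the components are recovered from the elements
  \<open>delta x a\<close>, and extensionality settles the rest. Identities between morphisms can
  thus be proved on \<open>U_obj\<close>, where composition is composition of functions.\<close>

lemma T_hom_eqI:
  assumes "invariant_morphism A B \<phi>" "invariant_morphism A B \<psi>"
    and eq: "\<And>f. f \<in> carrier (U_obj A) \<Longrightarrow> U_map A B \<phi> f = U_map A B \<psi> f"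
  shows "\<phi> = \<psi>"
proof (intro ext)
  interpret \<phi>: invariant_morphism A B \<phi> by fact
  interpret \<psi>: invariant_morphism A B \<psi> by fact
  fix x y a
  show "\<phi> x y a = \<psi> x y a"
  proof (cases "a \<in> carrier (A x)")
    case True
    then show ?thesis
      using eq [of "\<phi>.A.delta x a"] \<phi>.U_map_delta [of a x y] \<psi>.U_map_delta [of a x y] by simp
  next
    case False
    then show ?thesis using \<phi>.T_hom \<psi>.T_hom by (simp add: T_hom_iff extensional_def)
  qed
qed

locale invariant_morphism_pair =
  \<phi>: invariant_morphism A B \<phi> + \<psi>: invariant_morphism B C \<psi>
  for A :: "('r::ring_1, 'm) gmod" and B C \<phi> \<psi>
begin

text \<open>\<open>gcomp\<close> sums over the support of \<phi>, \<open>U_map\<close> over the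
  places where the given element is nonzero, and the former set contains the latter. Composites
  thereby inherit linearity and invariance from \<open>U_map\<close>.\<close>

lemma gcomp_eq_U_map:
  assumes a: "a \<in> carrier (A x)"
  shows "gcomp A B C \<psi> \<phi> x z a = U_map B C \<psi> (U_map A B \<phi> (\<phi>.A.delta x a)) z"
proof -
  have "U_map B C \<psi> (U_map A B \<phi> (\<phi>.A.delta x a)) z =
      (\<Oplus>\<^bsub>C z\<^esub>y\<in>{y. (x, y) \<in> supp A B \<phi>}. \<psi> y z (U_map A B \<phi> (\<phi>.A.delta x a) y))"
  proof (rule \<psi>.U_map_superset)
    show "{y. U_map A B \<phi> (\<phi>.A.delta x a) y \<noteq> \<zero>\<^bsub>B y\<^esub>} \<subseteq> {y. (x, y) \<in> supp A B \<phi>}"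
      using a \<phi>.component_outside_supp by (fastforce simp: \<phi>.U_map_delta)
  qed (simp_all add: a \<phi>.U_map_closed \<phi>.finite_supp_row)
  then show ?thesis using a by (simp add: gcomp_def \<phi>.U_map_delta)
qed

lemma supp_gcomp: "supp A C (gcomp A B C \<psi> \<phi>) \<subseteq> supp A B \<phi> O supp B C \<psi>"
proof clarify
  fix x z assume "(x, z) \<in> supp A C (gcomp A B C \<psi> \<phi>)"
  then obtain a where a: "a \<in> carrier (A x)" "gcomp A B C \<psi> \<phi> x z a \<noteq> \<zero>\<^bsub>C z\<^esub>"
    by (auto simp: supp_def)
  have "\<exists>y. (x, y) \<in> supp A B \<phi> \<and> (y, z) \<in> supp B C \<psi>"
  proof (rule ccontr)
    assume "\<not> ?thesis"
    then have "(\<Oplus>\<^bsub>C z\<^esub>y\<in>{y. (x, y) \<in> supp A B \<phi>}. \<psi> y z (\<phi> x y a)) = \<zero>\<^bsub>C z\<^esub>"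
      using a(1) by (intro \<psi>.B.M.add.finprod_one_eqI) (auto intro: \<psi>.component_outside_supp)
    then show False using a by (simp add: gcomp_def)
  qed
  then show "(x, z) \<in> supp A B \<phi> O supp B C \<psi>" by auto
qed

lemma gcomp_T_hom: "gcomp A B C \<psi> \<phi> \<in> T_hom A C"
  unfolding T_hom_iff
proof (intro conjI allI)
  let ?F = "\<lambda>f. U_map B C \<psi> (U_map A B \<phi> f)"
  have F: "left_linear (U_obj A) (U_obj C) ?F"
    by (rule left_linear_comp [OF \<phi>.U_map_linear \<psi>.U_map_linear])
  note Fc = left_linear_closed [OF F] and Fs = left_linear_smult [OF F]
  fix x z
  show "left_linear (A x) (C z) (gcomp A B C \<psi> \<phi> x z)"
    unfolding left_linear_def
  proof (intro conjI ballI allI Pi_I)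
    fix a b r assume a: "a \<in> carrier (A x)"
    show "gcomp A B C \<psi> \<phi> x z a \<in> carrier (C z)"
      using a Fc by (simp add: gcomp_eq_U_map)
    show "gcomp A B C \<psi> \<phi> x z (a \<oplus>\<^bsub>A x\<^esub> b) = gcomp A B C \<psi> \<phi> x z a \<oplus>\<^bsub>C z\<^esub> gcomp A B C \<psi> \<phi> x z b"
      if "b \<in> carrier (A x)"
      using a that left_linear_add [OF F, of "\<phi>.A.delta x a" "\<phi>.A.delta x b"]
      by (simp add: gcomp_eq_U_map \<phi>.A.delta_add) (simp add: U_obj_simps(3))
    have "?F (Poly_Mapping.single 0 r \<odot>\<^bsub>U_obj A\<^esub> \<phi>.A.delta x a) z
        = (Poly_Mapping.single 0 r \<odot>\<^bsub>U_obj C\<^esub> ?F (\<phi>.A.delta x a)) z"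
      using a by (simp add: Fs)
    then show "gcomp A B C \<psi> \<phi> x z (r \<odot>\<^bsub>A x\<^esub> a) = r \<odot>\<^bsub>C z\<^esub> gcomp A B C \<psi> \<phi> x z a"
      using a Fc [of "\<phi>.A.delta x a"]
      by (simp add: \<phi>.A.single_smult_delta \<psi>.B.U_smult_single gcomp_eq_U_map \<phi>.A.M.smult_closed)
  qed
  show "gcomp A B C \<psi> \<phi> x z \<in> extensional (carrier (A x))" by (simp add: gcomp_def)
  have "{y. (x, y) \<in> supp A C (gcomp A B C \<psi> \<phi>)} \<subseteq>
      (\<Union>y\<in>{y. (x, y) \<in> supp A B \<phi>}. {z. (y, z) \<in> supp B C \<psi>})"
    using supp_gcomp by auto
  then show "finite {y. (x, y) \<in> supp A C (gcomp A B C \<psi> \<phi>)}"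
    using \<phi>.finite_supp_row \<psi>.finite_supp_row by (meson finite_UN finite_subset)
  have "{x. (x, z) \<in> supp A C (gcomp A B C \<psi> \<phi>)} \<subseteq>
      (\<Union>y\<in>{y. (y, z) \<in> supp B C \<psi>}. {x. (x, y) \<in> supp A B \<phi>})"
    using supp_gcomp by auto
  then show "finite {x. (x, z) \<in> supp A C (gcomp A B C \<psi> \<phi>)}"
    using \<phi>.finite_supp_column \<psi>.finite_supp_column by (meson finite_UN finite_subset)
  show "gcomp A B C \<psi> \<phi> (x + 1) (z + 1) = gcomp A B C \<psi> \<phi> x z"
  proof
    fix a
    show "gcomp A B C \<psi> \<phi> (x + 1) (z + 1) a = gcomp A B C \<psi> \<phi> x z a"
    proof (cases "a \<in> carrier (A x)")
      case True
      \<comment> \<open>Moving a point by 1 is the action of t, so invariance of the composite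
        follows from Laurent linearity.\<close>
      have t: "\<phi>.A.delta (x + 1) a = Poly_Mapping.single 1 1 \<odot>\<^bsub>U_obj A\<^esub> \<phi>.A.delta x a"
        using True by (simp add: \<phi>.A.single_smult_delta \<phi>.A.M.smult_one)
      have "?F (\<phi>.A.delta (x + 1) a) (z + 1) = 1 \<odot>\<^bsub>C (z + 1)\<^esub> ?F (\<phi>.A.delta x a) z"
        using True Fc [of "\<phi>.A.delta x a"] by (simp add: t Fs \<psi>.B.U_smult_single)
      also have "\<dots> = ?F (\<phi>.A.delta x a) z"
        using True Fc [of "\<phi>.A.delta x a"]
        by (simp add: \<psi>.B.periodic \<psi>.B.M.smult_one)
      finally show ?thesis using True by (simp add: gcomp_eq_U_map \<phi>.A.periodic)
    qed (simp add: gcomp_def \<phi>.A.periodic)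
  qed
qed

sublocale gcomp: invariant_morphism A C "gcomp A B C \<psi> \<phi>"
  by unfold_locales (rule gcomp_T_hom)

lemma U_map_gcomp:
  assumes "f \<in> carrier (U_obj A)"
  shows "U_map A C (gcomp A B C \<psi> \<phi>) f = U_map B C \<psi> (U_map A B \<phi> f)"
  using assms
proof (induction rule: \<phi>.A.U_induct)
  case (delta x a)
  then show ?case by (simp add: fun_eq_iff gcomp.U_map_delta gcomp_eq_U_map)
qed (simp add: \<phi>.U_map_add \<psi>.U_map_add gcomp.U_map_add \<phi>.U_map_closed)

end

lemma (in invariant_family) U_map_gid:
  assumes "f \<in> carrier (U_obj A)"
  shows "U_map A A (gid A) f = f"
proof
  fix y
  have "finite {x. f x \<noteq> \<zero>\<^bsub>A x\<^esub>}" using assms by (simp add: U_obj_simps)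
  then have "(\<Oplus>\<^bsub>A y\<^esub>x\<in>{x. f x \<noteq> \<zero>\<^bsub>A x\<^esub>}. gid A x y (f x))
      = (\<Oplus>\<^bsub>A y\<^esub>x\<in>insert y {x. f x \<noteq> \<zero>\<^bsub>A x\<^esub>}. if y = x then f x else \<zero>\<^bsub>A y\<^esub>)"
    using assms by (intro M.add.finprod_mono_neutral_cong_left) (auto simp: gid_def)
  also have "\<dots> = (\<Oplus>\<^bsub>A y\<^esub>x\<in>insert y {x. f x \<noteq> \<zero>\<^bsub>A x\<^esub>}. if y = x then f y else \<zero>\<^bsub>A y\<^esub>)"
    using assms by (intro M.finsum_cong') auto
  also have "\<dots> = f y"
    using assms \<open>finite _\<close> by (intro M.finsum_singleton [where f = "\<lambda>_. f y"]) auto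
  finally show "U_map A A (gid A) f y = f y" using assms by (simp add: U_map_def)
qed

section \<open>Laurent coordinates and a basis\<close>

context invariant_family
begin

text \<open>The Laurent linear extension of \<open>h\<close>: it reads an element along the orbit of
  \<open>x\<close>, where \<open>h\<close> applies throughout because \<open>A\<close> is
  periodic.\<close>

definition laurent_coord :: "real \<Rightarrow> ('m \<Rightarrow> 'r) \<Rightarrow> (real \<Rightarrow> 'm) \<Rightarrow> int \<Rightarrow>\<^sub>0 'r" where
  "laurent_coord x h f = Abs_poly_mapping (\<lambda>k. h (f (x + of_int k)))"

lemma lookup_laurent_coord:
  assumes h: "functional (A x) h" and f: "f \<in> carrier (U_obj A)"
  shows "Poly_Mapping.lookup (laurent_coord x h f) k = h (f (x + of_int k))"
proof -
  have "h \<zero>\<^bsub>A (x + of_int k)\<^esub> = 0" for k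
    using functional_zero [OF left_module h] by (simp add: periodic_int)
  then have "{k. h (f (x + of_int k)) \<noteq> 0} \<subseteq> (\<lambda>k. x + of_int k) -` {y. f y \<noteq> \<zero>\<^bsub>A y\<^esub>}" by auto
  moreover have "finite ((\<lambda>k::int. x + of_int k) -` {y. f y \<noteq> \<zero>\<^bsub>A y\<^esub>})"
    using f by (intro finite_vimageI) (auto simp: U_obj_simps inj_on_def)
  ultimately have "finite {k. h (f (x + of_int k)) \<noteq> 0}" by (rule finite_subset)
  then show ?thesis by (simp add: laurent_coord_def)
qed

lemma functional_laurent_coord:
  assumes h: "functional (A x) h"
  shows "functional (U_obj A) (laurent_coord x h)"
proof -
  have hadd: "h (a \<oplus>\<^bsub>A (x + of_int k)\<^esub> b) = h a + h b"
    if "a \<in> carrier (A (x + of_int k))" "b \<in> carrier (A (x + of_int k))" for a b k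
    using that functional_add [OF h] by (simp add: periodic_int)
  have add: "laurent_coord x h (f \<oplus>\<^bsub>U_obj A\<^esub> g) = laurent_coord x h f + laurent_coord x h g"
    if "f \<in> carrier (U_obj A)" "g \<in> carrier (U_obj A)" for f g
  proof (rule poly_mapping_eqI)
    fix k
    have "h ((f \<oplus>\<^bsub>U_obj A\<^esub> g) (x + of_int k)) = h (f (x + of_int k)) + h (g (x + of_int k))"
      using that by (simp add: U_obj_simps(3) hadd)
    then show "Poly_Mapping.lookup (laurent_coord x h (f \<oplus>\<^bsub>U_obj A\<^esub> g)) k
        = Poly_Mapping.lookup (laurent_coord x h f + laurent_coord x h g) k"
      using that by (simp add: lookup_laurent_coord [OF h] lookup_add U_add_closed)
  qed
  have "laurent_coord x h (p \<odot>\<^bsub>U_obj A\<^esub> f) = p * laurent_coord x h f"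
    if f: "f \<in> carrier (U_obj A)" for p f
  proof (induction p rule: poly_mapping_single_induct)
    case (1 k r)
    show ?case
    proof (rule poly_mapping_eqI)
      fix l
      have "f (x + of_int l - of_int k) \<in> carrier (A x)"
        using U_closed [OF f, of "x + of_int (l - k)"] periodic_int [of x "l - k"]
        by (simp add: algebra_simps)
      then have "h ((Poly_Mapping.single k r \<odot>\<^bsub>U_obj A\<^esub> f) (x + of_int l))
          = r * h (f (x + of_int l - of_int k))"
        by (simp add: U_smult_single [OF f] periodic_int functional_smult [OF h])
      then show "Poly_Mapping.lookup (laurent_coord x h (Poly_Mapping.single k r \<odot>\<^bsub>U_obj A\<^esub> f)) l
          = Poly_Mapping.lookup (Poly_Mapping.single k r * laurent_coord x h f) l"
        using f by (simp add: lookup_laurent_coord [OF h] U_smult_closed lookup_single_times add_diff_eq)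
    qed
  next
    case (2 p q)
    then show ?case using f by (simp add: U.smult_l_distr add U_smult_closed distrib_right)
  qed
  then show ?thesis using add by (simp add: functional_def)
qed

text \<open>
  The global frame has the elements \<open>els i\<close> placed at the points \<open>pts i\<close>; the points may repeat,
  but those lying in one orbit must carry a frame of the module there.
\<close>

lemma frame_U:
  assumes els: "\<And>i. i < n \<Longrightarrow> els i \<in> carrier (A (pts i))"
    and fs: "\<And>i. i < n \<Longrightarrow> functional (A (pts i)) (fs i)"
    and expand: "\<And>x a. a \<in> carrier (A x) \<Longrightarrow>
      a = (\<Oplus>\<^bsub>A x\<^esub>i\<in>{i. i < n \<and> x - pts i \<in> \<int>}. fs i a \<odot>\<^bsub>A x\<^esub> els i)"
  defines "b \<equiv> \<lambda>i. if i < n then delta (pts i) (els i) else \<zero>\<^bsub>U_obj A\<^esub>"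
    and "f \<equiv> \<lambda>i. if i < n then laurent_coord (pts i) (fs i) else (\<lambda>_. 0)"
  shows "frame (U_obj A) n b f"
    and "(\<And>i j. i < n \<Longrightarrow> j < n \<Longrightarrow> pts i - pts j \<in> \<int> \<Longrightarrow>
        pts i = pts j \<and> fs j (els i) = (if i = j then 1 else 0)) \<Longrightarrow>
      i < n \<Longrightarrow> j < n \<Longrightarrow> f j (b i) = (if i = j then 1 else 0)"
proof -
  have bc: "b i \<in> carrier (U_obj A)" for i by (simp add: b_def els)
  have "m = (\<Oplus>\<^bsub>U_obj A\<^esub>i\<in>{..<n}. f i m \<odot>\<^bsub>U_obj A\<^esub> b i)" if m: "m \<in> carrier (U_obj A)" for m
  proof
    fix x
    have summand: "(f i m \<odot>\<^bsub>U_obj A\<^esub> b i) x =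
        (if x - pts i \<in> \<int> then fs i (m x) \<odot>\<^bsub>A x\<^esub> els i else \<zero>\<^bsub>A x\<^esub>)" if i: "i < n" for i
    proof (cases "x - pts i \<in> \<int>")
      case True
      then obtain l where "x - pts i = of_int l" by (auto simp: Ints_def)
      then have l: "x = pts i + of_int l" by simp
      show ?thesis using i m els [OF i] fs [OF i]
        by (simp add: b_def f_def smult_delta l lookup_laurent_coord periodic_int)
    qed (use i els [OF i] in \<open>simp add: b_def smult_delta\<close>)
    have "(\<Oplus>\<^bsub>U_obj A\<^esub>i\<in>{..<n}. f i m \<odot>\<^bsub>U_obj A\<^esub> b i) x = (\<Oplus>\<^bsub>A x\<^esub>i\<in>{..<n}. (f i m \<odot>\<^bsub>U_obj A\<^esub> b i) x)"
      by (rule U_finsum) (use bc in \<open>auto intro: U_smult_closed\<close>)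
    also have "\<dots> = (\<Oplus>\<^bsub>A x\<^esub>i\<in>{i. i < n \<and> x - pts i \<in> \<int>}. fs i (m x) \<odot>\<^bsub>A x\<^esub> els i)"
    proof (rule M.add.finprod_mono_neutral_cong_right)
      show "(\<lambda>i. (f i m \<odot>\<^bsub>U_obj A\<^esub> b i) x) \<in> {..<n} \<rightarrow> carrier (A x)"
        using bc by (auto intro: U_closed U_smult_closed)
    qed (auto simp: summand)
    also have "\<dots> = m x" using expand [of "m x" x] m by simp
    finally show "m x = (\<Oplus>\<^bsub>U_obj A\<^esub>i\<in>{..<n}. f i m \<odot>\<^bsub>U_obj A\<^esub> b i) x" by simp
  qed
  then show "frame (U_obj A) n b f"
    using bc functional_laurent_coord fs unfolding frame_def
    by (auto simp: b_def f_def functional_def)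
  assume dual: "\<And>i j. i < n \<Longrightarrow> j < n \<Longrightarrow> pts i - pts j \<in> \<int> \<Longrightarrow>
      pts i = pts j \<and> fs j (els i) = (if i = j then 1 else 0)"
    and ij: "i < n" "j < n"
  show "f j (b i) = (if i = j then 1 else 0)"
  proof (rule poly_mapping_eqI)
    fix k
    have f0: "fs j \<zero>\<^bsub>A (pts j + of_int k)\<^esub> = 0"
      using functional_zero [OF left_module fs [OF ij(2)]] by (simp add: periodic_int)
    have "Poly_Mapping.lookup (f j (b i)) k = fs j (delta (pts i) (els i) (pts j + of_int k))"
      using ij by (simp add: b_def f_def lookup_laurent_coord fs els)
    \<comment> \<open>If \<open>pts j + k\<close> meets \<open>pts i\<close>, the two points lie in
      one orbit, so by the duality hypothesis they coincide and k = 0.\<close>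
    also have "\<dots> = (if i = j \<and> k = 0 then 1 else 0)"
    proof (cases "pts j + of_int k = pts i")
      case True
      then have "pts i - pts j = of_int k" by simp
      then have "pts i = pts j" "fs j (els i) = (if i = j then 1 else 0)"
        using dual [OF ij] by auto
      then show ?thesis using True by (simp add: delta_def)
    qed (auto simp: delta_def f0)
    finally show "Poly_Mapping.lookup (f j (b i)) k
        = Poly_Mapping.lookup (if i = j then 1 else 0) k"
      by (simp add: lookup_one when_def)
  qed
qed

end

lemma T_obj_invariant_family: "A \<in> T_obj \<Longrightarrow> invariant_family A"
  by (auto simp: T_obj_def geometric_module_def fg_free_def invariant_family_def)

text \<open>The open sets that witness local finiteness cover a compact interval, so finitely many
  of them suffice.\<close>

lemma finite_gsupport_interval:
  assumes "geometric_module A"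
  shows "finite (gsupport A \<inter> {0..1})"
proof -
  from assms obtain W where W: "\<And>x. open (W x) \<and> x \<in> W x \<and> finite (W x \<inter> gsupport A)"
    unfolding geometric_module_def by metis
  obtain C where "C \<subseteq> {0..1::real}" "finite C" "{0..1} \<subseteq> (\<Union>c\<in>C. W c)"
    using compactE_image [OF compact_Icc, of "{0..1}" W 0 1] W by (metis UN_iff subsetI)
  then have "gsupport A \<inter> {0..1} \<subseteq> (\<Union>c\<in>C. W c \<inter> gsupport A)" by auto
  then show ?thesis using \<open>finite C\<close> W by (meson finite_UN finite_subset)
qed

text \<open>The interval [0,1) contains exactly one point of every orbit and finitely many points of
  the support. The bases of the modules at these points are collected, with their Laurent
  coordinates as dual functionals.\<close>

lemma U_obj_has_basis:
  assumes A: "A \<in> T_obj"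
  shows "\<exists>bs. is_basis (U_obj A) bs"
proof -
  interpret invariant_family A using A by (rule T_obj_invariant_family)
  define X where "X = gsupport A \<inter> {0..<1}"
  have X: "finite X"
    using A by (auto simp: X_def T_obj_def intro: finite_subset [OF _ finite_gsupport_interval])
  have "\<forall>x. \<exists>bs. is_basis (A x) bs"
    using A by (auto simp: T_obj_def geometric_module_def fg_free_def)
  then obtain bs where bs: "\<And>x. is_basis (A x) (bs x)" by metis
  define b where "b x = (\<lambda>i. if i < length (bs x) then bs x ! i else \<zero>\<^bsub>A x\<^esub>)" for x
  define f where "f x = (\<lambda>i. if i < length (bs x) then \<lambda>m. if m \<in> carrier (A x) then coords (A x) (bs x) m i else 0
      else (\<lambda>_. 0))" for x
  have fr1: "frame (A x) (length (bs x)) (b x) (f x)" for x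
    unfolding b_def f_def by (rule is_basis_frame(1) [OF left_module bs])
  have fr2: "f x j (b x i) = (if i = j then 1 else 0)" if "i < length (bs x)" "j < length (bs x)" for x i j
    unfolding b_def f_def by (rule is_basis_frame(2) [OF left_module bs that])
  let ?S = "SIGMA x:X. {..<length (bs x)}"
  \<comment> \<open>\<open>e\<close> numbers the pairs of a support point and a position in its
    basis, since \<open>frame_U\<close> takes a single list of vectors in which points may
    repeat.\<close>
  obtain e where e: "bij_betw e {0..<card ?S} ?S"
    using ex_bij_betw_nat_finite [of ?S] X by auto
  define n where "n = card ?S"
  define pts where "pts i = fst (e i)" for i
  define idx where "idx i = snd (e i)" for i
  have e_mem: "pts i \<in> X" "idx i < length (bs (pts i))" if "i < n" for i
    using bspec [OF bij_betwE [OF e], of i] that by (auto simp: n_def pts_def idx_def)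
  have e_inj: "i = j" if "i < n" "j < n" "pts i = pts j" "idx i = idx j" for i j
    using that inj_onD [OF bij_betw_imp_inj_on [OF e], of i j]
    by (simp add: n_def pts_def idx_def prod_eq_iff)
  have e_surj: "\<exists>i<n. pts i = x \<and> idx i = j" if "x \<in> X" "j < length (bs x)" for x j
  proof -
    have "(x, j) \<in> e ` {0..<n}" using that bij_betw_imp_surj_on [OF e] by (simp add: n_def)
    then obtain i where "i < n" "e i = (x, j)" by auto
    then show ?thesis by (auto simp: pts_def idx_def intro!: exI [of _ i])
  qed
  \<comment> \<open>Points of [0,1) represent their orbits uniquely, so lying in the orbit of x
    means being \<open>frac x\<close>.\<close>
  have pts_frac: "x - pts i \<in> \<int> \<longleftrightarrow> pts i = frac x" if "i < n" for x i
    using e_mem(1) [OF that] frac_unique_iff [of x "pts i"] by (auto simp: X_def)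
  have els: "b (pts i) (idx i) \<in> carrier (A (pts i))" for i by (rule frameD(1) [OF fr1])
  have fs: "functional (A (pts i)) (f (pts i) (idx i))" for i by (rule frameD(2) [OF fr1])
  have dual: "pts i = pts j \<and> f (pts j) (idx j) (b (pts i) (idx i)) = (if i = j then 1 else 0)"
    if "i < n" "j < n" "pts i - pts j \<in> \<int>" for i j
  proof -
    have "pts j = frac (pts i)" using pts_frac that by simp
    also have "\<dots> = pts i" using pts_frac [of i "pts i"] that by simp
    finally have eq: "pts i = pts j" by simp
    then show ?thesis
      using fr2 [of "idx i" "pts j" "idx j"] e_mem(2) [of i] e_mem(2) [of j] that e_inj [of i j]
      by auto
  qed
  have expand: "a = (\<Oplus>\<^bsub>A x\<^esub>i\<in>{i. i < n \<and> x - pts i \<in> \<int>}. f (pts i) (idx i) a \<odot>\<^bsub>A x\<^esub> b (pts i) (idx i))"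
    if a: "a \<in> carrier (A x)" for x a
  proof -
    let ?y = "frac x" and ?I = "{i. i < n \<and> x - pts i \<in> \<int>}"
    have I: "?I = {i. i < n \<and> pts i = frac x}" using pts_frac by auto
    have Ax: "A x = A ?y" using periodic_int_diff [of x "\<lfloor>x\<rfloor>"] by (simp add: frac_def)
    show "a = (\<Oplus>\<^bsub>A x\<^esub>i\<in>?I. f (pts i) (idx i) a \<odot>\<^bsub>A x\<^esub> b (pts i) (idx i))"
    proof (cases "?y \<in> X")
      case True
      have inj: "inj_on idx ?I" using e_inj unfolding I by (auto simp: inj_on_def)
      have img: "idx ` ?I = {..<length (bs ?y)}"
      proof (intro equalityI subsetI)
        fix j assume "j \<in> {..<length (bs ?y)}"
        then show "j \<in> idx ` ?I" using e_surj [OF True, of j] unfolding I by auto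
      next
        fix j assume "j \<in> idx ` ?I"
        then obtain i where "i < n" "pts i = ?y" "j = idx i" unfolding I by auto
        then show "j \<in> {..<length (bs ?y)}" using e_mem(2) [of i] by simp
      qed
      have "a = (\<Oplus>\<^bsub>A x\<^esub>j\<in>idx ` ?I. f ?y j a \<odot>\<^bsub>A x\<^esub> b ?y j)"
        unfolding img Ax using a Ax by (intro frameD(5) [OF fr1]) simp
      also have "\<dots> = (\<Oplus>\<^bsub>A x\<^esub>i\<in>?I. f ?y (idx i) a \<odot>\<^bsub>A x\<^esub> b ?y (idx i))"
        using frameD(1) [OF fr1] inj by (subst M.finsum_reindex) (auto simp: Ax M.smult_closed)
      also have "\<dots> = (\<Oplus>\<^bsub>A x\<^esub>i\<in>?I. f (pts i) (idx i) a \<odot>\<^bsub>A x\<^esub> b (pts i) (idx i))"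
        using frameD(1) [OF fr1] by (intro M.finsum_cong') (auto simp: I Ax M.smult_closed)
      finally show ?thesis .
    next
      case False
      \<comment> \<open>The orbit of x misses the support: the module at x is zero and the sum is
        empty.\<close>
      then have "carrier (A ?y) = {\<zero>\<^bsub>A ?y\<^esub>}"
        by (auto simp: X_def gsupport_def frac_lt_1)
      moreover have "?I = {}" using False e_mem(1) unfolding I by fastforce
      ultimately show ?thesis using a Ax by (simp only: M.finsum_empty) simp
    qed
  qed
  note global = frame_U [of n "\<lambda>i. b (pts i) (idx i)" pts "\<lambda>i. f (pts i) (idx i)"]
  show ?thesis
  proof (rule exI, rule is_basis_of_frame [OF U.left_module_axioms])
    show "frame (U_obj A) n
        (\<lambda>i. if i < n then delta (pts i) (b (pts i) (idx i)) else \<zero>\<^bsub>U_obj A\<^esub>)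
        (\<lambda>i. if i < n then laurent_coord (pts i) (f (pts i) (idx i)) else (\<lambda>_. 0))"
      by (rule global(1)) (assumption | rule els | rule fs | erule expand)+
  qed (rule global(2); (assumption | rule els | rule fs | erule expand | rule dual)+)
qed

section \<open>The homomorphism on \<open>K\<^sub>1\<close>\<close>

lemma T_inverse_automorphism:
  assumes A: "invariant_family A" and inv: "T_inverse A \<phi> \<psi>"
  shows "automorphism (U_obj A) (U_map A A \<phi>)"
proof -
  interpret invariant_family A by fact
  interpret P: invariant_morphism_pair A A A \<phi> \<psi>
    using inv by unfold_locales (auto simp: T_inverse_def)
  interpret Q: invariant_morphism_pair A A A \<psi> \<phi> ..
  show ?thesis unfolding automorphism_def
    using P.\<phi>.U_map_linear P.\<psi>.U_map_linear P.U_map_gcomp Q.U_map_gcomp inv U_map_gid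
    by (metis T_inverse_def)
qed

lemma T_AutD:
  assumes "(A, \<phi>) \<in> T_Aut"
  shows "invariant_morphism A A \<phi>" "automorphism (U_obj A) (U_map A A \<phi>)" "A \<in> T_obj"
  using assms T_inverse_automorphism T_obj_invariant_family
  by (auto simp: T_Aut_def T_inverse_def invariant_morphism_def invariant_morphism_axioms_def)

lemma gid_T_hom:
  assumes "invariant_family A"
  shows "gid A \<in> T_hom A A"
proof -
  interpret invariant_family A by fact
  have "supp A A (gid A) \<subseteq> Id" by (auto simp: supp_def gid_def)
  then have "{x. (x, y) \<in> supp A A (gid A)} \<subseteq> {y}" "{z. (y, z) \<in> supp A A (gid A)} \<subseteq> {y}" for y
    by auto
  then have "finite {x. (x, y) \<in> supp A A (gid A)}" "finite {z. (y, z) \<in> supp A A (gid A)}" for y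
    by (meson finite.emptyI finite.insertI finite_subset)+
  then show ?thesis
    by (auto simp: T_hom_iff left_linear_def gid_def periodic M.smult_closed M.smult_zero)
qed

text \<open>The inverse is the composite of the inverses in reverse order. The two equations are
  checked after applying the faithful U, which turns \<open>gcomp\<close> into composition of
  functions.\<close>

lemma T_Aut_gcomp:
  assumes "(A, \<phi>) \<in> T_Aut" "(A, \<psi>) \<in> T_Aut"
  shows "(A, gcomp A A A \<psi> \<phi>) \<in> T_Aut"
proof -
  obtain \<phi>' \<psi>' where inv: "T_inverse A \<phi> \<phi>'" "T_inverse A \<psi> \<psi>'" and A: "A \<in> T_obj"
    using assms by (auto simp: T_Aut_def)
  interpret invariant_family A using A by (rule T_obj_invariant_family)
  interpret P: invariant_morphism_pair A A A \<phi> \<psi>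
    using inv by unfold_locales (auto simp: T_inverse_def)
  interpret Q: invariant_morphism_pair A A A \<psi>' \<phi>'
    using inv by unfold_locales (auto simp: T_inverse_def)
  interpret PQ: invariant_morphism_pair A A A "gcomp A A A \<psi> \<phi>" "gcomp A A A \<phi>' \<psi>'" ..
  interpret QP: invariant_morphism_pair A A A "gcomp A A A \<phi>' \<psi>'" "gcomp A A A \<psi> \<phi>" ..
  interpret I: invariant_morphism A A "gid A"
    by unfold_locales (rule gid_T_hom [OF invariant_family_axioms])
  interpret R1: invariant_morphism_pair A A A \<phi> \<phi>' ..
  interpret R2: invariant_morphism_pair A A A \<phi>' \<phi> ..
  interpret R3: invariant_morphism_pair A A A \<psi> \<psi>' ..
  interpret R4: invariant_morphism_pair A A A \<psi>' \<psi> ..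
  have cancel: "U_map A A \<phi>' (U_map A A \<phi> f) = f" "U_map A A \<phi> (U_map A A \<phi>' f) = f"
      "U_map A A \<psi>' (U_map A A \<psi> f) = f" "U_map A A \<psi> (U_map A A \<psi>' f) = f"
    if "f \<in> carrier (U_obj A)" for f
    using that inv U_map_gid R1.U_map_gcomp R2.U_map_gcomp R3.U_map_gcomp R4.U_map_gcomp
    by (simp_all add: T_inverse_def)
  have "gcomp A A A (gcomp A A A \<phi>' \<psi>') (gcomp A A A \<psi> \<phi>) = gid A"
    by (rule T_hom_eqI [OF PQ.gcomp.invariant_morphism_axioms I.invariant_morphism_axioms])
       (simp add: PQ.U_map_gcomp P.U_map_gcomp Q.U_map_gcomp U_map_gid cancel
         P.\<phi>.U_map_closed P.\<psi>.U_map_closed)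
  moreover have "gcomp A A A (gcomp A A A \<psi> \<phi>) (gcomp A A A \<phi>' \<psi>') = gid A"
    by (rule T_hom_eqI [OF QP.gcomp.invariant_morphism_axioms I.invariant_morphism_axioms])
       (simp add: QP.U_map_gcomp P.U_map_gcomp Q.U_map_gcomp U_map_gid cancel
         Q.\<phi>.U_map_closed Q.\<psi>.U_map_closed)
  ultimately have "T_inverse A (gcomp A A A \<psi> \<phi>) (gcomp A A A \<phi>' \<psi>')"
    by (simp add: T_inverse_def P.gcomp_T_hom Q.gcomp_T_hom)
  then show ?thesis using A by (auto simp: T_Aut_def)
qed

lemma K1_aut_class_U:
  assumes "(A, \<phi>) \<in> T_Aut" "frame (U_obj A) n b f"
  shows "K1_aut_class (U_obj A) (U_map A A \<phi>) = K1_class (frame_aut b f (U_map A A \<phi>))"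
proof -
  interpret invariant_family A using T_AutD(3) [OF assms(1)] by (rule T_obj_invariant_family)
  show ?thesis
    using U_obj_has_basis [OF T_AutD(3) [OF assms(1)]] K1_aut_class_eq [OF U.left_module_axioms _ assms(2)]
      T_AutD(2) [OF assms(1)] by blast
qed

lemma U_obj_has_frame:
  assumes "A \<in> T_obj"
  obtains n b f where "frame (U_obj A) n b f"
proof -
  interpret invariant_family A using assms by (rule T_obj_invariant_family)
  show ?thesis
    using U_obj_has_basis [OF assms] is_basis_frame(1) [OF U.left_module_axioms] that by blast
qed

lemma K1_aut_class_U_closed:
  assumes "(A, \<phi>) \<in> T_Aut"
  shows "K1_aut_class (U_obj A) (U_map A A \<phi>) \<in> carrier K1"
proof -
  interpret invariant_family A using T_AutD(3) [OF assms] by (rule T_obj_invariant_family)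
  obtain n b f where fr: "frame (U_obj A) n b f" using U_obj_has_frame [OF T_AutD(3) [OF assms]] .
  show ?thesis
    using K1_class_closed [OF is_GL_frame_aut [OF U.left_module_axioms fr T_AutD(2) [OF assms]]]
    by (simp add: K1_aut_class_U [OF assms fr])
qed

text \<open>The row convention reverses composition, so the class of \<phi> stands on the
  left.\<close>

lemma K1_aut_class_U_gcomp:
  assumes "(A, \<phi>) \<in> T_Aut" "(A, \<psi>) \<in> T_Aut"
  shows "K1_aut_class (U_obj A) (U_map A A (gcomp A A A \<psi> \<phi>)) =
    K1_aut_class (U_obj A) (U_map A A \<phi>) \<otimes>\<^bsub>K1\<^esub> K1_aut_class (U_obj A) (U_map A A \<psi>)"
proof -
  interpret invariant_family A using T_AutD(3) [OF assms(1)] by (rule T_obj_invariant_family)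
  interpret P: invariant_morphism_pair A A A \<phi> \<psi>
    using T_AutD(1) [OF assms(1)] T_AutD(1) [OF assms(2)] by (simp add: invariant_morphism_pair_def)
  obtain n b f where fr: "frame (U_obj A) n b f" using U_obj_has_frame [OF T_AutD(3) [OF assms(1)]] .
  have "frame_aut b f (U_map A A (gcomp A A A \<psi> \<phi>))
      = frame_aut b f (\<lambda>x. U_map A A \<psi> (U_map A A \<phi> x))"
    by (rule frame_aut_cong [OF fr]) (rule P.U_map_gcomp)
  also have "\<dots> = frame_aut b f (U_map A A \<phi>) * frame_aut b f (U_map A A \<psi>)"
    by (rule frame_aut_mult [OF U.left_module_axioms fr P.\<phi>.U_map_linear P.\<psi>.U_map_linear, symmetric])
  finally show ?thesis
    using K1_class_mult [OF is_GL_frame_aut [OF U.left_module_axioms fr T_AutD(2) [OF assms(1)]]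
        is_GL_frame_aut [OF U.left_module_axioms fr T_AutD(2) [OF assms(2)]]]
    by (simp add: K1_aut_class_U [OF _ fr] assms T_Aut_gcomp)
qed

text \<open>U carries the structure maps of the sum to Laurent linear maps with the same identities,
  which are the hypotheses of \<open>K1_class_frame_aut_direct_sum\<close>.\<close>

lemma K1_aut_class_U_direct_sum:
  assumes auts: "(A, \<phi>) \<in> T_Aut" "(B, \<psi>) \<in> T_Aut" "(C, \<chi>) \<in> T_Aut"
    and sum: "T_direct_sum A \<phi> B \<psi> C \<chi>"
  shows "K1_aut_class (U_obj C) (U_map C C \<chi>) =
    K1_aut_class (U_obj A) (U_map A A \<phi>) \<otimes>\<^bsub>K1\<^esub> K1_aut_class (U_obj B) (U_map B B \<psi>)"
proof -
  interpret A: invariant_morphism A A \<phi> by (rule T_AutD(1) [OF auts(1)])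
  interpret B: invariant_morphism B B \<psi> by (rule T_AutD(1) [OF auts(2)])
  interpret C: invariant_morphism C C \<chi> by (rule T_AutD(1) [OF auts(3)])
  obtain i j p q where hom: "i \<in> T_hom A C" "j \<in> T_hom B C" "p \<in> T_hom C A" "q \<in> T_hom C B"
    and pi: "gcomp A C A p i = gid A" and qj: "gcomp B C B q j = gid B"
    and ipjq: "gadd C C (gcomp C A C i p) (gcomp C B C j q) = gid C"
    and \<chi>i: "gcomp A C C \<chi> i = gcomp A A C i \<phi>" and \<chi>j: "gcomp B C C \<chi> j = gcomp B B C j \<psi>"
    using sum by (auto simp: T_direct_sum_def)
  interpret i: invariant_morphism A C i by unfold_locales (rule hom)
  interpret j: invariant_morphism B C j by unfold_locales (rule hom)
  interpret p: invariant_morphism C A p by unfold_locales (rule hom)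
  interpret q: invariant_morphism C B q by unfold_locales (rule hom)
  interpret pi: invariant_morphism_pair A C A i p ..
  interpret qj: invariant_morphism_pair B C B j q ..
  interpret ip: invariant_morphism_pair C A C p i ..
  interpret jq: invariant_morphism_pair C B C q j ..
  interpret xi: invariant_morphism_pair A C C i \<chi> ..
  interpret xj: invariant_morphism_pair B C C j \<chi> ..
  interpret ix: invariant_morphism_pair A A C \<phi> i ..
  interpret jx: invariant_morphism_pair B B C \<psi> j ..
  \<comment> \<open>\<open>gadd\<close> is defined by components, so its equation is read off on
    elements \<open>delta x a\<close> and extended by additivity.\<close>
  have decomp: "U_map A C i (U_map C A p f) \<oplus>\<^bsub>U_obj C\<^esub> U_map B C j (U_map C B q f) = f"
    if "f \<in> carrier (U_obj C)" for f
    using that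
  proof (induction rule: C.A.U_induct)
    case (delta x a)
    show ?case
    proof
      fix y
      have "gcomp C A C i p x y a \<oplus>\<^bsub>C y\<^esub> gcomp C B C j q x y a = gid C x y a"
        using fun_cong [OF fun_cong [OF fun_cong [OF ipjq]], of x y a] delta by (simp add: gadd_def)
      then show "(U_map A C i (U_map C A p (C.A.delta x a)) \<oplus>\<^bsub>U_obj C\<^esub>
          U_map B C j (U_map C B q (C.A.delta x a))) y = C.A.delta x a y"
        using delta by (simp add: U_obj_simps(3) ip.gcomp_eq_U_map jq.gcomp_eq_U_map)
          (auto simp: gid_def C.A.delta_def)
    qed
  next
    case (add f g)
    let ?i = "\<lambda>f. U_map A C i (U_map C A p f)" and ?j = "\<lambda>f. U_map B C j (U_map C B q f)"
    have c: "?i f \<in> carrier (U_obj C)" "?i g \<in> carrier (U_obj C)"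
        "?j f \<in> carrier (U_obj C)" "?j g \<in> carrier (U_obj C)"
      using add(1,2) by (simp_all add: i.U_map_closed j.U_map_closed p.U_map_closed q.U_map_closed)
    have "?i (f \<oplus>\<^bsub>U_obj C\<^esub> g) \<oplus>\<^bsub>U_obj C\<^esub> ?j (f \<oplus>\<^bsub>U_obj C\<^esub> g)
        = (?i f \<oplus>\<^bsub>U_obj C\<^esub> ?i g) \<oplus>\<^bsub>U_obj C\<^esub> (?j f \<oplus>\<^bsub>U_obj C\<^esub> ?j g)"
      using add(1,2) by (simp add: i.U_map_add j.U_map_add p.U_map_add q.U_map_add
          p.U_map_closed q.U_map_closed)
    also have "\<dots> = (?i f \<oplus>\<^bsub>U_obj C\<^esub> ?j f) \<oplus>\<^bsub>U_obj C\<^esub> (?i g \<oplus>\<^bsub>U_obj C\<^esub> ?j g)"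
      using c by (simp add: C.A.U.a_ac C.A.U_add_closed)
    finally show ?case using add by simp
  qed
  obtain nA bA fA where frA: "frame (U_obj A) nA bA fA" using U_obj_has_frame [OF T_AutD(3) [OF auts(1)]] .
  obtain nB bB fB where frB: "frame (U_obj B) nB bB fB" using U_obj_has_frame [OF T_AutD(3) [OF auts(2)]] .
  obtain nC bC fC where frC: "frame (U_obj C) nC bC fC" using U_obj_has_frame [OF T_AutD(3) [OF auts(3)]] .
  have "K1_class (frame_aut bC fC (U_map C C \<chi>)) =
      K1_class (frame_aut bA fA (U_map A A \<phi>)) \<otimes>\<^bsub>K1\<^esub> K1_class (frame_aut bB fB (U_map B B \<psi>))"
  proof (rule K1_class_frame_aut_direct_sum
      [OF A.A.U.left_module_axioms B.A.U.left_module_axioms C.A.U.left_module_axioms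
        i.U_map_linear p.U_map_linear j.U_map_linear q.U_map_linear _ _ decomp
        T_AutD(2) [OF auts(1)] T_AutD(2) [OF auts(2)] C.U_map_linear _ _ frA frB frC])
    fix f assume f: "f \<in> carrier (U_obj A)"
    show "U_map C A p (U_map A C i f) = f"
      using f pi.U_map_gcomp [OF f] by (simp add: pi A.A.U_map_gid)
    show "U_map C C \<chi> (U_map A C i f) = U_map A C i (U_map A A \<phi> f)"
      using f xi.U_map_gcomp [OF f] ix.U_map_gcomp [OF f] by (simp add: \<chi>i)
  next
    fix f assume f: "f \<in> carrier (U_obj B)"
    show "U_map C B q (U_map B C j f) = f"
      using f qj.U_map_gcomp [OF f] by (simp add: qj B.A.U_map_gid)
    show "U_map C C \<chi> (U_map B C j f) = U_map B C j (U_map B B \<psi> f)"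
      using f xj.U_map_gcomp [OF f] jx.U_map_gcomp [OF f] by (simp add: \<chi>j)
  qed
  then show ?thesis
    by (simp add: K1_aut_class_U [OF auts(1) frA] K1_aut_class_U [OF auts(2) frB]
        K1_aut_class_U [OF auts(3) frC])
qed

section \<open>The extension to the free abelian group and its kernel\<close>

lemma U_free_superset:
  assumes "finite S" "S \<subseteq> T_Aut" "Poly_Mapping.keys c \<subseteq> S"
  shows "U_free c = (\<Otimes>\<^bsub>K1\<^esub>a\<in>S.
     K1_aut_class (U_obj (fst a)) (U_map (fst a) (fst a) (snd a)) [^]\<^bsub>K1\<^esub> Poly_Mapping.lookup c a)"
proof -
  show ?thesis unfolding U_free_def
    using assms
    by (intro K1.finprod_mono_neutral_cong_left)
       (auto simp: in_keys_iff intro!: K1.int_pow_closed K1_aut_class_U_closed)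
qed

lemma U_free_closed: "Poly_Mapping.keys c \<subseteq> T_Aut \<Longrightarrow> U_free c \<in> carrier K1"
proof -
  assume "Poly_Mapping.keys c \<subseteq> T_Aut"
  then show ?thesis unfolding U_free_def
    by (intro K1.finprod_closed) (auto intro!: K1.int_pow_closed K1_aut_class_U_closed)
qed

text \<open>The support condition keeps all factors in \<open>K1\<close>, where powers add and
  finite products can be split.\<close>

lemma U_free_add:
  assumes "Poly_Mapping.keys c \<subseteq> T_Aut" "Poly_Mapping.keys d \<subseteq> T_Aut"
  shows "U_free (c + d) = U_free c \<otimes>\<^bsub>K1\<^esub> U_free d"
proof -
  let ?S = "Poly_Mapping.keys c \<union> Poly_Mapping.keys d"
  let ?k = "\<lambda>a. K1_aut_class (U_obj (fst a)) (U_map (fst a) (fst a) (snd a))"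
  have S: "finite ?S" "?S \<subseteq> T_Aut" using assms by auto
  have k: "?k a \<in> carrier K1" if "a \<in> ?S" for a
    using K1_aut_class_U_closed [of "fst a" "snd a"] that S by auto
  have "U_free (c + d) = (\<Otimes>\<^bsub>K1\<^esub>a\<in>?S. ?k a [^]\<^bsub>K1\<^esub> Poly_Mapping.lookup (c + d) a)"
    using S Poly_Mapping.keys_add by (rule U_free_superset)
  also have "\<dots> = (\<Otimes>\<^bsub>K1\<^esub>a\<in>?S. ?k a [^]\<^bsub>K1\<^esub> Poly_Mapping.lookup c a \<otimes>\<^bsub>K1\<^esub> ?k a [^]\<^bsub>K1\<^esub> Poly_Mapping.lookup d a)"
    using k by (intro K1.finprod_cong') (auto simp: lookup_add K1.int_pow_mult)
  also have "\<dots> = (\<Otimes>\<^bsub>K1\<^esub>a\<in>?S. ?k a [^]\<^bsub>K1\<^esub> Poly_Mapping.lookup c a) \<otimes>\<^bsub>K1\<^esub>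
      (\<Otimes>\<^bsub>K1\<^esub>a\<in>?S. ?k a [^]\<^bsub>K1\<^esub> Poly_Mapping.lookup d a)"
    using k by (intro K1.finprod_multf) auto
  also have "\<dots> = U_free c \<otimes>\<^bsub>K1\<^esub> U_free d"
    using S by (simp add: U_free_superset [of ?S])
  finally show ?thesis .
qed

lemma U_free_zero: "U_free 0 = \<one>\<^bsub>K1\<^esub>"
proof -
  show ?thesis by (simp add: U_free_def)
qed

lemma U_free_uminus:
  assumes "Poly_Mapping.keys c \<subseteq> T_Aut"
  shows "U_free (- c) = inv\<^bsub>K1\<^esub> U_free c"
proof -
  have "U_free (- c) \<otimes>\<^bsub>K1\<^esub> U_free c = \<one>\<^bsub>K1\<^esub>"
    using assms by (simp flip: U_free_add add: U_free_zero)
  then show ?thesis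
    using assms K1.inv_equality [of "U_free (- c)" "U_free c"] U_free_closed [of c] U_free_closed [of "- c"]
    by simp
qed

lemma U_free_frag_of:
  assumes "(A, \<phi>) \<in> T_Aut"
  shows "U_free (frag_of (A, \<phi>)) = K1_aut_class (U_obj A) (U_map A A \<phi>)"
proof -
  show ?thesis
    using K1_aut_class_U_closed [OF assms] by (simp add: U_free_def)
qed

lemma K1_T_relations_kernel:
  fixes c :: "(('r::ring_1, 'm) gmod \<times> 'm gmor) \<Rightarrow>\<^sub>0 int"
  assumes "c \<in> K1_T_relations"
  shows "Poly_Mapping.keys c \<subseteq> T_Aut" "U_free c = \<one>\<^bsub>K1\<^esub>"
proof -
  \<comment> \<open>Both kinds of relations have the form x - y - z. The order of z and y in the
    hypothesis is the reversed one delivered by \<open>K1_aut_class_U_gcomp\<close>; for direct sums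
    commutativity adjusts it.\<close>
  have rel: "Poly_Mapping.keys (frag_of x - frag_of y - frag_of z) \<subseteq> T_Aut \<and>
      U_free (frag_of x - frag_of y - frag_of z) = \<one>\<^bsub>K1\<^esub>"
    if mem: "x \<in> T_Aut" "y \<in> T_Aut" "z \<in> T_Aut"
      and eq: "U_free (frag_of x) = U_free (frag_of z) \<otimes>\<^bsub>K1\<^esub> U_free (frag_of y)"
    for x y z :: "('r, 'm) gmod \<times> 'm gmor"
  proof
    let ?c = "frag_of x - frag_of y - frag_of z"
    have "Poly_Mapping.keys ?c \<subseteq> {x} \<union> {y} \<union> {z}"
      using keys_diff [of "frag_of x - frag_of y" "frag_of z"] keys_diff [of "frag_of x" "frag_of y"]
      by auto
    then show keys: "Poly_Mapping.keys ?c \<subseteq> T_Aut" using mem by auto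
    have closed: "U_free (frag_of u) \<in> carrier K1" if "u \<in> T_Aut" for u :: "('r, 'm) gmod \<times> 'm gmor"
      using that by (intro U_free_closed) auto
    have yz: "Poly_Mapping.keys (frag_of y + frag_of z) \<subseteq> T_Aut"
      using Poly_Mapping.keys_add [of "frag_of y" "frag_of z"] mem by auto
    \<comment> \<open>Adding y + z back turns the difference into a sum, to which
      \<open>U_free_add\<close> applies; then the value at x cancels.\<close>
    have "U_free (frag_of x) = U_free (?c + (frag_of y + frag_of z))" by simp
    also have "\<dots> = U_free ?c \<otimes>\<^bsub>K1\<^esub> U_free (frag_of y + frag_of z)"
      by (rule U_free_add [OF keys yz])
    also have "U_free (frag_of y + frag_of z) = U_free (frag_of y) \<otimes>\<^bsub>K1\<^esub> U_free (frag_of z)"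
      using mem by (intro U_free_add) auto
    finally have "U_free ?c \<otimes>\<^bsub>K1\<^esub> U_free (frag_of x) = U_free (frag_of x)"
      using eq closed mem by (simp add: K1.m_comm)
    then show "U_free ?c = \<one>\<^bsub>K1\<^esub>"
      using closed [OF mem(1)] U_free_closed [OF keys] by simp
  qed
  have "Poly_Mapping.keys c \<subseteq> T_Aut \<and> U_free c = \<one>\<^bsub>K1\<^esub>"
    using assms unfolding K1_T_relations_def
  proof (elim UnE CollectE exE conjE; hypsubst)
    fix A \<phi> \<psi> assume auts: "(A :: ('r, 'm) gmod, \<phi>) \<in> T_Aut" "(A, \<psi>) \<in> T_Aut"
    then show "Poly_Mapping.keys (frag_of (A, gcomp A A A \<psi> \<phi>) - frag_of (A, \<psi>) - frag_of (A, \<phi>)) \<subseteq> T_Aut \<and>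
        U_free (frag_of (A, gcomp A A A \<psi> \<phi>) - frag_of (A, \<psi>) - frag_of (A, \<phi>)) = \<one>\<^bsub>K1\<^esub>"
      by (intro rel) (auto simp: T_Aut_gcomp U_free_frag_of K1_aut_class_U_gcomp)
  next
    fix A \<phi> B \<psi> C \<chi>
    assume "(A :: ('r, 'm) gmod, \<phi>) \<in> T_Aut" "(B, \<psi>) \<in> T_Aut" "(C, \<chi>) \<in> T_Aut"
      "T_direct_sum A \<phi> B \<psi> C \<chi>"
    then show "Poly_Mapping.keys (frag_of (C, \<chi>) - frag_of (A, \<phi>) - frag_of (B, \<psi>)) \<subseteq> T_Aut \<and>
        U_free (frag_of (C, \<chi>) - frag_of (A, \<phi>) - frag_of (B, \<psi>)) = \<one>\<^bsub>K1\<^esub>"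
      by (intro rel)
         (auto simp: U_free_frag_of K1_aut_class_U_direct_sum K1_aut_class_U_closed K1.m_comm)
  qed
  then show "Poly_Mapping.keys c \<subseteq> T_Aut" "U_free c = \<one>\<^bsub>K1\<^esub>" by auto
qed

lemma K1_T_kernel_U_free:
  assumes "c \<in> K1_T_kernel"
  shows "Poly_Mapping.keys c \<subseteq> T_Aut \<and> U_free c = \<one>\<^bsub>K1\<^esub>"
  using assms unfolding K1_T_kernel_def
proof (induction rule: generate.induct)
  case (inv h)
  show ?case using K1_T_relations_kernel [OF inv] by (simp add: U_free_uminus)
next
  case (eng g h)
  show ?case using eng Poly_Mapping.keys_add [of g h] by (auto simp: U_free_add)
qed (auto simp: U_free_zero K1_T_relations_kernel)

text \<open>The class is a coset of the kernel, on which \<open>U_free\<close> is constant; since 0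
  lies in the kernel, the image is a singleton and \<open>the_elem\<close> returns its
  element.\<close>

theorem U_K1_class:
  assumes "(A, \<phi>) \<in> T_Aut"
  shows "U_K1 (K1_T_class A \<phi>) = K1_aut_class (U_obj A) (U_map A A \<phi>)"
proof -
  have "U_free (c + frag_of (A, \<phi>)) = K1_aut_class (U_obj A) (U_map A A \<phi>)" if "c \<in> K1_T_kernel" for c
    using K1_T_kernel_U_free [OF that] assms
    by (simp add: U_free_add U_free_frag_of K1_aut_class_U_closed)
  moreover have "0 \<in> K1_T_kernel"
    using generate.one [of "free_Abelian_group T_Aut"] by (simp add: K1_T_kernel_def)
  ultimately have "U_free ` K1_T_class A \<phi> = {K1_aut_class (U_obj A) (U_map A A \<phi>)}"
    by (auto simp: K1_T_class_def r_coset_def image_iff)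
  then show ?thesis by (simp add: U_K1_def)
qed

section \<open>Cyclic permutations of odd length\<close>

definition perm_matrix :: "(nat \<Rightarrow> nat) \<Rightarrow> 'a::ring_1 rfmat" where
  "perm_matrix \<sigma> = Rfmat (\<lambda>i j. if j = \<sigma> i then 1 else 0)"

lemma entry_perm_matrix: "entry (perm_matrix \<sigma>) i j = (if j = \<sigma> i then 1 else 0)"
  by (simp add: perm_matrix_def Rfmat_inverse)

lemma perm_matrix_mult: "perm_matrix \<sigma> * perm_matrix \<tau> = perm_matrix (\<lambda>i. \<tau> (\<sigma> i))"
  by (rule rfmat_eqI, subst entry_times_superset [of "{\<sigma> _}"])
     (auto simp: entry_perm_matrix split: if_splits)

lemma perm_matrix_id: "perm_matrix (\<lambda>i. i) = 1"
  by (rule rfmat_eqI) (auto simp: entry_perm_matrix entry_simps)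

lemma stable_perm_matrix:
  assumes "\<And>i. i < m \<Longrightarrow> \<sigma> i < m" "\<And>i. i \<ge> m \<Longrightarrow> \<sigma> i = i"
  shows "stable (perm_matrix \<sigma>)"
proof -
  have "block m (perm_matrix \<sigma> - 1)"
    unfolding block_def
  proof (intro allI impI)
    fix i j assume "m \<le> i \<or> m \<le> j"
    then show "entry (perm_matrix \<sigma> - 1) i j = 0"
      using assms [of i] by (cases "i < m") (auto simp: entry_simps entry_perm_matrix)
  qed
  then show ?thesis by (auto simp: stable_iff)
qed

text \<open>Addition of \<open>a\<close> modulo \<open>m\<close>, for \<open>a\<close> at most
  \<open>m\<close>, written with cases instead of \<open>mod\<close> so that identities reduce to
  linear arithmetic.\<close>

definition rot :: "nat \<Rightarrow> nat \<Rightarrow> nat \<Rightarrow> nat" where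
  "rot m a i = (if i < m then if i + a < m then i + a else i + a - m else i)"

definition reflection :: "nat \<Rightarrow> nat \<Rightarrow> nat" where
  "reflection m i = (if 0 < i \<and> i < m then m - i else i)"

text \<open>Modulo 2k + 1 the rotation by 2k is the one by -1, and its square root is the rotation
  \<open>?s\<close> by k. The inverse of \<open>?s\<close> is the rotation \<open>?s'\<close> by k +
  1, which the map i -> -i intertwines with \<open>?s\<close>; hence \<open>?s * ?s\<close> has the
  class of \<open>?s * ?s' = 1\<close>.\<close>

lemma K1_class_rot:
  defines "m \<equiv> \<lambda>k. 2 * k + 1"
  shows "is_GL (perm_matrix (rot (m k) (2 * k)) :: 'a::ring_1 rfmat)"
    and "K1_class (perm_matrix (rot (m k) (2 * k)) :: 'a::ring_1 rfmat) = \<one>\<^bsub>K1\<^esub>"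
proof -
  let ?s = "perm_matrix (rot (m k) k) :: 'a rfmat" and ?s' = "perm_matrix (rot (m k) (k + 1)) :: 'a rfmat"
    and ?r = "perm_matrix (reflection (m k)) :: 'a rfmat"
  have st: "stable ?s" "stable ?s'" "stable ?r"
    by (rule stable_perm_matrix [of "m k"]; auto simp: rot_def reflection_def m_def)+
  have ss': "?s * ?s' = 1" "?s' * ?s = 1"
    unfolding perm_matrix_mult perm_matrix_id [symmetric]
    by (rule arg_cong [where f = perm_matrix], auto simp: rot_def m_def fun_eq_iff)+
  have rr: "?r * ?r = 1"
    unfolding perm_matrix_mult perm_matrix_id [symmetric]
    by (rule arg_cong [where f = perm_matrix]) (auto simp: reflection_def fun_eq_iff)
  have rs: "?r * ?s' = ?s * ?r"
    unfolding perm_matrix_mult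
    by (rule arg_cong [where f = perm_matrix]) (auto simp: rot_def reflection_def m_def fun_eq_iff)
  have ss: "?s * ?s = perm_matrix (rot (m k) (2 * k))"
    unfolding perm_matrix_mult
    by (rule arg_cong [where f = perm_matrix]) (auto simp: rot_def m_def fun_eq_iff)
  have GL: "is_GL ?s" "is_GL ?s'" "is_GL ?r"
    using st ss' rr by (blast intro: is_GLI)+
  then show "is_GL (perm_matrix (rot (m k) (2 * k)) :: 'a rfmat)"
    by (simp add: is_GL_mult flip: ss)
  have "K1_class ?s \<otimes>\<^bsub>K1\<^esub> K1_class ?s = K1_class ?s \<otimes>\<^bsub>K1\<^esub> K1_class ?s'"
    using K1_class_conj [OF GL(3) GL(2) GL(1) rs] by simp
  then show "K1_class (perm_matrix (rot (m k) (2 * k)) :: 'a rfmat) = \<one>\<^bsub>K1\<^esub>"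
    using GL ss' by (simp add: K1_class_one flip: K1_class_mult ss)
qed

section \<open>The shift on a grid\<close>

definition seq_module :: "nat \<Rightarrow> ('r::ring_1, nat \<Rightarrow> 'r) module" where
  "seq_module d = \<lparr>carrier = {c. \<forall>i\<ge>d. c i = 0}, monoid.mult = undefined, monoid.one = undefined,
     ring.zero = (\<lambda>_. 0), ring.add = (\<lambda>a b i. a i + b i), module.smult = (\<lambda>r a i. r * a i)\<rparr>"

lemma seq_module_simps [simp]:
  "a \<in> carrier (seq_module d) \<longleftrightarrow> (\<forall>i\<ge>d. a i = 0)"
  "\<zero>\<^bsub>seq_module d\<^esub> = (\<lambda>_. 0)"
  "a \<oplus>\<^bsub>seq_module d\<^esub> b = (\<lambda>i. a i + b i)"
  "r \<odot>\<^bsub>seq_module d\<^esub> a = (\<lambda>i. r * a i)"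
  by (simp_all add: seq_module_def)

lemma left_module_seq: "left_module (seq_module d)"
proof (intro left_module.intro left_module_axioms.intro abelian_groupI)
  fix a :: "nat \<Rightarrow> 'a" assume "a \<in> carrier (seq_module d)"
  then show "\<exists>b\<in>carrier (seq_module d). b \<oplus>\<^bsub>seq_module d\<^esub> a = \<zero>\<^bsub>seq_module d\<^esub>"
    by (intro bexI [of _ "\<lambda>i. - a i"]) auto
qed (auto simp: algebra_simps)

definition unit_seq :: "nat \<Rightarrow> nat \<Rightarrow> 'r::ring_1" where
  "unit_seq i = (\<lambda>j. if j = i then 1 else 0)"

lemma fg_free_seq: "fg_free (seq_module d :: ('r::ring_1, nat \<Rightarrow> 'r) module)"
proof -
  let ?M = "seq_module d :: ('r, nat \<Rightarrow> 'r) module"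
  let ?b = "\<lambda>i. if i < d then unit_seq i else (\<lambda>_. 0)" and ?f = "\<lambda>i a. if i < d then a i else 0"
  interpret left_module ?M by (rule left_module_seq)
  have sum: "(\<Oplus>\<^bsub>?M\<^esub>i\<in>I. g i) = (\<lambda>j. \<Sum>i\<in>I. g i j)" if "g \<in> I \<rightarrow> carrier ?M" for g and I :: "nat set"
    using that
  proof (induction I rule: infinite_finite_induct)
    case (insert i I)
    then have "g i \<in> carrier ?M" "g \<in> I \<rightarrow> carrier ?M" by auto
    then show ?case using insert by (simp del: seq_module_simps(1))
  qed auto
  have "frame ?M d ?b ?f"
    unfolding frame_def
  proof (intro conjI allI ballI impI)
    fix a :: "nat \<Rightarrow> 'r" assume a: "a \<in> carrier ?M"
    have "(\<Sum>i<d. ?f i a * ?b i j) = (\<Sum>i<d. if i = j then a i else 0)" for j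
      by (intro sum.cong) (auto simp: unit_seq_def)
    then have "(\<Sum>i<d. ?f i a * ?b i j) = a j" for j using a by simp
    then show "a = (\<Oplus>\<^bsub>?M\<^esub>i\<in>{..<d}. ?f i a \<odot>\<^bsub>?M\<^esub> ?b i)"
      by (subst sum) (auto simp: unit_seq_def)
  qed (auto simp: functional_def unit_seq_def)
  then have "is_basis ?M (map ?b [0..<d])"
    by (rule is_basis_of_frame [OF left_module_seq]) (auto simp: unit_seq_def)
  then show ?thesis using left_module_seq by (auto simp: fg_free_def)
qed

definition grid_module :: "nat \<Rightarrow> 'r::ring_1 geometric" where
  "grid_module m x = seq_module (if of_nat m * x \<in> \<int> then 1 else 0)"

text \<open>A general step \<open>s\<close> lets the same lemmas serve the shift and its inverse.
  The value off the target, the zero sequence, is the zero of every module of the family.\<close>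

definition grid_shift :: "nat \<Rightarrow> int \<Rightarrow> 'r::ring_1 geometric_mor" where
  "grid_shift m s = (\<lambda>x y. \<lambda>a\<in>carrier (grid_module m x). if y = x + of_int s / of_nat m then a else (\<lambda>_. 0))"

lemma grid_point_shift:
  assumes "m > 0"
  shows "of_nat m * (x + of_int s / of_nat m) \<in> \<int> \<longleftrightarrow> of_nat m * x \<in> (\<int> :: real set)"
proof -
  have "of_nat m * (x + of_int s / of_nat m) = of_nat m * x + of_int s"
    using assms by (simp add: field_simps)
  then show ?thesis by (metis Ints_add Ints_diff Ints_of_int add_diff_cancel_right')
qed

lemma grid_module_shift: "m > 0 \<Longrightarrow> grid_module m (x + of_int s / of_nat m) = grid_module m x"
  by (simp only: grid_module_def grid_point_shift)

lemma invariant_family_grid: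
  assumes "m > 0"
  shows "invariant_family (grid_module m :: 'r::ring_1 geometric)"
proof (rule invariant_family.intro)
  fix x
  show "left_module (grid_module m x :: ('r, nat \<Rightarrow> 'r) module)"
    by (simp add: grid_module_def left_module_seq)
  show "(grid_module m (x + 1) :: ('r, nat \<Rightarrow> 'r) module) = grid_module m x"
    using grid_module_shift [OF assms, of x "int m"] assms by simp
qed

lemma grid_module_T_obj:
  assumes "m > 0"
  shows "grid_module m \<in> T_obj"
proof -
  interpret invariant_family "grid_module m :: 'a geometric" by (rule invariant_family_grid [OF assms])
  let ?S = "gsupport (grid_module m :: 'a geometric)"
  have S: "of_nat m * x \<in> \<int>" if "x \<in> ?S" for x
    using that by (auto simp: gsupport_def grid_module_def split: if_splits)
  have "\<exists>W. open W \<and> x \<in> W \<and> finite (W \<inter> ?S)" for x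
  proof (intro exI conjI)
    have "{x - 1<..<x + 1} \<inter> ?S \<subseteq>
        (\<lambda>k. of_int k / of_nat m) ` {\<lfloor>of_nat m * (x - 1)\<rfloor>..\<lceil>of_nat m * (x + 1)\<rceil>}"
    proof
      fix y assume y: "y \<in> {x - 1<..<x + 1} \<inter> ?S"
      then obtain k where k: "of_nat m * y = of_int k" using S by (auto elim: Ints_cases)
      have "of_nat m * (x - 1) \<le> of_nat m * y" "of_nat m * y \<le> of_nat m * (x + 1)"
        using y by (auto intro: mult_left_mono)
      then have "k \<in> {\<lfloor>of_nat m * (x - 1)\<rfloor>..\<lceil>of_nat m * (x + 1)\<rceil>}"
        unfolding k by (auto simp: floor_le_iff le_ceiling_iff)
      moreover have "y = of_int k / of_nat m" using k assms by (simp add: field_simps)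
      ultimately show "y \<in> (\<lambda>k. of_int k / of_nat m) ` {\<lfloor>of_nat m * (x - 1)\<rfloor>..\<lceil>of_nat m * (x + 1)\<rceil>}"
        by blast
    qed
    then show "finite ({x - 1<..<x + 1} \<inter> ?S)" by (rule finite_subset) simp
  qed auto
  moreover have "?S \<subseteq> {x + of_int k |x k. x \<in> {0..1}}"
  proof
    fix x assume "x \<in> ?S"
    show "x \<in> {x + of_int k |x k. x \<in> {0..1}}"
      by (rule CollectI, rule exI [of _ "frac x"], rule exI [of _ "\<lfloor>x\<rfloor>"])
         (simp add: frac_def, linarith)
  qed
  moreover have "fg_free (grid_module m x :: ('a, nat \<Rightarrow> 'a) module)" for x
    by (simp add: grid_module_def fg_free_seq)
  ultimately show ?thesis
    using compact_Icc [of "0::real" 1] periodic unfolding T_obj_def geometric_module_def by blast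
qed

lemma supp_grid_shift:
  "supp (grid_module m) (grid_module m) (grid_shift m s) \<subseteq> {(x, y). y = x + of_int s / of_nat m}"
  by (auto simp: supp_def grid_shift_def grid_module_def)

lemma grid_zero [simp]: "\<zero>\<^bsub>grid_module m x\<^esub> = (\<lambda>_. 0)"
  by (simp add: grid_module_def)

lemma grid_shift_T_hom:
  assumes m: "m > 0"
  shows "(grid_shift m s :: 'r::ring_1 geometric_mor) \<in> T_hom (grid_module m) (grid_module m)"
  unfolding T_hom_iff
proof (intro conjI allI)
  let ?A = "grid_module m :: 'r geometric" and ?\<xi> = "grid_shift m s :: 'r geometric_mor"
  interpret invariant_family ?A by (rule invariant_family_grid [OF m])
  fix x y
  show "left_linear (?A x) (?A y) (?\<xi> x y)"
  proof (cases "y = x + of_int s / of_nat m")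
    case True
    then show ?thesis
      by (auto simp: left_linear_def grid_shift_def grid_module_shift [OF m] M.smult_closed)
  next
    case False
    then show ?thesis
      by (auto simp: left_linear_def grid_shift_def M.smult_closed) (auto simp: grid_module_def)
  qed
  show "?\<xi> x y \<in> extensional (carrier (?A x))"
    by (simp add: grid_shift_def)
  show "?\<xi> (x + 1) (y + 1) = ?\<xi> x y"
    by (auto simp: grid_shift_def periodic fun_eq_iff)
  let ?S = "supp ?A ?A ?\<xi>"
  have "{x. (x, y) \<in> ?S} \<subseteq> {y - of_int s / of_nat m}" "{y. (x, y) \<in> ?S} \<subseteq> {x + of_int s / of_nat m}"
    using supp_grid_shift [of m s] by auto
  then show "finite {x. (x, y) \<in> ?S}" "finite {y. (x, y) \<in> ?S}"
    by (meson finite.emptyI finite.insertI finite_subset)+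
qed

lemma gcomp_grid_shift:
  assumes m: "m > 0"
  shows "gcomp (grid_module m :: 'r::ring_1 geometric) (grid_module m) (grid_module m)
    (grid_shift m (- s)) (grid_shift m s) = gid (grid_module m)"
proof (rule ext, rule ext, rule ext)
  interpret invariant_morphism_pair "grid_module m :: 'r geometric" "grid_module m" "grid_module m"
      "grid_shift m s" "grid_shift m (- s)"
    by (simp add: invariant_morphism_pair_def invariant_morphism_def invariant_morphism_axioms_def
        invariant_family_grid [OF m] grid_shift_T_hom [OF m])
  let ?A = "grid_module m :: 'r geometric"
  fix x z and a :: "nat \<Rightarrow> 'r"
  show "gcomp ?A ?A ?A (grid_shift m (- s)) (grid_shift m s) x z a = gid ?A x z a"
  proof (cases "a \<in> carrier (?A x)")
    case True
    let ?y = "x + of_int s / of_nat m"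
    have a: "a \<in> carrier (?A ?y)" using True by (simp add: grid_module_shift [OF m])
    \<comment> \<open>On the grid the support of the row is the single point \<open>?y\<close>; off
      the grid it is empty, so the sum is enlarged to \<open>{?y}\<close> by zero terms.\<close>
    have "(\<Oplus>\<^bsub>?A z\<^esub>y\<in>{y. (x, y) \<in> supp ?A ?A (grid_shift m s)}. grid_shift m (- s) y z (grid_shift m s x y a))
        = (\<Oplus>\<^bsub>?A z\<^esub>y\<in>{?y}. grid_shift m (- s) y z (grid_shift m s x y a))"
      using True supp_grid_shift [of m s] \<phi>.component_outside_supp [OF _ True]
        \<psi>.component_zero [unfolded grid_zero]
      by (intro \<phi>.A.M.add.finprod_mono_neutral_cong_left) auto
    also have "\<dots> = grid_shift m (- s) ?y z (grid_shift m s x ?y a)"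
      using True by (simp del: grid_zero)
    also have "\<dots> = gid ?A x z a"
      using True a by (auto simp: grid_shift_def gid_def)
    finally show ?thesis using True by (simp add: gcomp_def)
  qed (simp add: gcomp_def gid_def)
qed

lemma grid_shift_inverse:
  "m > 0 \<Longrightarrow> T_inverse (grid_module m) (grid_shift m s) (grid_shift m (- s))"
  using gcomp_grid_shift [of m s] gcomp_grid_shift [of m "- s"]
  by (simp add: T_inverse_def grid_shift_T_hom)

lemma controlled_grid_shift:
  "of_int \<bar>s\<bar> / of_nat m < \<epsilon> \<Longrightarrow> controlled \<epsilon> (grid_module m) (grid_module m) (grid_shift m s)"
  using supp_grid_shift [of m s] by (fastforce simp: controlled_def)

lemma of_int_divide_Ints_iff:
  assumes "m > 0"
  shows "(of_int i / of_nat m :: real) \<in> \<int> \<longleftrightarrow> int m dvd i"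
proof
  assume "(of_int i / of_nat m :: real) \<in> \<int>"
  then obtain l where "(of_int i / of_nat m :: real) = of_int l" by (auto elim: Ints_cases)
  then have "(of_int i :: real) = of_int (int m * l)" using assms by (simp add: field_simps)
  then show "int m dvd i" unfolding of_int_eq_iff by simp
qed (use assms in auto)

section \<open>The matrix of the shift and its class\<close>

text \<open>The rotation by 2k = m - 1 is the map i -> i - 1 on indices, so the matrix of the shift
  factors as \<open>D * ?P\<close>: the rotation has trivial class, and \<open>D\<close> is the
  stabilised t.\<close>

lemma U_grid_shift_class:
  fixes k :: nat
  defines "m \<equiv> 2 * k + 1"
  shows "K1_aut_class (U_obj (grid_module m :: 'r::ring_1 geometric)) (U_map (grid_module m) (grid_module m) (grid_shift m 1))
    = K1_unit_class laurent_t"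
proof -
  let ?A = "grid_module m :: 'r geometric"
  let ?U = "U_map ?A ?A (grid_shift m 1)"
  have m: "m > 0" by (simp add: m_def)
  interpret invariant_morphism ?A ?A "grid_shift m 1"
    by (simp add: invariant_morphism_def invariant_morphism_axioms_def
        invariant_family_grid [OF m] grid_shift_T_hom [OF m])
  define pts where "pts i = - real i / real m" for i :: nat
  define e where "e = (unit_seq 0 :: nat \<Rightarrow> 'r)"
  have pts_eq: "pts i = 0 + of_int (- int i) / of_nat m" for i by (simp add: pts_def)
  have Apts: "?A (pts i) = seq_module 1" for i
    using grid_module_shift [OF m, of 0 "- int i"] by (simp add: pts_def grid_module_def)
  have e: "e \<in> carrier (?A (pts i))" for i by (simp add: Apts e_def unit_seq_def)
  have h: "functional (?A (pts i)) (\<lambda>a. a 0)" for i by (simp add: Apts functional_def)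
  have expand: "a = (\<Oplus>\<^bsub>?A x\<^esub>i\<in>{i. i < m \<and> x - pts i \<in> \<int>}. a 0 \<odot>\<^bsub>?A x\<^esub> e)" if a: "a \<in> carrier (?A x)" for x a
  proof (cases "of_nat m * x \<in> \<int>")
    case True
    then obtain q where "of_nat m * x = of_int q" by (auto elim: Ints_cases)
    then have q: "x = of_int q / of_nat m" using m by (simp add: field_simps)
    \<comment> \<open>The point q/m lies in the orbit of -i/m iff m divides q + i, which has exactly
      one solution i below m.\<close>
    define i0 where "i0 = nat ((- q) mod int m)"
    have i0: "int i0 = (- q) mod int m" using m by (simp add: i0_def)
    have Ax: "?A x = seq_module 1" using True by (simp add: grid_module_def)
    have "{i. i < m \<and> x - pts i \<in> \<int>} = {i0}"
    proof -
      have "x - pts i = of_int (q + int i) / of_nat m" for i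
        by (simp add: q pts_def add_divide_distrib)
      then have iff: "x - pts i \<in> \<int> \<longleftrightarrow> int m dvd (q + int i)" for i
        using of_int_divide_Ints_iff [OF m, of "q + int i"] by simp
      have "int m dvd (q + int i) \<longleftrightarrow> i = i0" if "i < m" for i
      proof -
        have "int m dvd (q + int i) \<longleftrightarrow> int i mod int m = (- q) mod int m"
          by (simp add: mod_eq_dvd_iff add.commute)
        then show ?thesis using that i0 by (metis of_nat_eq_iff of_nat_less_iff of_nat_mod mod_less)
      qed
      moreover have "i0 < m" using i0 m by (metis of_nat_0_less_iff of_nat_less_iff pos_mod_bound)
      ultimately show ?thesis using iff by auto
    qed
    moreover have "a 0 \<odot>\<^bsub>?A x\<^esub> e \<in> carrier (?A x)" by (simp add: Ax e_def unit_seq_def)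
    then have "(\<Oplus>\<^bsub>?A x\<^esub>i\<in>{i0}. a 0 \<odot>\<^bsub>?A x\<^esub> e) = a 0 \<odot>\<^bsub>?A x\<^esub> e" by (simp del: grid_zero)
    moreover have "a = a 0 \<odot>\<^bsub>?A x\<^esub> e"
      using a by (auto simp: Ax e_def unit_seq_def fun_eq_iff)
    ultimately show ?thesis by simp
  next
    case False
    have "x - pts i \<notin> \<int>" for i
    proof
      assume "x - pts i \<in> \<int>"
      then have "of_nat m * (x - pts i) - of_nat i \<in> \<int>" by auto
      moreover have "of_nat m * (x - pts i) - of_nat i = of_nat m * x"
        using m by (simp add: pts_def field_simps)
      ultimately show False using False by simp
    qed
    then have "{i. i < m \<and> x - pts i \<in> \<int>} = {}" by simp
    moreover have "a = \<zero>\<^bsub>?A x\<^esub>" using a False by (auto simp: grid_module_def)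
    ultimately show ?thesis by (simp only: A.M.finsum_empty)
  qed
  have dual: "pts i = pts j \<and> e 0 = (if i = j then 1 else 0)" if "i < m" "j < m" "pts i - pts j \<in> \<int>" for i j
  proof -
    have "pts i - pts j = of_int (int j - int i) / of_nat m"
      by (simp add: pts_def diff_divide_distrib)
    then have "int m dvd int j - int i" using that of_int_divide_Ints_iff [OF m] by metis
    then have "int j mod int m = int i mod int m" by (simp add: mod_eq_dvd_iff)
    then have "i = j" using that by simp
    then show ?thesis by (simp add: e_def unit_seq_def)
  qed
  define b where "b = (\<lambda>i. if i < m then A.delta (pts i) e else \<zero>\<^bsub>U_obj ?A\<^esub>)"
  define f where "f = (\<lambda>i. if i < m then A.laurent_coord (pts i) (\<lambda>a. a 0) else (\<lambda>_. 0))"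
  have fr: "frame (U_obj ?A) m b f"
    unfolding b_def f_def
    by (rule A.frame_U(1) [where els = "\<lambda>_. e" and fs = "\<lambda>_ a. a 0"])
       (assumption | rule e | rule h | erule expand)+
  have fb: "f j (b i) = (if i = j then 1 else 0)" if "i < m" "j < m" for i j
    unfolding b_def f_def
    by (rule A.frame_U(2) [where n = m and pts = pts and els = "\<lambda>_. e" and fs = "\<lambda>_ a. a 0"])
       (assumption | rule e | rule h | erule expand | rule dual | rule that)+
  have U_delta: "?U (A.delta (pts i) e) = A.delta (pts i + 1 / real m) e" for i
  proof
    fix y
    show "?U (A.delta (pts i) e) y = A.delta (pts i + 1 / real m) e y"
      using e [of i] by (simp add: U_map_delta) (simp add: grid_shift_def A.delta_def)
  qed
  have Ub: "?U (b i) = (if i = 0 then Poly_Mapping.single 1 1 \<odot>\<^bsub>U_obj ?A\<^esub> b (m - 1) else b (i - 1))"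
    if i: "i < m" for i
  proof (cases "i = 0")
    case True
    \<comment> \<open>The wrap-around: the shift carries 0 to 1/m, which is the translate by t of
      the last base point -(m - 1)/m.\<close>
    have "pts (m - 1) + 1 = pts 0 + 1 / real m" using m by (simp add: pts_def field_simps)
    moreover have "1 \<odot>\<^bsub>?A (pts (m - 1))\<^esub> e = e" using e by (rule A.M.smult_one)
    ultimately show ?thesis
      using True m e [of "m - 1"] by (simp add: b_def U_delta A.single_smult_delta)
  next
    case False
    then have "pts (i - 1) = pts i + 1 / real m" using m by (simp add: pts_def field_simps of_nat_diff)
    moreover have "i - 1 < m" using i by simp
    ultimately show ?thesis using False i by (simp add: b_def U_delta)
  qed
  define D where "D = (Rfmat (stabilize 1 (\<lambda>_ _. laurent_t)) :: (int \<Rightarrow>\<^sub>0 'r) rfmat)"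
  let ?P = "perm_matrix (rot m (2 * k)) :: (int \<Rightarrow>\<^sub>0 'r) rfmat"
  have entry_D: "entry D i j = (if i = j then if i = 0 then laurent_t else 1 else 0)" for i j
    unfolding D_def entry_Rfmat_stabilize by (simp add: stabilize_def)
  have DP: "entry (D * ?P) i j = (if i = 0 then laurent_t else 1) * (if j = rot m (2 * k) i then 1 else 0)" for i j
    by (subst entry_times_superset [of "{i}"]) (auto simp: entry_D entry_perm_matrix)
  have rot: "rot m (2 * k) i = (if i = 0 then m - 1 else if i < m then i - 1 else i)" for i
    by (auto simp: rot_def m_def)
  have frame_eq: "frame_aut b f ?U = D * ?P"
  proof (rule rfmat_eqI)
    fix i j
    have ent: "entry (frame_aut b f ?U) i j = (if i = j then 1 else 0) - f j (b i) + f j (?U (b i))"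
      by (simp add: frame_aut_def entry_simps entry_frame_matrix [OF fr])
    \<comment> \<open>Outside the corner both sides are the identity: the padded vectors and
      functionals vanish, and the rotation fixes all indices from m on.\<close>
    consider "i < m" "j < m" | "i < m" "j \<ge> m" | "i \<ge> m" by linarith
    then show "entry (frame_aut b f ?U) i j = entry (D * ?P) i j"
    proof cases
      case 1
      have "f j (Poly_Mapping.single 1 1 \<odot>\<^bsub>U_obj ?A\<^esub> b (m - 1)) = laurent_t * f j (b (m - 1))"
        unfolding laurent_t_def by (rule functional_smult [OF frameD(2) [OF fr] frameD(1) [OF fr]])
      moreover have "b i \<in> carrier (U_obj ?A)" by (rule frameD(1) [OF fr])
      ultimately show ?thesis using 1 fb
        by (auto simp: ent DP Ub rot m)
    next
      case 2
      then show ?thesis using m by (auto simp: ent DP frameD(4) [OF fr] rot)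
    next
      case 3
      then have "b i = \<zero>\<^bsub>U_obj ?A\<^esub>" by (simp add: b_def)
      then have "f j (b i) = 0" "f j (?U (b i)) = 0"
        using functional_zero [OF A.U.left_module_axioms frameD(2) [OF fr]]
          left_linear_zero [OF A.U.left_module_axioms A.U.left_module_axioms U_map_linear] by simp_all
      then show ?thesis using 3 m by (auto simp: ent DP rot)
    qed
  qed
  \<comment> \<open>The inverse of t is the monomial of degree -1; membership of \<open>D\<close> in
    \<open>GL\<close> requires an inverse that is itself stable.\<close>
  define D' where "D' = (Rfmat (stabilize 1 (\<lambda>_ _. Poly_Mapping.single (- 1) 1)) :: (int \<Rightarrow>\<^sub>0 'r) rfmat)"
  have entry_D': "entry D' i j = (if i = j then if i = 0 then Poly_Mapping.single (- 1) 1 else 1 else 0)" for i j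
    unfolding D'_def entry_Rfmat_stabilize by (simp add: stabilize_def)
  have "D * D' = 1" "D' * D = 1"
    by (rule rfmat_eqI, subst entry_times_superset [of "{_}"],
        auto simp: entry_D entry_D' one_rfmat.rep_eq laurent_t_def mult_single split: if_splits)+
  moreover have "stable D" "stable D'"
    unfolding stable_def by (rule exI [of _ 1], simp add: entry_D entry_D' stabilize_def fun_eq_iff)+
  ultimately have GL: "is_GL D" by (blast intro: is_GLI)
  have "K1_class (frame_aut b f ?U) = K1_class D"
    using K1_class_rot [of k, where 'a = "int \<Rightarrow>\<^sub>0 'r", folded m_def] GL K1_class_closed [OF GL]
    by (simp add: frame_eq K1_class_mult)
  moreover have "(?A, grid_shift m 1) \<in> T_Aut"
    using grid_module_T_obj [OF m] grid_shift_inverse [OF m] by (auto simp: T_Aut_def)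
  ultimately show ?thesis
    by (simp add: K1_aut_class_U [OF _ fr] K1_unit_class_def K1_matrix_class_eq [of D] D_def)
qed

theorem proposition1p7:
  fixes n :: nat
  assumes "n \<ge> 1"
  shows "\<exists>(A :: 'r::ring_1 geometric) (\<xi> :: 'r geometric_mor).
    eps_automorphism (1 / real n) A \<xi> \<and>
    U_K1 (K1_T_class A \<xi>) = K1_unit_class (laurent_t :: int \<Rightarrow>\<^sub>0 'r)"
proof (intro exI conjI)
  \<comment> \<open>\<open>U_grid_shift_class\<close> is used with k = n; being larger than n,
    \<open>?m\<close> meets the strict bound in \<open>controlled\<close>.\<close>
  let ?m = "2 * n + 1" and ?A = "grid_module (2 * n + 1) :: 'r geometric"
  have m: "?m > 0" by simp
  note inv = grid_shift_inverse [OF m, of 1, where 'a = 'r]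
  show "eps_automorphism (1 / real n) ?A (grid_shift ?m 1)"
    unfolding eps_automorphism_def
    using assms
    by (intro conjI exI [of _ "grid_shift ?m (- 1)"] grid_module_T_obj inv controlled_grid_shift)
       (auto simp: field_simps)
  have "(?A, grid_shift ?m 1) \<in> T_Aut"
    using grid_module_T_obj [OF m] inv by (auto simp: T_Aut_def)
  then show "U_K1 (K1_T_class ?A (grid_shift ?m 1)) = K1_unit_class (laurent_t :: int \<Rightarrow>\<^sub>0 'r)"
    by (simp only: U_K1_class U_grid_shift_class)
qed

end
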